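(* Let $\mathcal{L}=\{L_1,\dots,L_k\}$ be a set of lines in $\mathbb{R}^d$ in general position, and let $G=(\mathcal{V},\mathcal{E})$, $\mathcal{V}=\bigcup_{i=1}^k V_i$, be a crossing partitioned graph. Suppose that $p\in\mathcal{L}^{\mathcal{V}}$ is $\mathcal{L}$-generic and that $(G,p)$ is globally $\mathcal{L}$-rigid. Then $(G-uv,p)$ is infinitesimally $\mathcal{L}$-rigid for any edge $uv\in\mathcal{E}$.
   Context: Every line in $\mathbb{R}^d$ has a unique standard equation $Ax=b$ with $(A,b)$ a $(d-1)\times(d+1)$ matrix in reduced row echelon form; $A_i x=b_i$ is that of $L_i$. $\mathbb{Q}(\mathcal{L})$ is the smallest subfield of $\mathbb{R}$ containing all entries of all $(A_i,b_i)$. Three pairwise non-parallel lines $L_1,L_2,L_3$ are weakly concurrent if the closest point in $L_1$ to $L_2$ coincides with the closest point in $L_1$ to $L_3$. $\mathcal{L}$ is in general position if no two lines in $\mathcal{L}$ are parallel, no two are perpendicular, and no three (in any order) are weakly concurrent. A partitioned graph is a finite (simple, undirected) graph $G=(\mathcal{V},\mathcal{E})$ with a partition $\mathcal{V}=\bigcup_{i=1}^k V_i$ (some $V_i$ may be empty; edges inside a part are allowed). $G$ is crossing if at least two of the $V_i$ are non-empty. $\mathcal{L}[G]=\{L_i: V_i\neq\emptyset\}$. $\mathcal{L}^{\mathcal{V}}$ is the set of $p:\mathcal{V}\to\mathbb{R}^d$ with $p(V_i)\subset L_i$ for all $i$. $\mathbb{Q}(\mathcal{L},p)$ is the smallest subfield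 of $\mathbb{R}$ containing $\mathbb{Q}(\mathcal{L})$ and all coordinates of all $p(v)$; $p$ is $\mathcal{L}$-generic if the transcendence degree of $\mathbb{Q}(\mathcal{L},p)$ over $\mathbb{Q}(\mathcal{L})$ is $|\mathcal{V}|$. $M_G(p)=(\|p(u)-p(v)\|^2)_{uv\in\mathcal{E}}$. For a set of lines $\mathcal{M}$, $\mathrm{Isom}(\mathcal{M})$ is the group of maps $\theta:\bigcup_{L\in\mathcal{M}}L\to\bigcup_{L\in\mathcal{M}}L$ preserving Euclidean distances and satisfying $\theta(L)=L$ for all $L\in\mathcal{M}$. $(G,p)$ is globally $\mathcal{L}$-rigid if for $q\in\mathcal{L}^{\mathcal{V}}$, $M_G(q)=M_G(p)$ implies $q=\theta\circ p$ for some $\theta\in\mathrm{Isom}(\mathcal{L}[G])$. An infinitesimal flex of $(G,p)$ is $f:\mathcal{V}\to\mathbb{R}^d$ with $(p(u)-p(v))\cdot(f(u)-f(v))=0$ for all $uv\in\mathcal{E}$ and $A_i f(v)=0$ for all $i$, $v\in V_i$. $(G,p)$ is infinitesimally $\mathcal{L}$-rigid if the space of infinitesimal flexes has dimension $1$ when all lines in $\mathcal{L}[G]$ are parallel, and $0$ otherwise. $G-uv$ denotes $G$ with the edge $uv$ deleted (same vertex set and partition). *)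

theory Defs
  imports
    "HOL-Analysis.Analysis"
    "HOL-Library.Poly_Mapping"
    "HOL-Library.Extended_Nat"
    "Jordan_Normal_Form.Gauss_Jordan_Elimination"
begin

no_notation Matrix.vec_index (infixl "$" 100)
no_notation Matrix.scalar_prod (infix "\<bullet>" 70)

section \<open>Lines and their standard equations\<close>

definition is_line :: "(real ^ 'd) set \<Rightarrow> bool" where
  "is_line L \<longleftrightarrow> affine L \<and> aff_dim L = 1"

text \<open>The linear order on the index type \<^typ>\<open>'d\<close> is only there to fix the order of the coordinates,
  on which reduced row echelon form depends.\<close>

definition coords :: "real ^ 'd::{finite,linorder} \<Rightarrow> real vec" where
  "coords x = Matrix.vec CARD('d) (\<lambda>j. x $ (sorted_list_of_set (UNIV :: 'd set) ! j))"

text \<open>An augmented matrix \<open>(A,b)\<close> is split into \<open>A\<close> and \<open>b\<close>.\<close>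

definition coeff_part :: "real mat \<Rightarrow> real mat" where
  "coeff_part C = Matrix.mat (dim_row C) (dim_col C - 1) (\<lambda>ij. C $$ ij)"

definition rhs_part :: "real mat \<Rightarrow> real vec" where
  "rhs_part C = col C (dim_col C - 1)"

text \<open>The library predicate \<^const>\<open>row_echelon_form\<close> means \<^emph>\<open>reduced\<close> row echelon form: pivots
  are 1 and are the only non-zero entries of their columns.\<close>

definition is_standard_equation :: "real mat \<Rightarrow> (real ^ 'd::{finite,linorder}) set \<Rightarrow> bool" where
  "is_standard_equation C L \<longleftrightarrow>
     C \<in> carrier_mat (CARD('d) - 1) (CARD('d) + 1) \<and> row_echelon_form C \<and>
     L = {x. coeff_part C *\<^sub>v coords x = rhs_part C}"

definition standard_equation :: "(real ^ 'd::{finite,linorder}) set \<Rightarrow> real mat" where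
  "standard_equation L = (THE C. is_standard_equation C L)"

section \<open>Lines in general position\<close>

text \<open>Two lines (possibly skew) are perpendicular when their directions are orthogonal.\<close>

definition perpendicular :: "(real ^ 'd) set \<Rightarrow> (real ^ 'd) set \<Rightarrow> bool" where
  "perpendicular L M \<longleftrightarrow> (\<forall>x\<in>L. \<forall>y\<in>L. \<forall>z\<in>M. \<forall>w\<in>M. (x - y) \<bullet> (z - w) = 0)"

definition is_closest_point :: "real ^ 'd \<Rightarrow> (real ^ 'd) set \<Rightarrow> (real ^ 'd) set \<Rightarrow> bool" where
  "is_closest_point x L M \<longleftrightarrow> is_arg_min (\<lambda>y. infdist y M) (\<lambda>y. y \<in> L) x"

text \<open>For non-parallel lines the closest point in one to the other is unique, so the
  two closest points coincide iff there is a common one.\<close>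

definition weakly_concurrent ::
    "(real ^ 'd) set \<Rightarrow> (real ^ 'd) set \<Rightarrow> (real ^ 'd) set \<Rightarrow> bool" where
  "weakly_concurrent L1 L2 L3 \<longleftrightarrow>
     \<not> affine_parallel L1 L2 \<and> \<not> affine_parallel L1 L3 \<and> \<not> affine_parallel L2 L3 \<and>
     (\<exists>x. is_closest_point x L1 L2 \<and> is_closest_point x L1 L3)"

definition general_position :: "(real ^ 'd) set set \<Rightarrow> bool" where
  "general_position \<L> \<longleftrightarrow>
     (\<forall>L\<in>\<L>. \<forall>M\<in>\<L>. L \<noteq> M \<longrightarrow> \<not> affine_parallel L M \<and> \<not> perpendicular L M) \<and>
     (\<forall>L1\<in>\<L>. \<forall>L2\<in>\<L>. \<forall>L3\<in>\<L>. distinct [L1, L2, L3] \<longrightarrow> \<not> weakly_concurrent L1 L2 L3)"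

section \<open>Fields generated by real numbers and transcendence degree\<close>

definition is_subfield :: "real set \<Rightarrow> bool" where
  "is_subfield K \<longleftrightarrow> 0 \<in> K \<and> 1 \<in> K \<and>
     (\<forall>x\<in>K. \<forall>y\<in>K. x + y \<in> K \<and> x * y \<in> K) \<and> (\<forall>x\<in>K. - x \<in> K \<and> inverse x \<in> K)"

text \<open>Polynomials are finitely supported maps from monomials (finitely supported exponent
  maps) to coefficients; here the elements of a set of reals themselves serve as the
  variables, and evaluation substitutes each element for itself.\<close>

definition self_eval :: "((real \<Rightarrow>\<^sub>0 nat) \<Rightarrow>\<^sub>0 real) \<Rightarrow> real" where
  "self_eval P = (\<Sum>m\<in>Poly_Mapping.keys P. Poly_Mapping.lookup P m *
     (\<Prod>b\<in>Poly_Mapping.keys m. b ^ Poly_Mapping.lookup m b))"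

definition algebraically_independent :: "real set \<Rightarrow> real set \<Rightarrow> bool" where
  "algebraically_independent K B \<longleftrightarrow>
     (\<forall>P. (\<forall>m\<in>Poly_Mapping.keys P. Poly_Mapping.lookup P m \<in> K \<and> Poly_Mapping.keys m \<subseteq> B) \<and>
          self_eval P = 0 \<longrightarrow> P = 0)"

definition transcendence_degree :: "real set \<Rightarrow> real set \<Rightarrow> enat" where
  "transcendence_degree K F =
     (SUP B\<in>{B. B \<subseteq> F \<and> finite B \<and> algebraically_independent K B}. enat (card B))"

section \<open>Partitioned graphs and their rigidity\<close>

text \<open>The lines are \<open>L 1, \<dots>, L k\<close>. The vertex set is the finite type \<^typ>\<open>'v\<close>, partitioned
  into \<open>V 1, \<dots>, V k\<close>; the edge set is given as a symmetric set \<open>E\<close> of ordered pairs.\<close>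

definition partitioned_graph ::
    "nat \<Rightarrow> ('v::finite \<times> 'v) set \<Rightarrow> (nat \<Rightarrow> 'v set) \<Rightarrow> bool" where
  "partitioned_graph k E V \<longleftrightarrow>
     sym E \<and> irrefl E \<and> disjoint_family_on V {1..k} \<and> (\<Union>i\<in>{1..k}. V i) = UNIV"

definition delete_edge :: "('v \<times> 'v) set \<Rightarrow> 'v \<Rightarrow> 'v \<Rightarrow> ('v \<times> 'v) set" where
  "delete_edge E u v = E - {(u, v), (v, u)}"

definition crossing :: "nat \<Rightarrow> (nat \<Rightarrow> 'v set) \<Rightarrow> bool" where
  "crossing k V \<longleftrightarrow> (\<exists>i\<in>{1..k}. \<exists>j\<in>{1..k}. i \<noteq> j \<and> V i \<noteq> {} \<and> V j \<noteq> {})"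

definition used_lines ::
    "nat \<Rightarrow> (nat \<Rightarrow> (real ^ 'd) set) \<Rightarrow> (nat \<Rightarrow> 'v set) \<Rightarrow> (real ^ 'd) set set" where
  "used_lines k L V = {L i | i. i \<in> {1..k} \<and> V i \<noteq> {}}"

definition realisations ::
    "nat \<Rightarrow> (nat \<Rightarrow> (real ^ 'd) set) \<Rightarrow> (nat \<Rightarrow> 'v set) \<Rightarrow> ('v \<Rightarrow> real ^ 'd) set" where
  "realisations k L V = {p. \<forall>i\<in>{1..k}. p ` V i \<subseteq> L i}"

definition field_of_lines :: "nat \<Rightarrow> (nat \<Rightarrow> (real ^ 'd::{finite,linorder}) set) \<Rightarrow> real set" where
  "field_of_lines k L = is_subfield hull (\<Union>i\<in>{1..k}. elements_mat (standard_equation (L i)))"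

definition field_of_realisation ::
    "nat \<Rightarrow> (nat \<Rightarrow> (real ^ 'd::{finite,linorder}) set) \<Rightarrow> ('v \<Rightarrow> real ^ 'd::{finite,linorder}) \<Rightarrow> real set" where
  "field_of_realisation k L p = is_subfield hull (field_of_lines k L \<union> {p v $ c | v c. True})"

definition generic_realisation ::
    "nat \<Rightarrow> (nat \<Rightarrow> (real ^ 'd::{finite,linorder}) set) \<Rightarrow> ('v::finite \<Rightarrow> real ^ 'd::{finite,linorder}) \<Rightarrow> bool" where
  "generic_realisation k L p \<longleftrightarrow>
     transcendence_degree (field_of_lines k L) (field_of_realisation k L p) = enat CARD('v)"

definition measurement :: "('v \<times> 'v) set \<Rightarrow> ('v \<Rightarrow> real ^ 'd) \<Rightarrow> 'v \<times> 'v \<Rightarrow> real" where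
  "measurement E p = restrict (\<lambda>(u, v). (norm (p u - p v))\<^sup>2) E"

text \<open>Only the values on the union of the lines matter; elements of \<open>Isom\<close> that agree there are
  the same map, so the group is rendered by extensional functions.\<close>

definition Isom :: "(real ^ 'd) set set \<Rightarrow> (real ^ 'd \<Rightarrow> real ^ 'd) set" where
  "Isom \<M> = {\<theta> \<in> (\<Union>\<M>) \<rightarrow>\<^sub>E (\<Union>\<M>).
     (\<forall>x\<in>\<Union>\<M>. \<forall>y\<in>\<Union>\<M>. dist (\<theta> x) (\<theta> y) = dist x y) \<and> (\<forall>L\<in>\<M>. \<theta> ` L = L)}"

definition globally_rigid ::
    "nat \<Rightarrow> (nat \<Rightarrow> (real ^ 'd) set) \<Rightarrow> (nat \<Rightarrow> 'v set) \<Rightarrow> ('v \<times> 'v) set \<Rightarrow>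
     ('v \<Rightarrow> real ^ 'd) \<Rightarrow> bool" where
  "globally_rigid k L V E p \<longleftrightarrow>
     (\<forall>q\<in>realisations k L V. measurement E q = measurement E p \<longrightarrow>
        (\<exists>\<theta>\<in>Isom (used_lines k L V). q = \<theta> \<circ> p))"

text \<open>Flexes are vectors indexed by the vertices (rather than plain functions), so that they
  live in a Euclidean space and \<^const>\<open>dim\<close> applies.\<close>

definition infinitesimal_flexes ::
    "nat \<Rightarrow> (nat \<Rightarrow> (real ^ 'd::{finite,linorder}) set) \<Rightarrow> (nat \<Rightarrow> 'v set) \<Rightarrow> ('v \<times> 'v) set \<Rightarrow>
     ('v::finite \<Rightarrow> real ^ 'd::{finite,linorder}) \<Rightarrow> ((real ^ 'd::{finite,linorder}) ^ 'v) set" where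
  "infinitesimal_flexes k L V E p =
     {f. (\<forall>(u, v)\<in>E. (p u - p v) \<bullet> (f $ u - f $ v) = 0) \<and>
         (\<forall>i\<in>{1..k}. \<forall>v\<in>V i.
            coeff_part (standard_equation (L i)) *\<^sub>v coords (f $ v) = 0\<^sub>v (CARD('d) - 1))}"

definition infinitesimally_rigid ::
    "nat \<Rightarrow> (nat \<Rightarrow> (real ^ 'd::{finite,linorder}) set) \<Rightarrow> (nat \<Rightarrow> 'v set) \<Rightarrow> ('v \<times> 'v) set \<Rightarrow>
     ('v::finite \<Rightarrow> real ^ 'd::{finite,linorder}) \<Rightarrow> bool" where
  "infinitesimally_rigid k L V E p \<longleftrightarrow>
     dim (infinitesimal_flexes k L V E p) =
       (if \<forall>M\<in>used_lines k L V. \<forall>N\<in>used_lines k L V. affine_parallel M N then 1 else 0)"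

section \<open>Existence and uniqueness of the standard equation of a line\<close>

text \<open>Lemma \<open>standard_equation_ex1\<close> shows that the definite description in \<^const>\<open>standard_equation\<close> is
  well defined. The constants introduced here serve only its proof.\<close>

definition solves_system :: "real mat \<Rightarrow> nat \<Rightarrow> (nat \<Rightarrow> real) \<Rightarrow> bool" where
  "solves_system C n x \<longleftrightarrow> (\<forall>i<n-1. (\<Sum>j<n. C $$ (i,j) * x j) = C $$ (i,n))"

definition skip_index :: "nat \<Rightarrow> nat \<Rightarrow> nat" where
  "skip_index c i = (if i < c then i else Suc i)"

definition line_mat :: "nat \<Rightarrow> nat \<Rightarrow> (nat \<Rightarrow> real) \<Rightarrow> (nat \<Rightarrow> real) \<Rightarrow> real mat" where
  "line_mat n c a u = Matrix.mat (n-1) (n+1) (\<lambda>(i,j).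
     if j = skip_index c i then 1 else if j = c then - u (skip_index c i) / u c
     else if j = n then a (skip_index c i) - u (skip_index c i) / u c * a c else 0)"

lemma skip_cover: "c < n \<Longrightarrow> j < n \<Longrightarrow> j \<noteq> c \<Longrightarrow> \<exists>i<n-1. j = skip_index c i"
  by (rule exI[of _ "if j < c then j else j - 1"]) (auto simp: skip_index_def)

lemma skip_less: "c < n \<Longrightarrow> i < n - 1 \<Longrightarrow> skip_index c i < n \<and> skip_index c i \<noteq> c"
  by (auto simp: skip_index_def)

lemma line_mat_solves:
  assumes c: "c < n" "u c \<noteq> 0"
  shows "solves_system (line_mat n c a u) n x \<longleftrightarrow> (\<exists>t. \<forall>j<n. x j = a j + t * u j)"
proof -
  have row: "(\<Sum>j<n. line_mat n c a u $$ (i,j) * x j) = x (skip_index c i) - u (skip_index c i) / u c * x c"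
    if i: "i < n - 1" for i
  proof -
    have s: "skip_index c i < n" "skip_index c i \<noteq> c" using skip_less[OF c(1) i] by auto
    have "(\<Sum>j<n. line_mat n c a u $$ (i,j) * x j) =
      (\<Sum>j<n. (if j = skip_index c i then x j else 0) + (if j = c then - u (skip_index c i) / u c * x j else 0))"
      using i s by (intro sum.cong refl) (auto simp: line_mat_def)
    also have "\<dots> = x (skip_index c i) - u (skip_index c i) / u c * x c"
      using s c by (simp add: sum.distrib)
    finally show ?thesis .
  qed
  have eq: "solves_system (line_mat n c a u) n x \<longleftrightarrow>
     (\<forall>i<n-1. x (skip_index c i) - u (skip_index c i) / u c * x c = a (skip_index c i) - u (skip_index c i) / u c * a c)"
  proof -
    have "line_mat n c a u $$ (i,n) = a (skip_index c i) - u (skip_index c i) / u c * a c" if "i < n - 1" for i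
      using that skip_less[OF c(1) that] c by (auto simp: line_mat_def)
    then show ?thesis using row by (simp add: solves_system_def)
  qed
  show ?thesis
  proof
    assume "solves_system (line_mat n c a u) n x"
    then have h: "\<forall>i<n-1. x (skip_index c i) - u (skip_index c i) / u c * x c = a (skip_index c i) - u (skip_index c i) / u c * a c"
      using eq by simp
    have "x j = a j + (x c - a c) / u c * u j" if jn: "j < n" for j
    proof (cases "j = c")
      case True then show ?thesis using c by simp
    next
      case False
      then obtain i where "i < n-1" "j = skip_index c i" using skip_cover[OF c(1) jn False] by blast
      then have "x j - u j / u c * x c = a j - u j / u c * a c" using h by simp
      then show ?thesis using c by (simp add: field_simps)
    qed
    then show "\<exists>t. \<forall>j<n. x j = a j + t * u j" by blast
  next
    assume "\<exists>t. \<forall>j<n. x j = a j + t * u j"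
    then obtain t where t: "\<forall>j<n. x j = a j + t * u j" by blast
    show "solves_system (line_mat n c a u) n x"
      unfolding eq
    proof (intro allI impI)
      fix i assume i: "i < n - 1"
      have "x (skip_index c i) = a (skip_index c i) + t * u (skip_index c i)" "x c = a c + t * u c"
        using t skip_less[OF c(1) i] c by auto
      then show "x (skip_index c i) - u (skip_index c i) / u c * x c = a (skip_index c i) - u (skip_index c i) / u c * a c"
        using c by (simp add: field_simps)
    qed
  qed
qed

lemma line_mat_echelon:
  assumes c: "c < n" and z: "\<And>j. c < j \<Longrightarrow> j < n \<Longrightarrow> u j = 0"
  shows "row_echelon_form (line_mat n c a u)"
proof -
  have "pivot_fun (line_mat n c a u) (skip_index c) (n + 1)"
  proof (rule pivot_funI[of _ "n-1"])
    fix i j assume i: "i < n - 1" and j: "j < skip_index c i"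
    then have "u (skip_index c i) = 0" if "j = c"
      using z[of "skip_index c i"] skip_less[OF c i] that by auto
    then show "line_mat n c a u $$ (i, j) = 0"
      using i j skip_less[OF c i] by (auto simp: line_mat_def)
  next
    fix i i' assume "i < n - 1" "i' < n - 1" "i' \<noteq> i"
    then show "line_mat n c a u $$ (i', skip_index c i) = 0"
      using skip_less[OF c, of i] by (auto simp: line_mat_def) (auto simp: skip_index_def split: if_splits)
  qed (use c in \<open>auto simp: line_mat_def skip_index_def\<close>)
  then show ?thesis unfolding row_echelon_form_def by (auto simp: line_mat_def)
qed

lemma strict_mono_skip:
  fixes f :: "nat \<Rightarrow> nat"
  assumes "\<And>i. Suc i < m \<Longrightarrow> f i < f (Suc i)" "\<And>i. i < m \<Longrightarrow> f i \<le> m \<and> f i \<noteq> c"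
    and "c \<le> m" "i < m"
  shows "f i = skip_index c i"
proof -
  have lt: "i < j \<Longrightarrow> j < m \<Longrightarrow> f i < f j" for i j
    by (induction j) (auto simp: less_Suc_eq intro: assms(1) less_trans[OF _ assms(1)])
  have ge: "i < m \<Longrightarrow> f i \<ge> i" for i
  proof (induction i)
    case (Suc i) then show ?case using assms(1)[of i] by auto
  qed simp
  have le: "i < m \<Longrightarrow> f i \<le> Suc i" for i
  proof (induction "m - i" arbitrary: i rule: less_induct)
    case less
    show ?case
    proof (cases "Suc i < m")
      case True
      then show ?thesis using less(1)[of "Suc i"] assms(1)[of i] less.prems by linarith
    next
      case False then show ?thesis using assms(2)[of i] less by auto
    qed
  qed
  have stay: "f j = Suc j" if "f i = Suc i" "i \<le> j" "j < m" for i j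
    using that(2,3)
  proof (induction j rule: dec_induct)
    case base then show ?case using that(1) by simp
  next
    case (step j) then show ?case using assms(1)[of j] le[of "Suc j"] by auto
  qed
  show ?thesis
  proof (cases "i < c")
    case True
    have "f i = i"
    proof (rule ccontr)
      assume "f i \<noteq> i"
      then have "f i = Suc i" using ge[of i] le[of i] assms by auto
      moreover have "i \<le> c - 1" "c - 1 < m" using True assms(3) by linarith+
      ultimately have "f (c - 1) = Suc (c - 1)" using stay by blast
      then show False using assms(2)[OF \<open>c - 1 < m\<close>] True by simp
    qed
    then show ?thesis using True by (simp add: skip_index_def)
  next
    case False
    then have "f c = Suc c" using ge[of c] le[of c] assms(2)[of c] assms(4) by auto
    then show ?thesis using stay[of c i] False assms(4) by (auto simp: skip_index_def)
  qed
qed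

lemma echelon_line_unique:
  assumes D: "D \<in> carrier_mat (n-1) (n+1)" and ech: "row_echelon_form D"
    and c: "c < n" "u c \<noteq> 0" and z: "\<And>j. c < j \<Longrightarrow> j < n \<Longrightarrow> u j = 0"
    and sol: "\<And>x. solves_system D n x \<longleftrightarrow> (\<exists>t. \<forall>j<n. x j = a j + t * u j)"
  shows "D = line_mat n c a u"
proof -
  have dim: "dim_row D = n - 1" "dim_col D = n + 1" using D by auto
  obtain f where f: "pivot_fun D f (n+1)" using ech unfolding row_echelon_form_def dim by blast
  note pf = pivot_funD[OF dim(1) f]
  have sa: "solves_system D n a" unfolding sol by (rule exI[of _ 0]) auto
  have hom: "(\<exists>t. \<forall>j<n. x j = t * u j)" if "\<And>i. i < n-1 \<Longrightarrow> (\<Sum>j<n. D $$ (i,j) * x j) = 0" for x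
  proof -
    have "solves_system D n (\<lambda>j. a j + x j)" using sa that by (auto simp: solves_system_def algebra_simps sum.distrib)
    then show ?thesis unfolding sol by auto
  qed
  have homu: "(\<Sum>j<n. D $$ (i,j) * u j) = 0" if "i < n-1" for i
  proof -
    have "solves_system D n (\<lambda>j. a j + u j)" unfolding sol by (rule exI[of _ 1]) auto
    then have "(\<Sum>j<n. D $$ (i,j) * (a j + u j)) = D $$ (i,n)" using that by (auto simp: solves_system_def)
    moreover have "(\<Sum>j<n. D $$ (i,j) * a j) = D $$ (i,n)" using sa that by (auto simp: solves_system_def)
    ultimately show ?thesis by (auto simp: algebra_simps sum.distrib)
  qed
  have fn: "f i \<noteq> n" if i: "i < n-1" for i
  proof
    assume fi: "f i = n"
    have "(\<Sum>j<n. D $$ (i,j) * a j) = 0" using pf(2)[OF i] fi by (intro sum.neutral) auto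
    moreover have "D $$ (i,n) = 1" using pf(4)[OF i] fi by auto
    ultimately show False using sa i by (auto simp: solves_system_def)
  qed
  define R where "R = {i. i < n-1 \<and> f i < n}"
  have piv: "D $$ (i', f i) = (if i' = i then 1 else 0)" if "i \<in> R" "i' < n-1" for i i'
    using that pf(4,5) unfolding R_def by auto
  have injf: "inj_on f R"
    by (rule inj_onI) (metis piv R_def mem_Collect_eq zero_neq_one)
  have zero_row: "D $$ (i,j) = 0" if "i < n-1" "i \<notin> R" "j < n" for i j
    using that pf(1)[of i] pf(2)[of i j] fn[of i] unfolding R_def by force
  have finR: "finite R" "f ` R \<subseteq> {..<n}" unfolding R_def by auto
  have special: "u j \<noteq> 0 \<and> (\<forall>j'<n. j' \<notin> f ` R \<longrightarrow> j' \<noteq> j \<longrightarrow> u j' = 0)"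
    if j: "j < n" "j \<notin> f ` R" for j
  proof -
    define x where "x = (\<lambda>l. if l = j then 1 else if l \<in> f ` R then - D $$ (the_inv_into R f l, j) else 0)"
    have xf: "x (f i) = - D $$ (i,j)" if "i \<in> R" for i
      using that j injf by (auto simp: x_def the_inv_into_f_f)
    have "(\<Sum>l<n. D $$ (i,l) * x l) = 0" if i: "i < n-1" for i
    proof -
      have "(\<Sum>l<n. D $$ (i,l) * x l) = (\<Sum>l\<in>insert j (f ` R). D $$ (i,l) * x l)"
        using finR j by (intro sum.mono_neutral_right) (auto simp: x_def)
      also have "\<dots> = D $$ (i,j) + (\<Sum>l\<in>f ` R. D $$ (i,l) * x l)"
        using finR j by (subst sum.insert) (auto simp: x_def)
      also have "(\<Sum>l\<in>f ` R. D $$ (i,l) * x l) = (\<Sum>i'\<in>R. D $$ (i,f i') * x (f i'))"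
        using injf by (simp add: sum.reindex)
      also have "\<dots> = (\<Sum>i'\<in>R. if i' = i then - D $$ (i,j) else 0)"
        using piv xf i by (intro sum.cong) auto
      also have "\<dots> = - D $$ (i,j)" using finR zero_row[OF i _ j(1)] by auto
      finally show ?thesis by simp
    qed
    then obtain t where t: "\<forall>l<n. x l = t * u l" using hom by blast
    have "t * u j = 1" using t j by (auto simp: x_def)
    moreover have "t * u j' = 0" if "j' < n" "j' \<notin> f ` R" "j' \<noteq> j" for j'
      using t that by (auto simp: x_def)
    ultimately show ?thesis by (metis mult_eq_0_iff zero_neq_one)
  qed
  have "card R \<le> n - 1" using card_mono[of "{..<n-1}" R] by (auto simp: R_def)
  then have "card (f ` R) < card {..<n}" using card_image_le[OF finR(1), of f] c by auto
  then obtain c' where c': "c' < n" "c' \<notin> f ` R"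
    using card_mono[OF finite_imageI[OF finR(1)], of "{..<n}" f] by fastforce
  have only: "f ` R = {..<n} - {c'}"
  proof -
    have "j \<in> f ` R" if "j < n" "j \<noteq> c'" for j
      using special[OF c'] special[OF that(1)] that c' by blast
    then show ?thesis using finR c' by auto
  qed
  have "card R = n - 1" using card_image[OF injf] only c' by simp
  then have R: "R = {..<n-1}"
    by (intro card_subset_eq) (auto simp: R_def)
  have rowsum: "(\<Sum>l<n. D $$ (i,l) * x l) = x (f i) + D $$ (i,c') * x c'" if i: "i < n-1" for i x
  proof -
    have "(\<Sum>l<n. D $$ (i,l) * x l) = D $$ (i,c') * x c' + (\<Sum>l\<in>f ` R. D $$ (i,l) * x l)"
      unfolding only using c' by (subst sum.remove[of _ c']) auto
    also have "(\<Sum>l\<in>f ` R. D $$ (i,l) * x l) = (\<Sum>i'\<in>R. D $$ (i,f i') * x (f i'))"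
      using injf by (simp add: sum.reindex)
    also have "\<dots> = (\<Sum>i'\<in>R. if i' = i then x (f i) else 0)"
      using piv i by (intro sum.cong) auto
    also have "\<dots> = x (f i)" using i R by auto
    finally show ?thesis by simp
  qed
  have uc': "u c' \<noteq> 0" using special[OF c'] by blast
  have uf: "u (f i) = - D $$ (i,c') * u c'" if "i < n-1" for i
    using homu[OF that] rowsum[OF that, of u] by simp
  have "u j = 0" if j: "c' < j" "j < n" for j
  proof -
    have "j \<in> f ` R" using only j by auto
    then obtain i where "i < n-1" "j = f i" unfolding R by auto
    then show ?thesis using uf[of i] pf(2)[of i c'] j by auto
  qed
  then have cc: "c' = c"
    using z[of c'] c c' uc' by (meson linorder_neqE_nat)
  have fs: "f i = skip_index c i" if "i < n-1" for i
  proof (rule strict_mono_skip[OF _ _ _ that])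
    have fl: "f i < n \<and> f i \<noteq> c" if "i < n-1" for i
      using only that cc unfolding R by auto
    show "f i < f (Suc i)" if "Suc i < n-1" for i using pf(3)[of i] fl[of "Suc i"] that by auto
    show "f i \<le> n-1 \<and> f i \<noteq> c" if "i < n-1" for i using fl[OF that] by auto
    show "c \<le> n-1" using c by auto
  qed
  show ?thesis
  proof (rule eq_matI)
    fix i j assume "i < dim_row (line_mat n c a u)" "j < dim_col (line_mat n c a u)"
    then have i: "i < n-1" and j: "j < n+1" by (auto simp: line_mat_def)
    have s: "skip_index c i < n" "skip_index c i \<noteq> c" using skip_less[OF c(1) i] by auto
    have Dc: "D $$ (i,c) = - u (skip_index c i) / u c" using uf[OF i] fs[OF i] cc c by (simp add: field_simps)
    have Dn: "D $$ (i,n) = a (skip_index c i) - u (skip_index c i) / u c * a c"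
      using sa i rowsum[OF i, of a] fs[OF i] cc Dc by (auto simp: solves_system_def)
    consider "j = skip_index c i" | "j = c" | "j = n" | "j < n" "j \<noteq> c" "j \<noteq> skip_index c i" using j by linarith
    then show "D $$ (i,j) = line_mat n c a u $$ (i,j)"
    proof cases
      case 4
      then have "j \<in> f ` R" using only cc by auto
      then obtain i' where "i' \<in> R" "j = f i'" by auto
      then have "D $$ (i,j) = 0" using piv[of i' i] i 4 fs[OF i] by auto
      then show ?thesis using 4 i by (auto simp: line_mat_def)
    qed (use i s c Dc Dn piv[of i i] R fs[OF i] in \<open>auto simp: line_mat_def\<close>)
  qed (auto simp: line_mat_def dim)
qed

lemma standard_equation_ex1:
  fixes L :: "(real ^ 'd::{finite,linorder}) set"
  assumes "is_line L"
  shows "\<exists>!C. is_standard_equation C L"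
proof -
  define n where "n = CARD('d)"
  define e where "e j = sorted_list_of_set (UNIV :: 'd set) ! j" for j
  have be: "bij_betw e {..<n} UNIV"
    using bij_betw_nth[of "sorted_list_of_set (UNIV :: 'd set)" "{..<n}" UNIV]
    by (simp add: n_def e_def[abs_def])
  have char: "x = y \<longleftrightarrow> (\<forall>j<n. x $ e j = y $ e j)" for x y :: "real ^ 'd::{finite,linorder}"
    using be unfolding Finite_Cartesian_Product.vec_eq_iff bij_betw_def by (metis UNIV_I imageE lessThan_iff)
  have surj: "\<exists>x :: real ^ 'd::{finite,linorder}. \<forall>j<n. x $ e j = g j" for g
    using be by (intro exI[of _ "\<chi> i. g (the_inv_into {..<n} e i)"])
      (auto simp: the_inv_into_f_f bij_betw_def)
  obtain a b where L: "L = affine hull {a,b}" and ab: "a \<noteq> b"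
  proof -
    obtain B where B: "affine hull B = L" "\<not> affine_dependent B" "int (card B) = 2"
      using aff_dim_basis_exists[of L] assms hull_same[of affine L] unfolding is_line_def by auto
    then have "card B = 2" by simp
    then obtain a b where "B = {a,b}" "a \<noteq> b" by (auto simp: card_2_iff)
    then show ?thesis using that B by auto
  qed
  define w where "w = b - a"
  have L': "x \<in> L \<longleftrightarrow> (\<exists>t. \<forall>j<n. x $ e j = a $ e j + t * w $ e j)" for x
  proof -
    have "x \<in> L \<longleftrightarrow> (\<exists>t. x = a + t *\<^sub>R w)"
      unfolding L affine_hull_2_alt w_def by auto
    then show ?thesis unfolding char by simp
  qed
  have "w \<noteq> 0" using ab w_def by simp
  then have ne: "\<exists>j<n. w $ e j \<noteq> 0" unfolding char by auto
  define c where "c = Max {j. j < n \<and> w $ e j \<noteq> 0}"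
  have "c \<in> {j. j < n \<and> w $ e j \<noteq> 0}" unfolding c_def using ne by (intro Max_in) auto
  then have c: "c < n" "w $ e c \<noteq> 0" by auto
  have z: "w $ e j = 0" if "c < j" "j < n" for j
    using that Max_ge[of "{j. j < n \<and> w $ e j \<noteq> 0}" j] unfolding c_def by (auto simp: not_less[symmetric])
  have eqn: "coeff_part C *\<^sub>v coords x = rhs_part C \<longleftrightarrow> solves_system C n (\<lambda>j. x $ e j)"
    if C: "C \<in> carrier_mat (n-1) (n+1)" for C and x :: "real ^ 'd::{finite,linorder}"
  proof -
    have "Matrix.vec_index (coeff_part C *\<^sub>v coords x) i = (\<Sum>j<n. C $$ (i,j) * x $ e j)" if "i < n-1" for i
      using that C by (simp add: coeff_part_def coords_def scalar_prod_def e_def n_def lessThan_atLeast0)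
    moreover have "Matrix.vec_index (rhs_part C) i = C $$ (i,n)" if "i < n-1" for i
      using that C by (simp add: rhs_part_def)
    ultimately show ?thesis
      using C by (auto simp: Matrix.vec_eq_iff solves_system_def coeff_part_def rhs_part_def)
  qed
  have iff: "is_standard_equation C L \<longleftrightarrow> C \<in> carrier_mat (n-1) (n+1) \<and> row_echelon_form C \<and>
     (\<forall>g. solves_system C n g \<longleftrightarrow> (\<exists>t. \<forall>j<n. g j = a $ e j + t * w $ e j))" for C
  proof -
    have "L = {x. coeff_part C *\<^sub>v coords x = rhs_part C} \<longleftrightarrow>
       (\<forall>g. solves_system C n g \<longleftrightarrow> (\<exists>t. \<forall>j<n. g j = a $ e j + t * w $ e j))"
      if C: "C \<in> carrier_mat (n-1) (n+1)"
    proof -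
      have cong: "solves_system C n g \<longleftrightarrow> solves_system C n h" if "\<forall>j<n. g j = h j" for g h
        using that by (simp add: solves_system_def)
      have "L = {x. coeff_part C *\<^sub>v coords x = rhs_part C} \<longleftrightarrow>
        (\<forall>x. solves_system C n (\<lambda>j. x $ e j) \<longleftrightarrow> (\<exists>t. \<forall>j<n. x $ e j = a $ e j + t * w $ e j))"
        by (simp only: set_eq_iff mem_Collect_eq eqn[OF C] L') blast
      also have "\<dots> \<longleftrightarrow> (\<forall>g. solves_system C n g \<longleftrightarrow> (\<exists>t. \<forall>j<n. g j = a $ e j + t * w $ e j))"
      proof
        assume h: "\<forall>x. solves_system C n (\<lambda>j. x $ e j) \<longleftrightarrow> (\<exists>t. \<forall>j<n. x $ e j = a $ e j + t * w $ e j)"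
        show "\<forall>g. solves_system C n g \<longleftrightarrow> (\<exists>t. \<forall>j<n. g j = a $ e j + t * w $ e j)"
        proof
          fix g
          obtain x :: "real ^ 'd::{finite,linorder}" where x: "\<forall>j<n. x $ e j = g j" using surj by blast
          then have "solves_system C n g \<longleftrightarrow> solves_system C n (\<lambda>j. x $ e j)" by (intro cong) auto
          then show "solves_system C n g \<longleftrightarrow> (\<exists>t. \<forall>j<n. g j = a $ e j + t * w $ e j)" using h x by simp
        qed
      qed auto
      finally show ?thesis .
    qed
    then show ?thesis unfolding is_standard_equation_def n_def[symmetric] by blast
  qed
  let ?M = "line_mat n c (\<lambda>j. a $ e j) (\<lambda>j. w $ e j)"
  show ?thesis
  proof (rule ex1I[of _ ?M])
    show "is_standard_equation ?M L"
      unfolding iff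
    proof (intro conjI allI)
      show "?M \<in> carrier_mat (n-1) (n+1)" by (simp add: line_mat_def)
      show "row_echelon_form ?M" by (rule line_mat_echelon[where u = "\<lambda>j. w $ e j", OF c(1) z])
      show "solves_system ?M n g \<longleftrightarrow> (\<exists>t. \<forall>j<n. g j = a $ e j + t * w $ e j)" for g
        by (rule line_mat_solves[where u = "\<lambda>j. w $ e j", OF c])
    qed
    fix C assume "is_standard_equation C L"
    then have C: "C \<in> carrier_mat (n-1) (n+1)" "row_echelon_form C"
        "\<And>g. solves_system C n g \<longleftrightarrow> (\<exists>t. \<forall>j<n. g j = a $ e j + t * w $ e j)"
      unfolding iff by simp_all
    show "C = ?M"
      by (rule echelon_line_unique[where u = "\<lambda>j. w $ e j" and a = "\<lambda>j. a $ e j", OF C(1,2) c z C(3)])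
  qed
qed

lemma is_standard_equation_standard_equation:
  "is_line L \<Longrightarrow> is_standard_equation (standard_equation L) L"
  unfolding standard_equation_def by (rule theI'[OF standard_equation_ex1])

end

theory Submission
  imports Defs
begin

text \<open>Writing \<open>p v = o\<^sub>i + x\<^sub>v b\<^sub>i\<close> for \<open>v \<in> V i\<close>, with \<open>o\<^sub>i\<close> and \<open>b\<^sub>i\<close> over \<open>\<rat>(L)\<close>, genericity says that a
  polynomial over \<open>\<rat>(L)\<close> vanishing at \<open>x\<close> is zero. Suppose \<open>G - uv\<close> has a nonzero flex. On a spanning tree of a
  component of \<open>G - uv\<close> that supports it, the flex is the value at \<open>x\<close> of a polynomial vector field \<open>X\<close> which is
  divergence free and, by genericity, preserves the lengths of all edges of \<open>G - uv\<close> everywhere. No component of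
  \<open>G - uv\<close> lies in a single line, so these lengths have bounded level sets. If the derivative of the
  length of \<open>uv\<close> along \<open>X\<close> is nonzero at \<open>x\<close>, then at some solution \<open>q\<close> of the same length equations it is zero or
  has the opposite sign: otherwise the integral of a compactly supported divergence would not vanish. If it is zero
  at \<open>x\<close>, then it is zero everywhere, and the same argument applies with a coordinate in place of the length of
  \<open>uv\<close>. By global rigidity \<open>q\<close> can only be the reflection of \<open>p\<close> in the two mutually closest points of the only
  two lines used. A sign comparison excludes this; when every edge joins different lines, it needs the component
  to have an even number of vertices, which follows since all degrees are at least two.\<close>

section \<open>Generic points\<close>

text \<open>On a tree, the halved gradients of the squared edge lengths have a generalised cross
  product whose component at \<open>v\<close> is, up to sign, the product over the edges of
  \<open>drv\<close> taken at the end farther from \<open>v\<close>. Such a cross product is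
  divergence free and preserves the tree lengths; at \<open>x\<close> these lengths have a
  one-dimensional kernel on the tree, so the field there is a multiple of the flex. A tree with
  \<open>n\<close> vertices gives \<open>n - 1\<close> factors, all odd under the reflection: hence
  the parity condition.

  The natural picture is a closed curve that crosses a level of the length of \<open>uv\<close> in
  both directions. Away from the generic point the level set may be singular, so no curve is traced;
  the integral asks only for boundedness and continuous partial derivatives.

  Genericity is given as a transcendence degree, whereas the argument uses vanishing of polynomials
  in the parameters. A count of monomials leads from one to the other.\<close>

lemma is_subfield_diff: "is_subfield K \<Longrightarrow> x \<in> K \<Longrightarrow> y \<in> K \<Longrightarrow> x - y \<in> K"
  unfolding is_subfield_def by (metis diff_conv_add_uminus)

lemma is_subfield_divide: "is_subfield K \<Longrightarrow> x \<in> K \<Longrightarrow> y \<in> K \<Longrightarrow> x / y \<in> K"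
  unfolding is_subfield_def by (metis divide_inverse)

lemma is_subfield_sum: "is_subfield K \<Longrightarrow> (\<And>i. i \<in> I \<Longrightarrow> f i \<in> K) \<Longrightarrow> sum f I \<in> K"
  by (induction I rule: infinite_finite_induct) (auto simp: is_subfield_def)

lemma is_subfield_hull: "is_subfield (is_subfield hull S)"
  by (rule hull_in) (auto simp: is_subfield_def)

text \<open>\<open>K\<close> is a set of reals rather than a type, so the \<open>K\<close>-linear
  span is generated inductively, one scaled generator at a time.\<close>

inductive_set lin_span :: "real set \<Rightarrow> real set \<Rightarrow> real set" for K S where
  zero: "0 \<in> lin_span K S"
| step: "k \<in> K \<Longrightarrow> s \<in> S \<Longrightarrow> z \<in> lin_span K S \<Longrightarrow> k * s + z \<in> lin_span K S"

lemma lin_span_add: "y \<in> lin_span K S \<Longrightarrow> z \<in> lin_span K S \<Longrightarrow> y + z \<in> lin_span K S"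
  by (induction rule: lin_span.induct) (auto simp: add.assoc intro: lin_span.step)

lemma lin_span_base: "1 \<in> K \<Longrightarrow> s \<in> S \<Longrightarrow> s \<in> lin_span K S"
  using lin_span.step[of 1 K s S 0] by (simp add: lin_span.zero)

lemma lin_span_scale:
  assumes "is_subfield K" "z \<in> lin_span K S" "k \<in> K" shows "k * z \<in> lin_span K S"
  using assms(2)
proof (induction rule: lin_span.induct)
  case (step c s z)
  then have "(k * c) * s + k * z \<in> lin_span K S"
    using assms(1,3) by (intro lin_span.step) (auto simp: is_subfield_def)
  then show ?case by (simp add: algebra_simps)
qed (simp add: lin_span.zero)

lemma lin_span_trans:
  assumes "is_subfield K" "S \<subseteq> lin_span K T" "z \<in> lin_span K S" shows "z \<in> lin_span K T"
  using assms(3)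
  by (induction rule: lin_span.induct)
    (use assms in \<open>auto intro!: lin_span.zero lin_span_add lin_span_scale\<close>)

lemma lin_span_mono: "S \<subseteq> T \<Longrightarrow> z \<in> lin_span K S \<Longrightarrow> z \<in> lin_span K T"
  by (rotate_tac, induction rule: lin_span.induct) (auto intro: lin_span.intros)

lemma lin_span_mult:
  assumes "is_subfield K" "y \<in> lin_span K S" "z \<in> lin_span K T"
    and "\<And>s t. s \<in> S \<Longrightarrow> t \<in> T \<Longrightarrow> s * t \<in> lin_span K U"
  shows "y * z \<in> lin_span K U"
  using assms(2)
proof (induction rule: lin_span.induct)
  case (step k s y)
  have "s * z \<in> lin_span K U"
    using assms(3)
  proof (induction rule: lin_span.induct)
    case (step c t z)
    then have "c * (s * t) + s * z \<in> lin_span K U"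
      using lin_span_add[OF lin_span_scale[OF assms(1) assms(4)[OF \<open>s \<in> S\<close>]]] by blast
    then show ?case by (simp add: algebra_simps)
  qed (simp add: lin_span.zero)
  then have "k * (s * z) + y * z \<in> lin_span K U"
    using lin_span_add[OF lin_span_scale[OF assms(1) _ step(1)] step.IH] by blast
  then show ?case by (simp add: algebra_simps)
qed (simp add: lin_span.zero)

lemma lin_span_insert:
  assumes "is_subfield K" "z \<in> lin_span K (insert s S)" shows "\<exists>c\<in>K. z - c * s \<in> lin_span K S"
  using assms(2)
proof (induction rule: lin_span.induct)
  case zero then show ?case using assms(1) by (intro bexI[of _ 0]) (auto simp: lin_span.zero is_subfield_def)
next
  case (step k s' z)
  then obtain c where c: "c \<in> K" "z - c * s \<in> lin_span K S" by auto
  show ?case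
  proof (cases "s' = s")
    case True
    have "k + c \<in> K" using step c assms(1) by (auto simp: is_subfield_def)
    then show ?thesis using c True by (intro bexI[of _ "k + c"]) (auto simp: algebra_simps)
  next
    case False
    then have "k * s' + (z - c * s) \<in> lin_span K S" using step c by (intro lin_span.step) auto
    then show ?thesis using c by (intro bexI[of _ c]) (auto simp: algebra_simps)
  qed
qed

text \<open>Elimination of one generator at a time: some \<open>z j\<close> with a nonzero
  coefficient at \<open>s\<close> serves as pivot, and subtracting multiples of it brings the other
  vectors into the span of \<open>S\<close>.\<close>

lemma lin_span_dependent:
  assumes K: "is_subfield K" and "finite S"
  shows "finite I \<Longrightarrow> card S < card I \<Longrightarrow> \<forall>i\<in>I. z i \<in> lin_span K S \<Longrightarrow>
    \<exists>k. (\<forall>i\<in>I. k i \<in> K) \<and> (\<exists>i\<in>I. k i \<noteq> 0) \<and> (\<Sum>i\<in>I. k i * z i) = 0"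
  using assms(2)
proof (induction S arbitrary: I z rule: finite_induct)
  case empty
  then obtain i where "i \<in> I" by fastforce
  have z0: "w = 0" if "w \<in> lin_span K {}" for w using that by cases auto
  then have "z i = 0" if "i \<in> I" for i using empty that by auto
  then show ?case using K \<open>i \<in> I\<close> by (intro exI[of _ "\<lambda>_. 1"]) (auto simp: is_subfield_def)
next
  case (insert s S)
  then have "\<forall>i\<in>I. \<exists>c\<in>K. z i - c * s \<in> lin_span K S" using lin_span_insert[OF K] by blast
  then obtain c where c: "\<And>i. i \<in> I \<Longrightarrow> c i \<in> K" "\<And>i. i \<in> I \<Longrightarrow> z i - c i * s \<in> lin_span K S" by metis
  show ?case
  proof (cases "\<forall>i\<in>I. c i = 0")
    case True
    then show ?thesis using insert c(2) by (intro insert.IH) (auto simp: card_insert_if)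
  next
    case False
    then obtain j where j: "j \<in> I" "c j \<noteq> 0" by auto
    let ?J = "I - {j}" and ?z = "\<lambda>i. z i - c i / c j * z j"
    have sp: "?z i \<in> lin_span K S" if "i \<in> ?J" for i
    proof -
      have "- (c i / c j) \<in> K"
        using is_subfield_divide[OF K c(1)[of i] c(1)[of j]] that j K by (auto simp: is_subfield_def)
      then have "(z i - c i * s) + - (c i / c j) * (z j - c j * s) \<in> lin_span K S"
        using that j c(2) by (intro lin_span_add lin_span_scale[OF K]) auto
      then show ?thesis using j by (simp add: algebra_simps)
    qed
    have "card S < card ?J" using insert.prems insert.hyps j by auto
    then obtain k where k: "\<forall>i\<in>?J. k i \<in> K" "\<exists>i\<in>?J. k i \<noteq> 0" "(\<Sum>i\<in>?J. k i * ?z i) = 0"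
      using insert.IH[of ?J ?z] insert.prems sp by auto
    \<comment> \<open>The pivot receives the coefficient that undoes the elimination: it collects
      the multiples of \<open>z j\<close> subtracted from the other vectors.\<close>
    define m where "m i = (if i = j then - (\<Sum>i\<in>?J. k i * (c i / c j)) else k i)" for i
    have "(\<Sum>i\<in>?J. k i * (c i / c j)) \<in> K"
    proof (rule is_subfield_sum[OF K])
      fix i assume "i \<in> ?J"
      then show "k i * (c i / c j) \<in> K"
        using is_subfield_divide[OF K c(1)[of i] c(1)[of j]] k(1) j K
        unfolding is_subfield_def by (metis DiffD1)
    qed
    then have "\<forall>i\<in>I. m i \<in> K" using k(1) K by (auto simp: m_def is_subfield_def)
    moreover have "\<exists>i\<in>I. m i \<noteq> 0" using k(2) by (auto simp: m_def)
    moreover have "(\<Sum>i\<in>I. m i * z i) = 0"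
    proof -
      have "(\<Sum>i\<in>I. m i * z i) = m j * z j + (\<Sum>i\<in>?J. k i * z i)"
        using insert.prems(1) j by (subst sum.remove[of _ j]) (auto simp: m_def)
      also have "\<dots> = (\<Sum>i\<in>?J. k i * ?z i)"
        by (simp add: m_def sum_distrib_right right_diff_distrib sum_subtractf mult.assoc)
      finally show ?thesis using k(3) by simp
    qed
    ultimately show ?thesis by blast
  qed
qed

section \<open>Polynomial functions over a subfield and weighted degrees\<close>

inductive poly_fun :: "real set \<Rightarrow> (real ^ 'v::finite \<Rightarrow> real) \<Rightarrow> bool" for K where
  const: "c \<in> K \<Longrightarrow> poly_fun K (\<lambda>q. c)"
| coord: "poly_fun K (\<lambda>q. q $ v)"
| add: "poly_fun K P \<Longrightarrow> poly_fun K Q \<Longrightarrow> poly_fun K (\<lambda>q. P q + Q q)"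
| mult: "poly_fun K P \<Longrightarrow> poly_fun K Q \<Longrightarrow> poly_fun K (\<lambda>q. P q * Q q)"

definition monom_at :: "real ^ 'v::finite \<Rightarrow> ('v \<Rightarrow> nat) \<Rightarrow> real" where
  "monom_at x a = (\<Prod>v\<in>UNIV. x $ v ^ a v)"

text \<open>The weights \<open>r\<close> are chosen per polynomial, in
  \<open>leading_exponent\<close>, so that a single monomial has the largest degree.\<close>

definition wdeg :: "('v::finite \<Rightarrow> nat) \<Rightarrow> ('v \<Rightarrow> nat) \<Rightarrow> nat" where
  "wdeg r a = (\<Sum>v\<in>UNIV. r v * a v)"

lemma monom_at_add: "monom_at x (\<lambda>v. a v + b v) = monom_at x a * monom_at x b"
  by (simp add: monom_at_def power_add prod.distrib)

lemma wdeg_add: "wdeg r (\<lambda>v. a v + b v) = wdeg r a + wdeg r b"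
  by (simp add: wdeg_def algebra_simps sum.distrib)

lemma poly_fun_expand:
  assumes "is_subfield K" "poly_fun K P"
  shows "\<exists>A c. finite A \<and> (\<forall>a\<in>A. c a \<in> K) \<and> (\<forall>q. P q = (\<Sum>a\<in>A. c a * monom_at q a))"
  using assms(2)
proof (induction rule: poly_fun.induct)
  case (const c)
  then show ?case
    by (intro exI[of _ "{\<lambda>_. 0}"] exI[of _ "\<lambda>_. c"]) (simp add: monom_at_def)
next
  case (coord v)
  have "(\<Prod>w\<in>UNIV. (q :: real ^ 'a) $ w ^ (if w = v then 1 else 0)) = q $ v" for q
    by (subst prod.remove[of _ v]) auto
  then show ?case using assms(1)
    by (intro exI[of _ "{\<lambda>w. if w = v then 1 else 0}"] exI[of _ "\<lambda>_. 1"])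
      (simp add: monom_at_def is_subfield_def)
next
  case (add P Q)
  then obtain A c B d where AB: "finite A" "\<forall>a\<in>A. c a \<in> K" "\<And>q. P q = (\<Sum>a\<in>A. c a * monom_at q a)"
    "finite B" "\<forall>a\<in>B. d a \<in> K" "\<And>q. Q q = (\<Sum>a\<in>B. d a * monom_at q a)" by auto
  let ?e = "\<lambda>a. (if a \<in> A then c a else 0) + (if a \<in> B then d a else 0)"
  have "P q + Q q = (\<Sum>a\<in>A\<union>B. ?e a * monom_at q a)" for q
  proof -
    have "P q = (\<Sum>a\<in>A\<union>B. (if a \<in> A then c a else 0) * monom_at q a)"
      unfolding AB(3) using AB(1,4) by (intro sum.mono_neutral_cong_left) auto
    moreover have "Q q = (\<Sum>a\<in>A\<union>B. (if a \<in> B then d a else 0) * monom_at q a)"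
      unfolding AB(6) using AB(1,4) by (intro sum.mono_neutral_cong_left) auto
    ultimately show ?thesis by (simp add: distrib_right sum.distrib)
  qed
  then show ?case using AB assms(1)
    by (intro exI[of _ "A \<union> B"] exI[of _ ?e]) (auto simp: is_subfield_def)
next
  case (mult P Q)
  then obtain A c B d where AB: "finite A" "\<forall>a\<in>A. c a \<in> K" "\<And>q. P q = (\<Sum>a\<in>A. c a * monom_at q a)"
    "finite B" "\<forall>a\<in>B. d a \<in> K" "\<And>q. Q q = (\<Sum>a\<in>B. d a * monom_at q a)" by auto
  \<comment> \<open>Different pairs of exponents can have the same sum, so the coefficients are
    collected over the fibres of \<open>s\<close>.\<close>
  define s where "s = (\<lambda>(a, b) (v :: 'a). a v + b v :: nat)"
  let ?e = "\<lambda>g. \<Sum>ab\<in>{ab \<in> A \<times> B. s ab = g}. c (fst ab) * d (snd ab)"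
  have "P q * Q q = (\<Sum>g\<in>s ` (A \<times> B). ?e g * monom_at q g)" for q
  proof -
    have "P q * Q q = (\<Sum>ab\<in>A \<times> B. c (fst ab) * d (snd ab) * monom_at q (s ab))"
      unfolding AB(3,6) sum_product sum.cartesian_product
      by (intro sum.cong) (auto simp: s_def monom_at_add)
    also have "\<dots> = (\<Sum>g\<in>s ` (A \<times> B). \<Sum>ab\<in>{ab \<in> A \<times> B. s ab = g}. c (fst ab) * d (snd ab) * monom_at q (s ab))"
      using AB(1,4) by (intro sum.image_gen) auto
    also have "\<dots> = (\<Sum>g\<in>s ` (A \<times> B). ?e g * monom_at q g)"
      unfolding sum_distrib_right by (intro sum.cong) auto
    finally show ?thesis .
  qed
  moreover have "?e g \<in> K" for g
    using AB assms(1) by (intro is_subfield_sum) (auto simp: is_subfield_def)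
  ultimately show ?case using AB(1,4)
    by (intro exI[of _ "s ` (A \<times> B)"] exI[of _ ?e]) auto
qed

lemma digits_unique:
  fixes a b :: "nat \<Rightarrow> nat"
  assumes "\<And>i. i < n \<Longrightarrow> a i < B" "\<And>i. i < n \<Longrightarrow> b i < B"
    and "(\<Sum>i<n. B ^ i * a i) = (\<Sum>i<n. B ^ i * b i)" "i < n"
  shows "a i = b i"
  using assms
proof (induction n arbitrary: a b i)
  case (Suc n)
  have s: "(\<Sum>i<Suc n. B ^ i * f i) = f 0 + B * (\<Sum>i<n. B ^ i * f (Suc i))" for f :: "nat \<Rightarrow> nat"
    by (simp only: sum.lessThan_Suc_shift) (simp add: sum_distrib_left mult.assoc)
  have ab: "a 0 < B" "b 0 < B" using Suc.prems by auto
  have eq: "a 0 + B * (\<Sum>i<n. B ^ i * a (Suc i)) = b 0 + B * (\<Sum>i<n. B ^ i * b (Suc i))"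
    using Suc.prems(3) unfolding s .
  have 0: "a 0 = b 0" using arg_cong[OF eq, of "\<lambda>x. x mod B"] ab by simp
  then have "(\<Sum>i<n. B ^ i * a (Suc i)) = (\<Sum>i<n. B ^ i * b (Suc i))" using eq ab by auto
  then have "a (Suc j) = b (Suc j)" if "j < n" for j
    using Suc.IH[of "\<lambda>i. a (Suc i)" "\<lambda>i. b (Suc i)" j] Suc.prems that by auto
  then show ?case using 0 Suc.prems(4) by (cases i) auto
qed simp

text \<open>With powers of a base \<open>D\<close> above every exponent in \<open>A\<close> as
  weights, the degree is the exponent vector read as a number in base \<open>D\<close>. Distinct
  exponents in \<open>A\<close> then have distinct degrees, and the maximum is attained
  once.\<close>

lemma leading_exponent:
  fixes A :: "('v::finite \<Rightarrow> nat) set"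
  assumes "finite A" "A \<noteq> {}"
  shows "\<exists>r a. (\<forall>v. 1 \<le> r v) \<and> a \<in> A \<and> (\<forall>b\<in>A. b \<noteq> a \<longrightarrow> wdeg r b < wdeg r a)"
proof -
  define n where "n = CARD('v)"
  obtain e :: "'v \<Rightarrow> nat" where e: "bij_betw e UNIV {..<n}"
    using ex_bij_betw_finite_nat[of "UNIV :: 'v set"] by (auto simp: n_def atLeast0LessThan)
  define D where "D = Suc (Max ((\<lambda>(a, v). a v) ` (A \<times> UNIV)))"
  have D: "a v < D" if "a \<in> A" for a v
    unfolding D_def less_Suc_eq_le using that assms(1) by (intro Max_ge) (auto intro!: image_eqI[of _ _ "(a, v)"])
  define r where "r v = D ^ e v" for v
  have w: "wdeg r a = (\<Sum>i<n. D ^ i * a (inv_into UNIV e i))" for a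
    unfolding wdeg_def r_def using e
    by (intro sum.reindex_bij_witness[of _ "inv_into UNIV e" e])
      (auto simp: bij_betw_def bij_betw_inv_into_left f_inv_into_f)
  have "inj_on (wdeg r) A"
  proof (rule inj_onI)
    fix a b assume ab: "a \<in> A" "b \<in> A" "wdeg r a = wdeg r b"
    have "a (inv_into UNIV e i) = b (inv_into UNIV e i)" if "i < n" for i
      using digits_unique[of n "\<lambda>i. a (inv_into UNIV e i)" D "\<lambda>i. b (inv_into UNIV e i)" i] ab D that by (simp add: w)
    moreover have "v = inv_into UNIV e (e v)" "e v < n" for v
      using e by (auto simp: bij_betw_def)
    ultimately have "a v = b v" for v by metis
    then show "a = b" by (rule ext)
  qed
  moreover obtain a where a: "a \<in> A" "\<And>b. b \<in> A \<Longrightarrow> wdeg r b \<le> wdeg r a"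
  proof -
    have "Max (wdeg r ` A) \<in> wdeg r ` A" using assms by (intro Max_in) auto
    then obtain a where a: "a \<in> A" "wdeg r a = Max (wdeg r ` A)" by auto
    show ?thesis by (rule that[OF a(1)]) (use a(2) assms(1) in simp)
  qed
  ultimately have "\<forall>b\<in>A. b \<noteq> a \<longrightarrow> wdeg r b < wdeg r a"
    by (auto simp: inj_on_def order_le_less)
  moreover have "1 \<le> r v" for v using D assms(2) by (auto simp: r_def Suc_le_eq D_def)
  ultimately show ?thesis using a by blast
qed

text \<open>Values at \<open>x\<close> of polynomials over \<open>K\<close> of degree at most
  \<open>N\<close>. Passing from polynomials to values lets an algebraic relation at
  \<open>x\<close> shrink the spanning set.\<close>

definition poly_values :: "real set \<Rightarrow> ('v::finite \<Rightarrow> nat) \<Rightarrow> real ^ 'v \<Rightarrow> nat \<Rightarrow> real set" where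
  "poly_values K r x N = lin_span K (monom_at x ` {g. wdeg r g \<le> N})"

lemma poly_values_mult:
  assumes K: "is_subfield K" and "y \<in> poly_values K r x N" "z \<in> poly_values K r x M"
  shows "y * z \<in> poly_values K r x (N + M)"
  using assms(2,3) unfolding poly_values_def
proof (rule lin_span_mult[OF K])
  fix s t assume "s \<in> monom_at x ` {g. wdeg r g \<le> N}" "t \<in> monom_at x ` {g. wdeg r g \<le> M}"
  then obtain g h where "s = monom_at x g" "wdeg r g \<le> N" "t = monom_at x h" "wdeg r h \<le> M" by auto
  then have "s * t \<in> monom_at x ` {g. wdeg r g \<le> N + M}"
    by (intro image_eqI[of _ _ "\<lambda>v. g v + h v"]) (auto simp: monom_at_add wdeg_add)
  then show "s * t \<in> lin_span K (monom_at x ` {g. wdeg r g \<le> N + M})"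
    using K by (intro lin_span_base) (auto simp: is_subfield_def)
qed

lemma poly_values_mono: "N \<le> M \<Longrightarrow> y \<in> poly_values K r x N \<Longrightarrow> y \<in> poly_values K r x M"
  unfolding poly_values_def by (erule lin_span_mono[rotated]) auto

lemma poly_values_const:
  assumes "is_subfield K" "c \<in> K" shows "c \<in> poly_values K r x N"
proof -
  have "c * monom_at x (\<lambda>_. 0) + 0 \<in> poly_values K r x N"
    unfolding poly_values_def using assms
    by (intro lin_span.step lin_span.zero) (auto simp: wdeg_def intro!: image_eqI[of _ _ "\<lambda>_. 0"])
  then show ?thesis by (simp add: monom_at_def)
qed

lemma poly_values_power:
  assumes "is_subfield K" "y \<in> poly_values K r x N"
  shows "y ^ k \<in> poly_values K r x (k * N)"
proof (induction k)
  case 0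
  then show ?case using assms(1) by (auto intro: poly_values_const simp: is_subfield_def)
next
  case (Suc k)
  then show ?case using poly_values_mult[OF assms(1,2) Suc] by simp
qed

lemma poly_values_prod:
  assumes "is_subfield K" "\<And>b. b \<in> B \<Longrightarrow> y b \<in> poly_values K r x N"
  shows "prod y B \<in> poly_values K r x (card B * N)"
  using assms(2)
proof (induction B rule: infinite_finite_induct)
  case (insert b B)
  then show ?case using poly_values_mult[OF assms(1), of "y b" r x N "prod y B" "card B * N"] by simp
qed (use assms(1) in \<open>auto intro: poly_values_const simp: is_subfield_def\<close>)

lemma poly_fun_in_poly_values:
  assumes "is_subfield K" "poly_fun K P"
  shows "\<exists>N. P x \<in> poly_values K r x N"
  using assms(2)
proof (induction rule: poly_fun.induct)
  case (const c)
  then show ?case using poly_values_const[OF assms(1)] by blast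
next
  case (coord v)
  define g :: "'a \<Rightarrow> nat" where "g w = (if w = v then 1 else 0)" for w
  have "monom_at x g = x $ v" unfolding monom_at_def g_def by (subst prod.remove[of _ v]) auto
  then have "x $ v \<in> poly_values K r x (wdeg r g)"
    unfolding poly_values_def using assms(1)
    by (intro lin_span_base) (auto simp: is_subfield_def intro!: image_eqI[of _ _ g])
  then show ?case by blast
next
  case (add P Q)
  then obtain N M where "P x \<in> poly_values K r x N" "Q x \<in> poly_values K r x M" by blast
  then have "P x + Q x \<in> poly_values K r x (max N M)"
    using poly_values_mono[of N "max N M"] poly_values_mono[of M "max N M"]
    by (metis lin_span_add max.cobounded1 max.cobounded2 poly_values_def)
  then show ?case by blast
next
  case (mult P Q)
  then show ?case using poly_values_mult[OF assms(1)] by blast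
qed

text \<open>The relation at \<open>x\<close> replaces a factor \<open>monom_at x a\<close> by
  monomials of lower degree. Applied to every monomial divisible by it, this terminates by induction
  on the degree and leaves only exponents below \<open>a\<close> in some coordinate.\<close>

lemma monom_reduce:
  assumes K: "is_subfield K"
    and a: "monom_at x a \<in> lin_span K (monom_at x ` {b. wdeg r b < wdeg r a})"
    and "wdeg r g \<le> N"
  shows "monom_at x g \<in> lin_span K (monom_at x ` {g. wdeg r g \<le> N \<and> (\<exists>v. g v < a v)})"
  using assms(3)
proof (induction "wdeg r g" arbitrary: g rule: less_induct)
  case less
  let ?T = "lin_span K (monom_at x ` {g. wdeg r g \<le> N \<and> (\<exists>v. g v < a v)})"
  have K1: "1 \<in> K" using K by (simp add: is_subfield_def)
  show ?case
  proof (cases "\<exists>v. g v < a v")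
    case True
    then show ?thesis using less.prems K1 by (intro lin_span_base) auto
  next
    case False
    define h where "h v = g v - a v" for v
    have g: "g = (\<lambda>v. a v + h v)" using False by (auto simp: h_def fun_eq_iff not_less)
    have "monom_at x a * monom_at x h \<in> ?T"
    proof (rule lin_span_mult[OF K a])
      show "monom_at x h \<in> lin_span K {monom_at x h}" using K1 by (intro lin_span_base) auto
      fix s t assume "s \<in> monom_at x ` {b. wdeg r b < wdeg r a}" "t \<in> {monom_at x h}"
      then obtain b where b: "s = monom_at x b" "wdeg r b < wdeg r a" "t = monom_at x h" by auto
      then have w: "wdeg r (\<lambda>v. b v + h v) < wdeg r g" unfolding g wdeg_add by simp
      show "s * t \<in> ?T"
        using less.hyps[OF w] less.prems w b by (simp add: monom_at_add)
    qed
    then show ?thesis unfolding g monom_at_add .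
  qed
qed

text \<open>Some coordinate \<open>v\<close> stays below \<open>a v\<close>, a bound free of
  \<open>N\<close>, and the others are at most \<open>N\<close> because all weights are at least 1.
  So the count grows with one power of \<open>N\<close> fewer than there are coordinates.\<close>

lemma card_reduced_exponents:
  fixes a :: "'v::finite \<Rightarrow> nat"
  assumes "\<And>v. 1 \<le> r v"
  shows "finite {g. wdeg r g \<le> N \<and> (\<exists>v. g v < a v)}"
    and "card {g. wdeg r g \<le> N \<and> (\<exists>v. g v < a v)} \<le> (\<Sum>v\<in>UNIV. a v) * (N + 1) ^ (CARD('v) - 1)"
proof -
  let ?E = "\<lambda>v. PiE UNIV (\<lambda>u. if u = v then {..<a v} else {..N})"
  have le: "g v \<le> wdeg r g" for g v
  proof -
    have "g v \<le> r v * g v" using assms[of v] by simp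
    also have "\<dots> \<le> wdeg r g" unfolding wdeg_def by (rule member_le_sum) auto
    finally show ?thesis .
  qed
  have sub: "{g. wdeg r g \<le> N \<and> (\<exists>v. g v < a v)} \<subseteq> (\<Union>v. ?E v)"
  proof
    fix g assume "g \<in> {g. wdeg r g \<le> N \<and> (\<exists>v. g v < a v)}"
    then obtain v where "wdeg r g \<le> N" "g v < a v" by auto
    then have "g \<in> ?E v" using order_trans[OF le] by (intro PiE_I) auto
    then show "g \<in> (\<Union>v. ?E v)" by blast
  qed
  have fin: "finite (\<Union>v. ?E v)" by (intro finite_UN_I finite_PiE) auto
  then show "finite {g. wdeg r g \<le> N \<and> (\<exists>v. g v < a v)}" using sub finite_subset by blast
  have "card (?E v) = a v * (N + 1) ^ (CARD('v) - 1)" for v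
  proof -
    have "card (?E v) = (\<Prod>u\<in>UNIV. card (if u = v then {..<a v} else {..N}))"
      by (rule card_PiE) auto
    also have "\<dots> = a v * (\<Prod>u\<in>UNIV - {v}. N + 1)"
      by (subst prod.remove[of _ v]) auto
    also have "\<dots> = a v * (N + 1) ^ (CARD('v) - 1)" by (simp add: card_Diff_singleton)
    finally show ?thesis .
  qed
  then have "card (\<Union>v. ?E v) \<le> (\<Sum>v\<in>UNIV. a v * (N + 1) ^ (CARD('v) - 1))"
    using card_UN_le[of UNIV ?E] by simp
  then show "card {g. wdeg r g \<le> N \<and> (\<exists>v. g v < a v)} \<le> (\<Sum>v\<in>UNIV. a v) * (N + 1) ^ (CARD('v) - 1)"
    using card_mono[OF fin sub] by (simp add: sum_distrib_right)
qed

section \<open>From transcendence degree to vanishing of polynomials\<close>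

lemma poly_fun_quotient:
  fixes x :: "real ^ 'v::finite"
  assumes K: "is_subfield K" and b: "b \<in> is_subfield hull (K \<union> range (($) x))"
  shows "\<exists>P R. poly_fun K P \<and> poly_fun K R \<and> R x \<noteq> 0 \<and> b = P x / R x"
proof -
  \<comment> \<open>The fractions whose denominator is nonzero at \<open>x\<close> form a subfield
    containing the generators, hence the hull.\<close>
  define F where "F = {b. \<exists>P R. poly_fun K P \<and> poly_fun K R \<and> R x \<noteq> 0 \<and> b = P x / R x}"
  have FI: "P x / R x \<in> F" if "poly_fun K P" "poly_fun K R" "R x \<noteq> 0" for P R
    using that F_def by blast
  have K01: "0 \<in> K" "1 \<in> K" "- 1 \<in> K" using K by (auto simp: is_subfield_def)
  have Fp: "P x \<in> F" if "poly_fun K P" for P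
    using FI[OF that poly_fun.const[OF K01(2)]] by simp
  have "is_subfield F"
    unfolding is_subfield_def
  proof (intro conjI ballI)
    show "0 \<in> F" "1 \<in> F" using Fp[OF poly_fun.const] K01 by auto
    fix y assume "y \<in> F"
    then obtain P R where y: "poly_fun K P" "poly_fun K R" "R x \<noteq> 0" "y = P x / R x" by (auto simp: F_def)
    show "- y \<in> F"
      using FI[OF poly_fun.mult[OF poly_fun.const[OF K01(3)] y(1)] y(2,3)] y(4) by simp
    show "inverse y \<in> F"
    proof (cases "P x = 0")
      case True then show ?thesis using y \<open>0 \<in> F\<close> by simp
    next
      case False then show ?thesis using FI[OF y(2,1)] y(4) by simp
    qed
    fix z assume "z \<in> F"
    then obtain P' R' where z: "poly_fun K P'" "poly_fun K R'" "R' x \<noteq> 0" "z = P' x / R' x" by (auto simp: F_def)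
    note m = poly_fun.mult[OF y(2) z(2)]
    show "y + z \<in> F"
      using FI[OF poly_fun.add[OF poly_fun.mult[OF y(1) z(2)] poly_fun.mult[OF z(1) y(2)]] m] y z
      by (simp add: add_frac_eq mult.commute)
    show "y * z \<in> F"
      using FI[OF poly_fun.mult[OF y(1) z(1)] m] y z by simp
  qed
  moreover have "K \<union> range (($) x) \<subseteq> F" using Fp[OF poly_fun.const] Fp[OF poly_fun.coord] by auto
  ultimately have "is_subfield hull (K \<union> range (($) x)) \<subseteq> F" by (intro hull_minimal)
  then show ?thesis using b by (auto simp: F_def)
qed

lemma poly_fun_common_denominator:
  fixes x :: "real ^ 'v::finite"
  assumes K: "is_subfield K" and "finite B" "B \<subseteq> is_subfield hull (K \<union> range (($) x))"
  shows "\<exists>P R. poly_fun K R \<and> R x \<noteq> 0 \<and> (\<forall>b\<in>B. poly_fun K (P b) \<and> b = P b x / R x)"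
  using assms(2,3)
proof (induction B rule: finite_induct)
  case empty
  then show ?case using K by (intro exI[of _ "\<lambda>_ _. 0"] exI[of _ "\<lambda>_. 1"]) (auto simp: is_subfield_def intro: poly_fun.const)
next
  case (insert b B)
  then obtain P R where PR: "poly_fun K R" "R x \<noteq> 0" "\<And>b. b \<in> B \<Longrightarrow> poly_fun K (P b)"
    "\<And>b. b \<in> B \<Longrightarrow> b = P b x / R x" by auto
  obtain Q S where QS: "poly_fun K Q" "poly_fun K S" "S x \<noteq> 0" "b = Q x / S x"
    using poly_fun_quotient[OF K] insert.prems by blast
  define P' where "P' c = (if c = b then (\<lambda>q. Q q * R q) else (\<lambda>q. P c q * S q))" for c
  show ?case
  proof (intro exI conjI ballI)
    show "poly_fun K (\<lambda>q. R q * S q)" using PR QS by (intro poly_fun.mult)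
    show "R x * S x \<noteq> 0" using PR QS by simp
    fix c assume c: "c \<in> insert b B"
    show "poly_fun K (P' c)" using c PR QS by (auto simp: P'_def intro: poly_fun.mult)
    show "c = P' c x / (R x * S x)" using c PR QS by (auto simp: P'_def)
  qed
qed

text \<open>Packs a finite family of coefficients into one polynomial mapping, the form in which
  independence is stated. The product may run over all of \<open>B\<close>, as absent variables
  contribute a power 0.\<close>

lemma self_eval_bounded_exponents:
  assumes "finite B" and I: "I \<subseteq> {m. Poly_Mapping.keys m \<subseteq> B}" "finite I"
    and "algebraically_independent K B" "\<forall>m\<in>I. k m \<in> K"
    and "(\<Sum>m\<in>I. k m * (\<Prod>b\<in>B. b ^ Poly_Mapping.lookup m b)) = 0" "m \<in> I"
  shows "k m = 0"
proof -
  define P where "P = Abs_poly_mapping (\<lambda>m. if m \<in> I then k m else 0)"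
  have lk: "Poly_Mapping.lookup P = (\<lambda>m. if m \<in> I then k m else 0)"
    unfolding P_def by (rule Abs_poly_mapping_inverse) (use I(2) in \<open>auto intro: finite_subset[of _ I]\<close>)
  have keys: "Poly_Mapping.keys P = {m \<in> I. k m \<noteq> 0}"
    by (auto simp: Poly_Mapping.keys.rep_eq lk)
  have pr: "(\<Prod>b\<in>Poly_Mapping.keys m. b ^ Poly_Mapping.lookup m b) = (\<Prod>b\<in>B. b ^ Poly_Mapping.lookup m b)"
    if "m \<in> I" for m :: "real \<Rightarrow>\<^sub>0 nat"
    using that I(1) assms(1) by (intro prod.mono_neutral_left) (auto simp: Poly_Mapping.in_keys_iff)
  have "self_eval P = (\<Sum>m\<in>{m \<in> I. k m \<noteq> 0}. k m * (\<Prod>b\<in>B. b ^ Poly_Mapping.lookup m b))"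
    unfolding self_eval_def keys by (intro sum.cong) (auto simp: lk pr)
  also have "\<dots> = (\<Sum>m\<in>I. k m * (\<Prod>b\<in>B. b ^ Poly_Mapping.lookup m b))"
    using I(2) by (intro sum.mono_neutral_left) auto
  finally have "self_eval P = 0" using assms(6) by simp
  then have "P = 0"
    using assms(4,5) I(1) unfolding algebraically_independent_def by (force simp: keys lk)
  then show ?thesis using lk \<open>m \<in> I\<close> by (metis Poly_Mapping.lookup_zero)
qed

lemma card_bounded_exponents:
  fixes B :: "real set"
  assumes "finite B"
  defines "I M \<equiv> {m :: real \<Rightarrow>\<^sub>0 nat. Poly_Mapping.keys m \<subseteq> B \<and> (\<forall>b. Poly_Mapping.lookup m b \<le> M)}"
  shows "finite (I M)" "card (I M) = (M + 1) ^ card B"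
proof -
  have "bij_betw (\<lambda>m. restrict (Poly_Mapping.lookup m) B) (I M) (PiE B (\<lambda>_. {..M}))"
  proof (rule bij_betw_byWitness[where f' = "\<lambda>g. Abs_poly_mapping (\<lambda>b. if b \<in> B then g b else 0)"])
    have lk: "Poly_Mapping.lookup (Abs_poly_mapping (\<lambda>b. if b \<in> B then g b else 0)) = (\<lambda>b. if b \<in> B then g b else 0)"
      for g :: "real \<Rightarrow> nat"
      using assms(1) by (intro Abs_poly_mapping_inverse) (auto intro: finite_subset[of _ B])
    show "\<forall>m\<in>I M. Abs_poly_mapping (\<lambda>b. if b \<in> B then restrict (Poly_Mapping.lookup m) B b else 0) = m"
      by (intro ballI poly_mapping_eqI, subst lk) (auto simp: I_def Poly_Mapping.in_keys_iff)
    show "\<forall>g\<in>PiE B (\<lambda>_. {..M}). restrict (Poly_Mapping.lookup (Abs_poly_mapping (\<lambda>b. if b \<in> B then g b else 0))) B = g"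
      unfolding lk by (auto simp: fun_eq_iff PiE_def extensional_def)
    show "(\<lambda>m. restrict (Poly_Mapping.lookup m) B) ` I M \<subseteq> PiE B (\<lambda>_. {..M})"
      by (auto simp: I_def)
    show "(\<lambda>g. Abs_poly_mapping (\<lambda>b. if b \<in> B then g b else 0)) ` PiE B (\<lambda>_. {..M}) \<subseteq> I M"
      by (auto simp: I_def Poly_Mapping.in_keys_iff lk PiE_def Pi_def split: if_splits)
  qed
  then show "finite (I M)" "card (I M) = (M + 1) ^ card B"
    using assms(1) by (auto simp: bij_betw_finite[of _ "I M"] finite_PiE card_PiE dest: bij_betw_same_card)
qed

text \<open>If a nonzero polynomial vanished at \<open>x\<close>, the monomials in \<open>B\<close>
  with exponents at most \<open>M\<close>, cleared of denominators, would lie in a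
  \<open>K\<close>-span of \<open>O(M ^ (CARD('v) - 1))\<close> elements, while there are
  \<open>(M + 1) ^ card B\<close> of them. For large \<open>M\<close> this makes them dependent over
  \<open>K\<close>, against the independence of \<open>B\<close>.\<close>

theorem poly_fun_vanish_generic:
  fixes x :: "real ^ 'v::finite"
  assumes K: "is_subfield K" and B: "finite B" "B \<subseteq> is_subfield hull (K \<union> range (($) x))"
    and cB: "CARD('v) \<le> card B" and ind: "algebraically_independent K B"
    and P: "poly_fun K P" "P x = 0"
  shows "P q = 0"
proof (rule ccontr)
  assume nz: "P q \<noteq> 0"
  obtain A0 c where A0: "finite A0" "\<And>a. a \<in> A0 \<Longrightarrow> c a \<in> K" "\<And>q. P q = (\<Sum>a\<in>A0. c a * monom_at q a)"
    using poly_fun_expand[OF K P(1)] by blast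
  define A where "A = {a \<in> A0. c a \<noteq> 0}"
  have A: "finite A" "\<And>a. a \<in> A \<Longrightarrow> c a \<in> K \<and> c a \<noteq> 0" using A0 by (auto simp: A_def)
  have PA: "P q = (\<Sum>a\<in>A. c a * monom_at q a)" for q
    unfolding A0(3) A_def using A0(1) by (intro sum.mono_neutral_right) auto
  have "A \<noteq> {}" using nz PA by force
  then obtain r a where r: "\<And>v. 1 \<le> r v" and a: "a \<in> A" "\<And>b. b \<in> A \<Longrightarrow> b \<noteq> a \<Longrightarrow> wdeg r b < wdeg r a"
    using leading_exponent[OF A(1)] by blast
  \<comment> \<open>The equation \<open>P x = 0\<close> is solved for the leading monomial.\<close>
  have red: "monom_at x a \<in> lin_span K (monom_at x ` {b. wdeg r b < wdeg r a})"
  proof -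
    have "c a * monom_at x a + (\<Sum>b\<in>A - {a}. c b * monom_at x b) = 0"
      using P(2) PA[of x] A(1) a(1) by (simp add: sum.remove[of A a])
    then have "monom_at x a = (\<Sum>b\<in>A - {a}. - (c b / c a) * monom_at x b)"
      using A(2)[OF a(1)] by (simp add: sum_negf field_simps sum_distrib_left flip: sum_divide_distrib)
    also have "\<dots> \<in> lin_span K (monom_at x ` {b. wdeg r b < wdeg r a})"
    proof -
      have "(\<Sum>b\<in>S. - (c b / c a) * monom_at x b) \<in> lin_span K (monom_at x ` {b. wdeg r b < wdeg r a})"
        if "S \<subseteq> A - {a}" "finite S" for S
        using that(2,1)
      proof (induction S rule: finite_induct)
        case (insert b S)
        have "- (c b / c a) \<in> K"
          using is_subfield_divide[OF K, of "c b" "c a"] A(2) insert.prems a(1) K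
          unfolding is_subfield_def by blast
        moreover have "wdeg r b < wdeg r a" using a(2)[of b] insert.prems by blast
        ultimately have "- (c b / c a) * monom_at x b + (\<Sum>b\<in>S. - (c b / c a) * monom_at x b)
            \<in> lin_span K (monom_at x ` {b. wdeg r b < wdeg r a})"
          using insert by (intro lin_span.step) auto
        then show ?case unfolding sum.insert[OF insert.hyps] .
      qed (simp add: lin_span.zero)
      then show ?thesis using A(1) by blast
    qed
    finally show ?thesis .
  qed
  obtain Q R where R: "poly_fun K R" "R x \<noteq> 0" and Q: "\<And>b. b \<in> B \<Longrightarrow> poly_fun K (Q b)" "\<And>b. b \<in> B \<Longrightarrow> b = Q b x / R x"
    using poly_fun_common_denominator[OF K B] by metis
  define D where "D = (\<lambda>F. SOME N. F x \<in> poly_values K r x N)"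
  have D: "F x \<in> poly_values K r x (D F)" if "poly_fun K F" for F
    unfolding D_def using poly_fun_in_poly_values[OF K that] by (rule someI_ex)
  \<comment> \<open>One degree bound for the common denominator and all numerators.\<close>
  define e where "e = Max (D ` insert R (Q ` B))"
  have De: "F x \<in> poly_values K r x e" if "F = R \<or> (\<exists>b\<in>B. F = Q b)" for F
  proof (rule poly_values_mono)
    show "D F \<le> e" unfolding e_def using that B(1) by (intro Max_ge) auto
    show "F x \<in> poly_values K r x (D F)" using that R(1) Q(1) by (intro D) auto
  qed
  define n where "n = card B"
  define C where "C = (\<Sum>v\<in>UNIV. a v)"
  \<comment> \<open>Chosen so that the final count closes:
    \<open>N + 1 \<le> (n * e + 1) * (M + 1)\<close> leaves at most
    \<open>M * (M + 1) ^ (CARD('v) - 1)\<close> generators.\<close>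
  define M where "M = C * (n * e + 1) ^ (CARD('v) - 1)"
  define N where "N = n * (M * e)"
  define I where "I = {m :: real \<Rightarrow>\<^sub>0 nat. Poly_Mapping.keys m \<subseteq> B \<and> (\<forall>b. Poly_Mapping.lookup m b \<le> M)}"
  have I: "finite I" "card I = (M + 1) ^ n" using card_bounded_exponents[OF B(1)] by (auto simp: I_def n_def)
  define z where "z m = (\<Prod>b\<in>B. Q b x ^ Poly_Mapping.lookup m b * R x ^ (M - Poly_Mapping.lookup m b))" for m
  define S where "S = monom_at x ` {g. wdeg r g \<le> N \<and> (\<exists>v. g v < a v)}"
  have zS: "z m \<in> lin_span K S" if "m \<in> I" for m
  proof -
    have "z m \<in> poly_values K r x N"
      unfolding z_def N_def n_def
    proof (rule poly_values_prod[OF K])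
      fix b assume b: "b \<in> B"
      have le: "Poly_Mapping.lookup m b \<le> M" using that by (auto simp: I_def)
      have "Q b x ^ Poly_Mapping.lookup m b * R x ^ (M - Poly_Mapping.lookup m b)
        \<in> poly_values K r x (Poly_Mapping.lookup m b * e + (M - Poly_Mapping.lookup m b) * e)"
        using b by (intro poly_values_mult poly_values_power K De) auto
      then show "Q b x ^ Poly_Mapping.lookup m b * R x ^ (M - Poly_Mapping.lookup m b) \<in> poly_values K r x (M * e)"
        using le by (simp add: add_mult_distrib[symmetric])
    qed
    moreover have "monom_at x ` {g. wdeg r g \<le> N} \<subseteq> lin_span K S"
      unfolding S_def using monom_reduce[OF K red] by auto
    ultimately show ?thesis unfolding poly_values_def using lin_span_trans[OF K] by blast
  qed
  have finS: "finite S" unfolding S_def using card_reduced_exponents(1)[of r] r by blast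
  have "card S \<le> C * (N + 1) ^ (CARD('v) - 1)"
    unfolding S_def C_def
    by (rule order_trans[OF card_image_le[OF card_reduced_exponents(1)] card_reduced_exponents(2)]) (rule r)+
  also have "\<dots> \<le> C * ((n * e + 1) * (M + 1)) ^ (CARD('v) - 1)"
    by (intro mult_left_mono power_mono) (auto simp: N_def algebra_simps)
  also have "\<dots> = M * (M + 1) ^ (CARD('v) - 1)" by (simp only: M_def power_mult_distrib mult.assoc)
  also have "\<dots> < (M + 1) * (M + 1) ^ (CARD('v) - 1)" by simp
  also have "\<dots> = (M + 1) ^ CARD('v)"
    by (metis power_Suc Suc_pred' zero_less_card_finite)
  also have "\<dots> \<le> card I" unfolding I(2) using cB by (intro power_increasing) (auto simp: n_def)
  finally obtain k where k: "\<forall>m\<in>I. k m \<in> K" "\<exists>m\<in>I. k m \<noteq> 0" "(\<Sum>m\<in>I. k m * z m) = 0"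
    using lin_span_dependent[OF K finS I(1)] zS by blast
  have zb: "z m = R x ^ (M * n) * (\<Prod>b\<in>B. b ^ Poly_Mapping.lookup m b)" if "m \<in> I" for m
  proof -
    have "z m = (\<Prod>b\<in>B. R x ^ M * b ^ Poly_Mapping.lookup m b)"
      unfolding z_def
    proof (rule prod.cong[OF refl])
      fix b assume b: "b \<in> B"
      have le: "Poly_Mapping.lookup m b \<le> M" using that by (auto simp: I_def)
      have "Q b x = b * R x" using Q(2)[OF b] R(2) by (simp add: field_simps)
      then have "Q b x ^ Poly_Mapping.lookup m b * R x ^ (M - Poly_Mapping.lookup m b)
         = b ^ Poly_Mapping.lookup m b * (R x ^ Poly_Mapping.lookup m b * R x ^ (M - Poly_Mapping.lookup m b))"
        by (simp add: power_mult_distrib mult_ac)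
      also have "R x ^ Poly_Mapping.lookup m b * R x ^ (M - Poly_Mapping.lookup m b) = R x ^ M"
        using le by (simp flip: power_add)
      finally show "Q b x ^ Poly_Mapping.lookup m b * R x ^ (M - Poly_Mapping.lookup m b) = R x ^ M * b ^ Poly_Mapping.lookup m b"
        by simp
    qed
    then show ?thesis by (simp add: prod.distrib n_def power_mult)
  qed
  have "R x ^ (M * n) * (\<Sum>m\<in>I. k m * (\<Prod>b\<in>B. b ^ Poly_Mapping.lookup m b)) = (\<Sum>m\<in>I. k m * z m)"
    unfolding sum_distrib_left by (intro sum.cong) (auto simp: zb mult_ac)
  then have "(\<Sum>m\<in>I. k m * (\<Prod>b\<in>B. b ^ Poly_Mapping.lookup m b)) = 0" using k(3) R(2) by simp
  then show False
    using self_eval_bounded_exponents[OF B(1) _ I(1) ind k(1)] k(2) by (auto simp: I_def)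
qed

section \<open>Divergence free vector fields\<close>

definition has_partial :: "(real ^ 'v::finite \<Rightarrow> real) \<Rightarrow> 'v \<Rightarrow> (real ^ 'v \<Rightarrow> real) \<Rightarrow> bool" where
  "has_partial F v F' \<longleftrightarrow> (\<forall>q. ((\<lambda>s. F (q + s *\<^sub>R axis v 1)) has_real_derivative F' q) (at 0))"

lemma has_partial_shift:
  assumes "has_partial F v F'"
  shows "((\<lambda>s. F (q + s *\<^sub>R axis v 1)) has_real_derivative F' (q + t *\<^sub>R axis v 1)) (at t)"
proof -
  have "((\<lambda>s. F ((q + t *\<^sub>R axis v 1) + s *\<^sub>R axis v 1)) has_real_derivative F' (q + t *\<^sub>R axis v 1)) (at 0)"
    using assms by (auto simp: has_partial_def)
  then show ?thesis
    using DERIV_shift[of "\<lambda>s. F (q + s *\<^sub>R axis v 1)" "F' (q + t *\<^sub>R axis v 1)" 0 t]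
    by (simp add: algebra_simps)
qed

lemma has_partial_const: "has_partial (\<lambda>q. c) v (\<lambda>q. 0)"
  by (simp add: has_partial_def)

lemma has_partial_coord: "has_partial (\<lambda>q. q $ w) v (\<lambda>q. if v = w then 1 else 0)"
  unfolding has_partial_def axis_def by (auto intro!: derivative_eq_intros)

lemma has_partial_add:
  "has_partial F v F' \<Longrightarrow> has_partial G v G' \<Longrightarrow> has_partial (\<lambda>q. F q + G q) v (\<lambda>q. F' q + G' q)"
  by (auto simp: has_partial_def intro: DERIV_add)

lemma has_partial_mult:
  "has_partial F v F' \<Longrightarrow> has_partial G v G' \<Longrightarrow> has_partial (\<lambda>q. F q * G q) v (\<lambda>q. F' q * G q + F q * G' q)"
  unfolding has_partial_def
proof (intro allI)
  fix q assume "\<forall>q. ((\<lambda>s. F (q + s *\<^sub>R axis v 1)) has_real_derivative F' q) (at 0)"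
    "\<forall>q. ((\<lambda>s. G (q + s *\<^sub>R axis v 1)) has_real_derivative G' q) (at 0)"
  then show "((\<lambda>s. F (q + s *\<^sub>R axis v 1) * G (q + s *\<^sub>R axis v 1)) has_real_derivative F' q * G q + F q * G' q) (at 0)"
    using DERIV_mult[of "\<lambda>s. F (q + s *\<^sub>R axis v 1)" "F' q" 0 UNIV "\<lambda>s. G (q + s *\<^sub>R axis v 1)" "G' q"]
    by (simp add: algebra_simps)
qed

lemma has_partial_sum:
  "(\<And>i. i \<in> I \<Longrightarrow> has_partial (F i) v (F' i)) \<Longrightarrow> has_partial (\<lambda>q. \<Sum>i\<in>I. F i q) v (\<lambda>q. \<Sum>i\<in>I. F' i q)"
  by (auto simp: has_partial_def intro: DERIV_sum)

lemma has_partial_compose: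
  assumes "has_partial F v F'" "\<And>z. (h has_real_derivative h' z) (at z)"
  shows "has_partial (\<lambda>q. h (F q)) v (\<lambda>q. h' (F q) * F' q)"
  unfolding has_partial_def
proof
  fix q
  show "((\<lambda>s. h (F (q + s *\<^sub>R axis v 1))) has_real_derivative h' (F q) * F' q) (at 0)"
    using DERIV_chain2[of h "h' (F q)" "\<lambda>s. F (q + s *\<^sub>R axis v 1)" 0 "F' q" UNIV] assms
    by (auto simp: has_partial_def)
qed

lemma has_partial_eq: "has_partial F v F' \<Longrightarrow> (\<And>q. F' q = G' q) \<Longrightarrow> has_partial F v G'"
  by (simp add: has_partial_def)

lemma has_partial_unique: "has_partial F v F' \<Longrightarrow> has_partial F v G' \<Longrightarrow> F' q = G' q"
  unfolding has_partial_def using DERIV_unique by blast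

lemma integrable_continuous_bounded_support:
  fixes H :: "real ^ 'v::finite \<Rightarrow> real"
  assumes "continuous_on UNIV H" "\<And>q. norm q > R \<Longrightarrow> H q = 0"
  shows "integrable lborel H"
proof -
  have "integrable lborel (\<lambda>x. indicator (cball 0 R) x *\<^sub>R H x)"
    by (rule borel_integrable_compact) (auto intro: continuous_on_subset[OF assms(1)])
  moreover have "(\<lambda>x. indicator (cball 0 R) x *\<^sub>R H x) = H"
    using assms(2) by (auto simp: fun_eq_iff indicator_def not_le)
  ultimately show ?thesis by simp
qed

text \<open>By translation invariance every difference quotient of \<open>H\<close> has integral
  zero, and dominated convergence carries this over to the partial derivative.\<close>

lemma integral_partial_zero:
  fixes H :: "real ^ 'v::finite \<Rightarrow> real"
  assumes H: "continuous_on UNIV H" "\<And>q. norm q > R \<Longrightarrow> H q = 0"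
    and pd: "has_partial H v H'" and H': "continuous_on UNIV H'"
  shows "\<And>q. norm q > R \<Longrightarrow> H' q = 0" "integrable lborel H'" "(\<integral>q. H' q \<partial>lborel) = 0"
proof -
  let ?e = "axis v 1 :: real ^ 'v"
  show z: "H' q = 0" if q: "norm q > R" for q
  proof -
    have "\<forall>\<^sub>F s in nhds (0::real). norm (q + s *\<^sub>R ?e) > R"
    proof -
      have "((\<lambda>s. norm (q + s *\<^sub>R ?e)) \<longlongrightarrow> norm (q + 0 *\<^sub>R ?e)) (nhds 0)"
        by (intro tendsto_intros filterlim_ident)
      then show ?thesis using q by (auto intro: order_tendstoD)
    qed
    then have "\<forall>\<^sub>F s in nhds (0::real). H (q + s *\<^sub>R ?e) = 0"
      by (rule eventually_mono) (rule H(2))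
    then have "((\<lambda>s. H (q + s *\<^sub>R ?e)) has_real_derivative 0) (at 0)"
      by (subst DERIV_cong_ev[OF refl _ refl]) auto
    then show ?thesis using pd DERIV_unique unfolding has_partial_def by blast
  qed
  show int': "integrable lborel H'" using integrable_continuous_bounded_support[OF H' z] .
  have intH: "integrable lborel H" using integrable_continuous_bounded_support[OF H] .
  have "bounded (H' ` cball 0 R)"
    by (intro compact_imp_bounded compact_continuous_image continuous_on_subset[OF H']) auto
  then obtain M where "M > 0" "\<forall>y\<in>H' ` cball 0 R. norm y \<le> M"
    unfolding bounded_pos by blast
  then have M: "M > 0" "\<And>q. q \<in> cball 0 R \<Longrightarrow> \<bar>H' q\<bar> \<le> M" by auto
  have M: "\<bar>H' q\<bar> \<le> M" for q using M z[of q] by (cases "norm q > R") (auto simp: not_less)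
  \<comment> \<open>Steps of length at most 1 keep all quotients supported in the ball of radius
    \<open>R + 1\<close>, and the mean value theorem bounds them by \<open>M\<close>.\<close>
  define h where "h k = inverse (real (Suc k))" for k
  have h: "h k > 0" "h k \<le> 1" for k by (auto simp: h_def field_simps)
  define F where "F k q = (H (q + h k *\<^sub>R ?e) - H q) / h k" for k q
  have Fb: "\<bar>F k q\<bar> \<le> M * indicator (cball 0 (R + 1)) q" for k q
  proof (cases "norm q > R + 1")
    case True
    have "norm q \<le> norm (q + h k *\<^sub>R ?e) + norm (h k *\<^sub>R ?e)" using norm_triangle_sub[of q "- (h k *\<^sub>R ?e)"] by simp
    then have "norm (q + h k *\<^sub>R ?e) > R" using True h[of k] by (simp add: norm_axis_1)
    then show ?thesis using True H(2) by (auto simp: F_def)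
  next
    case False
    have "\<exists>z>0. z < h k \<and> H (q + h k *\<^sub>R ?e) - H (q + 0 *\<^sub>R ?e) = (h k - 0) * H' (q + z *\<^sub>R ?e)"
      by (rule MVT2[OF h(1)]) (rule has_partial_shift[OF pd])
    then obtain z where "F k q = H' (q + z *\<^sub>R ?e)" using h(1)[of k] by (auto simp: F_def)
    then show ?thesis using M False by simp
  qed
  have "(\<lambda>k. \<integral>q. F k q \<partial>lborel) \<longlonglongrightarrow> (\<integral>q. H' q \<partial>lborel)"
  proof (rule integral_dominated_convergence)
    show "H' \<in> borel_measurable lborel" using int' by (rule borel_measurable_integrable)
    show "F k \<in> borel_measurable lborel" for k
      unfolding F_def using h(1)[of k]
      by (auto intro!: borel_measurable_continuous_onI continuous_intros continuous_on_compose2[OF H(1)])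
    show "integrable lborel (\<lambda>q :: real ^ 'v. M * indicator (cball 0 (R + 1)) q)"
      by (intro integrable_mult_right integrable_real_indicator) (auto simp: emeasure_bounded_finite[unfolded infinity_ennreal_def])
    show "AE q in lborel. (\<lambda>k. F k q) \<longlonglongrightarrow> H' q"
    proof (rule AE_I2)
      fix q
      have "((\<lambda>s. (H (q + s *\<^sub>R ?e) - H q) / s) \<longlongrightarrow> H' q) (at 0)"
        using pd by (auto simp: has_partial_def DERIV_def dest: spec[of _ q])
      moreover have "filterlim h (at 0) sequentially"
        unfolding h_def filterlim_at using LIMSEQ_inverse_real_of_nat by auto
      ultimately show "(\<lambda>k. F k q) \<longlonglongrightarrow> H' q"
        unfolding F_def by (rule filterlim_compose)
    qed
    show "AE q in lborel. norm (F k q) \<le> M * indicator (cball 0 (R + 1)) q" for k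
      using Fb by simp
  qed
  moreover have "(\<integral>q. F k q \<partial>lborel) = 0" for k
  proof -
    have m: "(+) c \<in> measurable lborel borel" for c :: "real ^ 'v" by simp
    have Hm: "H \<in> borel_measurable borel" using H(1) by (rule borel_measurable_continuous_onI)
    have d: "integrable lborel (\<lambda>q. H (q + h k *\<^sub>R ?e))" "(\<integral>q. H (q + h k *\<^sub>R ?e) \<partial>lborel) = (\<integral>q. H q \<partial>lborel)"
      using integrable_distr_eq[OF m Hm, of "h k *\<^sub>R ?e"] integral_distr[OF m Hm, of "h k *\<^sub>R ?e"] intH
      by (simp_all add: lborel_distr_plus add.commute)
    show ?thesis unfolding F_def using d intH by simp
  qed
  ultimately show "(\<integral>q. H' q \<partial>lborel) = 0" using LIMSEQ_unique[OF _ tendsto_const] by fastforce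
qed

lemma continuous_nonneg_integral_zero:
  fixes D :: "real ^ 'v::finite \<Rightarrow> real"
  assumes "continuous_on UNIV D" "\<And>q. 0 \<le> D q" "integrable lborel D" "(\<integral>q. D q \<partial>lborel) = 0"
  shows "D p = 0"
proof -
  obtain a b where ab: "p \<in> box a b" using bounded_subset_box_symmetric[of "{p}"] by (metis bounded_insert bounded_empty insert_subset)
  have D: "(D has_integral 0) UNIV" using has_integral_integral_lborel[OF assms(3)] assms(4) by simp
  have i: "D integrable_on cbox a b"
    using integrable_on_subcbox D by (metis integrable_on_def subset_UNIV)
  then have "integral (cbox a b) D \<le> integral UNIV D"
    using assms(2) D by (intro integral_subset_le) auto
  moreover have "integral (cbox a b) D \<ge> 0" using assms(2) by (intro integral_nonneg i) auto
  ultimately have "integral (cbox a b) D = 0" using integral_unique[OF D] by linarith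
  then have "(D has_integral 0) (cbox a b)" using integrable_integral[OF i] by simp
  then show ?thesis
    using ab assms(1,2) by (intro has_integral_0_cbox_imp_0[of a b D p])
      (auto intro: continuous_on_subset box_subset_cbox[THEN subsetD])
qed

text \<open>A continuously differentiable cut-off, which suffices because only first partial
  derivatives are integrated.\<close>

definition sq_pos :: "real \<Rightarrow> real" where
  "sq_pos z = (max 0 z)\<^sup>2"

lemma sq_pos_deriv: "(sq_pos has_real_derivative 2 * max 0 z) (at z)"
proof -
  consider "z > 0" | "z < 0" | "z = 0" by linarith
  then show ?thesis
  proof cases
    case 1
    have ev: "\<forall>\<^sub>F x in nhds z. sq_pos x = x\<^sup>2"
      using eventually_nhds_in_open[of "{0<..}" z] 1 by (auto simp: sq_pos_def elim!: eventually_mono)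
    show ?thesis by (subst DERIV_cong_ev[OF refl ev refl]) (use 1 in \<open>auto intro!: derivative_eq_intros\<close>)
  next
    case 2
    have ev: "\<forall>\<^sub>F x in nhds z. sq_pos x = 0"
      using eventually_nhds_in_open[of "{..<0}" z] 2 by (auto simp: sq_pos_def elim!: eventually_mono)
    show ?thesis by (subst DERIV_cong_ev[OF refl ev refl]) (use 2 in auto)
  next
    case 3
    have "((\<lambda>x. (sq_pos (0 + x) - sq_pos 0) / x) \<longlongrightarrow> 0) (at 0)"
    proof (rule Lim_null_comparison)
      show "\<forall>\<^sub>F x in at (0::real). norm ((sq_pos (0 + x) - sq_pos 0) / x) \<le> \<bar>x\<bar>"
        by (auto simp: sq_pos_def max_def power2_eq_square eventually_at_filter)
      show "((\<lambda>x. \<bar>x\<bar>) \<longlongrightarrow> 0) (at (0::real))" by (rule tendsto_rabs_zero) simp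
    qed
    then show ?thesis using 3 by (simp add: DERIV_def)
  qed
qed

lemma sq_pos_continuous: "continuous_on A sq_pos"
  unfolding sq_pos_def by (intro continuous_intros)

text \<open>Along the vector field \<open>X\<close> the functions \<open>\<phi> i\<close> are constant, so on a bounded level set
  \<open>g\<close> cannot increase at every passage through the level \<open>g p\<close>: a bump function \<open>W\<close> of
  the \<open>\<phi> i\<close> times a step function of \<open>g\<close> has \<open>\<integral> X \<cdot> \<nabla>W = 0\<close> because \<open>X\<close> is divergence free.\<close>

theorem divergence_free_level_set:
  fixes X X' :: "'v::finite \<Rightarrow> real ^ 'v \<Rightarrow> real" and \<phi> :: "'i \<Rightarrow> real ^ 'v \<Rightarrow> real"
  assumes I: "finite I"
    and X: "\<And>v. continuous_on UNIV (X v)" "\<And>v. continuous_on UNIV (X' v)"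
      "\<And>v. has_partial (X v) v (X' v)" "\<And>q. (\<Sum>v\<in>UNIV. X' v q) = 0"
    and \<phi>: "\<And>i. continuous_on UNIV (\<phi> i)" "\<And>i v. continuous_on UNIV (\<phi>' i v)"
      "\<And>i v. has_partial (\<phi> i) v (\<phi>' i v)" "\<And>i q. i \<in> I \<Longrightarrow> (\<Sum>v\<in>UNIV. X v q * \<phi>' i v q) = 0"
    and g: "continuous_on UNIV g" "\<And>v. continuous_on UNIV (g' v)" "\<And>v. has_partial g v (g' v)"
    and bdd: "bounded {q. \<forall>i\<in>I. \<bar>\<phi> i q - \<phi> i p\<bar> \<le> 1}"
  shows "\<exists>q. (\<forall>i\<in>I. \<phi> i q = \<phi> i p) \<and> g q = g p \<and> (\<Sum>v\<in>UNIV. X v q * g' v q) \<le> 0"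
proof (rule ccontr)
  define J where "J q = (\<Sum>v\<in>UNIV. X v q * g' v q)" for q
  assume "\<not> ?thesis"
  then have pos: "J q > 0" if "\<forall>i\<in>I. \<phi> i q = \<phi> i p" "g q = g p" for q
    using that unfolding J_def by (meson not_le)
  define N where "N q = (\<Sum>i\<in>I. (\<phi> i q - \<phi> i p)\<^sup>2)" for q
  have contJ: "continuous_on UNIV J" unfolding J_def using X g by (intro continuous_intros)
  have contN: "continuous_on UNIV N" unfolding N_def using \<phi> by (intro continuous_intros)
  have N0: "N q \<ge> 0" for q unfolding N_def by (intro sum_nonneg) auto
  have Nb: "\<forall>i\<in>I. \<bar>\<phi> i q - \<phi> i p\<bar> \<le> 1" if "N q \<le> 1" for q
  proof
    fix i assume "i \<in> I"
    then have "(\<phi> i q - \<phi> i p)\<^sup>2 \<le> N q" unfolding N_def using I by (intro member_le_sum) auto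
    then show "\<bar>\<phi> i q - \<phi> i p\<bar> \<le> 1" using that by (meson abs_square_le_1 order_trans)
  qed
  obtain R where R: "\<And>q. N q \<le> 1 \<Longrightarrow> norm q \<le> R"
    using bdd Nb unfolding bounded_iff by blast
  \<comment> \<open>Positivity of \<open>J\<close> spreads from the common level set to a
    neighbourhood by compactness: \<open>u\<close> has a positive minimum on the compact set
    \<open>Z\<close> of points where \<open>J\<close> is not positive, unless \<open>Z\<close> is
    empty.\<close>
  have "\<exists>\<epsilon>>0. \<epsilon> < 1 \<and> (\<forall>q. N q < \<epsilon> \<longrightarrow> \<bar>g q - g p\<bar> < \<epsilon> \<longrightarrow> J q > 0)"
  proof -
    define Z where "Z = {q. N q \<le> 1} \<inter> {q. J q \<le> 0}"
    have "closed Z" unfolding Z_def using contJ contN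
      by (intro closed_Int closed_Collect_le) (auto intro: continuous_intros)
    moreover have "bounded Z" unfolding Z_def bounded_iff using R by blast
    ultimately have "compact Z" by (simp add: compact_eq_bounded_closed)
    define u where "u q = N q + \<bar>g q - g p\<bar>" for q
    have cu: "continuous_on Z u" unfolding u_def
      by (intro continuous_intros continuous_on_subset[OF contN] continuous_on_subset[OF g(1)]) auto
    show ?thesis
    proof (cases "Z = {}")
      case True
      have "J q > 0" if "N q < 1/2" for q 
      proof (rule ccontr)
        assume "\<not> J q > 0"
        then have "q \<in> Z" using that by (simp add: Z_def)
        then show False using True by simp
      qed
      then show ?thesis by (intro exI[of _ "1/2"]) auto
    next
      case False
      obtain z where z: "z \<in> Z" "\<And>q. q \<in> Z \<Longrightarrow> u z \<le> u q"
        using continuous_attains_inf[OF \<open>compact Z\<close> False cu] by auto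
      have "u z > 0"
      proof (rule ccontr)
        assume "\<not> u z > 0"
        then have "N z = 0" "g z = g p" using N0[of z] by (auto simp: u_def)
        then have "J z > 0" using I pos by (auto simp: N_def sum_nonneg_eq_0_iff)
        then show False using z(1) by (simp add: Z_def)
      qed
      moreover have "J q > 0" if "N q < min (1/2) (u z / 2)" "\<bar>g q - g p\<bar> < min (1/2) (u z / 2)" for q
      proof (rule ccontr)
        assume "\<not> J q > 0"
        then have "q \<in> Z" using that by (auto simp: Z_def)
        then show False using z(2)[of q] that by (auto simp: u_def)
      qed
      ultimately show ?thesis by (intro exI[of _ "min (1/2) (u z / 2)"]) auto
    qed
  qed
  then obtain \<epsilon> where \<epsilon>: "\<epsilon> > 0" "\<epsilon> < 1" "\<And>q. N q < \<epsilon> \<Longrightarrow> \<bar>g q - g p\<bar> < \<epsilon> \<Longrightarrow> J q > 0" by blast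
  \<comment> \<open>A second difference of \<open>sq_pos\<close>: a continuously differentiable
    step, constant on either side of \<open>[-\<epsilon>, \<epsilon>]\<close>. Its derivative
    \<open>\<psi>'\<close> is a tent of height \<open>2 * \<epsilon>\<close> at 0.\<close>
  define \<psi> where "\<psi> z = sq_pos (z + \<epsilon>) - 2 * sq_pos z + sq_pos (z - \<epsilon>)" for z
  define \<psi>' where "\<psi>' z = 2 * max 0 (z + \<epsilon>) - 4 * max 0 z + 2 * max 0 (z - \<epsilon>)" for z
  have \<psi>': "\<psi>' z \<ge> 0" "\<bar>z\<bar> \<ge> \<epsilon> \<Longrightarrow> \<psi>' z = 0" "\<psi>' 0 > 0" for z
    using \<epsilon>(1) by (auto simp: \<psi>'_def max_def)
  have d\<psi>: "(\<psi> has_real_derivative \<psi>' z) (at z)" for z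
  proof -
    have s: "((\<lambda>z. sq_pos (z + c)) has_real_derivative 2 * max 0 (z + c)) (at z)" for c
      using DERIV_shift sq_pos_deriv by blast
    show ?thesis unfolding \<psi>_def \<psi>'_def
      using DERIV_add[OF DERIV_diff[OF s[of \<epsilon>] DERIV_cmult[OF sq_pos_deriv, of 2]] s[of "- \<epsilon>"]]
      by (simp add: algebra_simps)
  qed
  have c\<psi>: "continuous_on UNIV \<psi>" "continuous_on UNIV \<psi>'"
    unfolding \<psi>_def \<psi>'_def
    by (intro continuous_intros continuous_on_compose2[OF sq_pos_continuous[of UNIV]]; auto)+
  \<comment> \<open>Vanishes unless \<open>N q < \<epsilon>\<close>; as
    \<open>\<epsilon> < 1\<close>, everything multiplied by it is supported in the ball of radius
    \<open>R\<close>.\<close>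
  define \<theta> where "\<theta> q = sq_pos (\<epsilon> - N q)" for q
  define G where "G q = \<psi> (g q - g p)" for q
  define N' where "N' v q = (\<Sum>i\<in>I. 2 * (\<phi> i q - \<phi> i p) * \<phi>' i v q)" for v q
  define \<theta>' where "\<theta>' v q = 2 * max 0 (\<epsilon> - N q) * - N' v q" for v q
  define G' where "G' v q = \<psi>' (g q - g p) * g' v q" for v q
  have pN: "has_partial N v (N' v)" for v
    unfolding N_def N'_def
  proof (rule has_partial_sum)
    fix i
    have "has_partial (\<lambda>q. \<phi> i q + - \<phi> i p) v (\<lambda>q. \<phi>' i v q + 0)"
      by (intro has_partial_add \<phi> has_partial_const)
    from has_partial_compose[OF this, of "\<lambda>z. z\<^sup>2" "\<lambda>z. 2 * z"]
    moreover have "(power2 has_real_derivative 2 * z) (at z)" for z :: real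
      by (auto intro!: derivative_eq_intros)
    ultimately show "has_partial (\<lambda>q. (\<phi> i q - \<phi> i p)\<^sup>2) v (\<lambda>q. 2 * (\<phi> i q - \<phi> i p) * \<phi>' i v q)"
      by simp
  qed
  have p\<theta>: "has_partial \<theta> v (\<theta>' v)" for v
  proof -
    have "has_partial (\<lambda>q. \<epsilon> + (-1) * N q) v (\<lambda>q. 0 + (0 * N q + (-1) * N' v q))"
      by (intro has_partial_add has_partial_mult has_partial_const pN)
    from has_partial_compose[OF this sq_pos_deriv] show ?thesis by (simp add: \<theta>_def[abs_def] \<theta>'_def[abs_def])
  qed
  have pG: "has_partial G v (G' v)" for v
  proof -
    have "has_partial (\<lambda>q. g q + - g p) v (\<lambda>q. g' v q + 0)"
      by (intro has_partial_add g has_partial_const)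
    from has_partial_compose[OF this d\<psi>] show ?thesis by (simp add: G_def[abs_def] G'_def[abs_def])
  qed
  have c: "continuous_on UNIV \<theta>" "continuous_on UNIV (\<theta>' v)" "continuous_on UNIV G" "continuous_on UNIV (G' v)" for v
    unfolding \<theta>_def \<theta>'_def G_def G'_def N'_def
    by (intro continuous_intros continuous_on_compose2[OF sq_pos_continuous[of UNIV]] contN
      continuous_on_compose2[OF c\<psi>(1)] continuous_on_compose2[OF c\<psi>(2)] \<phi> g; auto)+
  define H where "H v q = X v q * (\<theta> q * G q)" for v q
  define H' where "H' v q = X' v q * (\<theta> q * G q) + X v q * (\<theta>' v q * G q + \<theta> q * G' v q)" for v q
  have pH: "has_partial (H v) v (H' v)" for v
    unfolding H_def H'_def by (intro has_partial_mult X p\<theta> pG)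
  have cH: "continuous_on UNIV (H v)" "continuous_on UNIV (H' v)" for v
    unfolding H_def H'_def by (intro continuous_intros X c)+
  have suppH: "H v q = 0" if "norm q > R" for v q
  proof -
    have "N q > 1" using R[of q] that by linarith
    then show ?thesis using \<epsilon> by (auto simp: H_def \<theta>_def sq_pos_def)
  qed
  note iz = integral_partial_zero[OF cH(1) suppH pH cH(2)]
  \<comment> \<open>Along \<open>X\<close> the factor \<open>\<theta>\<close> is constant, and
    \<open>X\<close> has divergence zero, so only the derivative of the step in \<open>g\<close>
    survives.\<close>
  have sum: "(\<Sum>v\<in>UNIV. H' v q) = \<theta> q * \<psi>' (g q - g p) * J q" for q
  proof -
    have "(\<Sum>v\<in>UNIV. X v q * N' v q) = (\<Sum>i\<in>I. 2 * (\<phi> i q - \<phi> i p) * (\<Sum>v\<in>UNIV. X v q * \<phi>' i v q))"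
      unfolding N'_def sum_distrib_left by (subst sum.swap) (simp add: mult_ac)
    then have N0: "(\<Sum>v\<in>UNIV. X v q * N' v q) = 0" using \<phi>(4) by simp
    have "(\<Sum>v\<in>UNIV. H' v q) = (\<Sum>v\<in>UNIV. X' v q) * (\<theta> q * G q)
      - 2 * max 0 (\<epsilon> - N q) * G q * (\<Sum>v\<in>UNIV. X v q * N' v q) + \<theta> q * \<psi>' (g q - g p) * J q"
      unfolding H'_def \<theta>'_def G'_def J_def
      by (simp add: sum.distrib sum_distrib_left sum_distrib_right sum_subtractf sum_negf algebra_simps)
    then show ?thesis using N0 X(4) by simp
  qed
  define D where "D q = \<theta> q * \<psi>' (g q - g p) * J q" for q
  \<comment> \<open>A continuous nonnegative function with integral zero vanishes everywhere, yet at
    \<open>p\<close> all three factors of \<open>D\<close> are positive.\<close>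
  have "D p = 0"
  proof (rule continuous_nonneg_integral_zero)
    show "continuous_on UNIV D" unfolding sum[symmetric] D_def by (intro continuous_intros cH)
    show "integrable lborel D" unfolding sum[symmetric] D_def by (intro Bochner_Integration.integrable_sum iz)
    show "(\<integral>q. D q \<partial>lborel) = 0" unfolding sum[symmetric] D_def by (subst Bochner_Integration.integral_sum) (auto simp: iz)
    fix q
    show "D q \<ge> 0"
    proof (cases "N q < \<epsilon> \<and> \<bar>g q - g p\<bar> < \<epsilon>")
      case True
      then show ?thesis using \<epsilon>(3)[of q] \<psi>'(1) by (simp add: D_def \<theta>_def sq_pos_def)
    next
      case False
      then show ?thesis using \<psi>'(2)[of "g q - g p"] by (auto simp: D_def \<theta>_def sq_pos_def)
    qed
  qed
  moreover have "N p = 0" by (simp add: N_def)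
  moreover have "J p > 0" by (rule pos) auto
  ultimately show False using \<psi>'(3) \<epsilon>(1) by (auto simp: D_def \<theta>_def sq_pos_def)
qed

section \<open>Frameworks in coordinates\<close>

lemma poly_fun_neg: "is_subfield K \<Longrightarrow> poly_fun K P \<Longrightarrow> poly_fun K (\<lambda>q. - P q)"
  using poly_fun.mult[OF poly_fun.const[of "-1" K], of P] by (auto simp: is_subfield_def)

lemma poly_fun_diff: "is_subfield K \<Longrightarrow> poly_fun K P \<Longrightarrow> poly_fun K Q \<Longrightarrow> poly_fun K (\<lambda>q. P q - Q q)"
  using poly_fun.add[OF _ poly_fun_neg, of K P Q] by simp

lemma poly_fun_continuous: "poly_fun K P \<Longrightarrow> continuous_on UNIV P"
  by (induction rule: poly_fun.induct) (auto intro!: continuous_intros)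

lemma is_subfield_inner:
  fixes x y :: "real ^ 'd::finite"
  shows "is_subfield K \<Longrightarrow> (\<And>c. x $ c \<in> K) \<Longrightarrow> (\<And>c. y $ c \<in> K) \<Longrightarrow> x \<bullet> y \<in> K"
  unfolding inner_vec_def by (rule is_subfield_sum) (auto simp: is_subfield_def)

text \<open>A framework in affine coordinates: the vertex \<open>v\<close> with parameter
  \<open>q $ v\<close> sits at \<open>base v + q $ v *\<^sub>R dir v\<close>, and \<open>lab\<close>
  names its line. \<open>nonparallel\<close> is the strict Cauchy-Schwarz inequality, and
  \<open>generic\<close> states genericity of the parameter vector \<open>p\<close> through
  vanishing polynomials.\<close>

locale line_framework =
  fixes K :: "real set" and base dir :: "'v::finite \<Rightarrow> real ^ 'd::finite" and lab :: "'v \<Rightarrow> nat"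
    and p :: "real ^ 'v" and E :: "('v \<times> 'v) set"
  assumes K: "is_subfield K"
    and base_K: "base v $ c \<in> K" and dir_K: "dir v $ c \<in> K"
    and same_line: "lab a = lab b \<Longrightarrow> base a = base b \<and> dir a = dir b"
    and dir_nonzero: "dir v \<noteq> 0"
    and nonparallel: "lab a \<noteq> lab b \<Longrightarrow> (dir a \<bullet> dir b)\<^sup>2 < (dir a \<bullet> dir a) * (dir b \<bullet> dir b)"
    and nonperpendicular: "lab a \<noteq> lab b \<Longrightarrow> dir a \<bullet> dir b \<noteq> 0"
    and generic: "poly_fun K P \<Longrightarrow> P p = 0 \<Longrightarrow> P q = 0"
    and sym_E: "(a, b) \<in> E \<Longrightarrow> (b, a) \<in> E" and irrefl_E: "(a, a) \<notin> E"
begin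

definition pt :: "real ^ 'v \<Rightarrow> 'v \<Rightarrow> real ^ 'd" where
  "pt q v = base v + q $ v *\<^sub>R dir v"

definition len :: "'v \<Rightarrow> 'v \<Rightarrow> real ^ 'v \<Rightarrow> real" where
  "len a b q = (norm (pt q a - pt q b))\<^sup>2"

text \<open>Half the partial derivative of \<open>len a b\<close> in the parameter of
  \<open>a\<close>, for distinct vertices.\<close>

definition drv :: "'v \<Rightarrow> 'v \<Rightarrow> real ^ 'v \<Rightarrow> real" where
  "drv a b q = (pt q a - pt q b) \<bullet> dir a"

text \<open>At most two lines, with base points at their mutually closest points. The map
  \<open>q \<mapsto> - q\<close> then preserves every \<open>len\<close>.\<close>

definition centred :: bool where
  "centred \<longleftrightarrow> (\<exists>i j. \<forall>v. lab v = i \<or> lab v = j) \<and> (\<forall>a b. (base a - base b) \<bullet> dir a = 0)"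

lemma drv_expand:
  "drv a b q = (dir a \<bullet> dir a) * q $ a - (dir a \<bullet> dir b) * q $ b + (base a - base b) \<bullet> dir a"
  by (simp add: drv_def pt_def inner_diff_left inner_add_left inner_commute algebra_simps)

lemma poly_fun_drv: "poly_fun K (drv a b)"
  unfolding drv_expand[abs_def] using base_K dir_K K
  by (intro poly_fun.add poly_fun_diff poly_fun.mult poly_fun.coord poly_fun.const K is_subfield_inner)
    (auto intro: is_subfield_diff)

lemma drv_partial:
  "has_partial (drv a b) v (\<lambda>q. (if v = a then dir a \<bullet> dir a else 0) - (if v = b then dir a \<bullet> dir b else 0))"
proof -
  have "has_partial (\<lambda>q. (dir a \<bullet> dir a) * q $ a + (- (dir a \<bullet> dir b) * q $ b + (base a - base b) \<bullet> dir a)) v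
     (\<lambda>q. (0 * q $ a + (dir a \<bullet> dir a) * (if v = a then 1 else 0))
       + ((0 * q $ b + - (dir a \<bullet> dir b) * (if v = b then 1 else 0)) + 0))"
    by (intro has_partial_add has_partial_mult has_partial_const has_partial_coord)
  then show ?thesis by (auto simp: drv_expand[abs_def] has_partial_def algebra_simps)
qed

lemma drv_centred: "centred \<Longrightarrow> drv a b (- q) = - drv a b q"
  by (simp add: drv_expand centred_def)

lemma drv_same: "lab a = lab b \<Longrightarrow> drv a b q = (dir a \<bullet> dir a) * (q $ a - q $ b)"
  using same_line[of a b] by (simp add: drv_expand algebra_simps)

lemma len_commute: "len a b q = len b a q"
  by (simp add: len_def norm_minus_commute)

text \<open>Exact expansion when the parameters of \<open>a\<close> and \<open>b\<close> change by
  \<open>s * c\<close> and \<open>s * e\<close>. The linear term yields the partial derivatives, the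
  quadratic term the second position in \<open>two_edges_leave\<close>.\<close>

lemma len_shift:
  "(norm (pt q a - pt q b + s *\<^sub>R (c *\<^sub>R dir a - e *\<^sub>R dir b)))\<^sup>2
    = len a b q + 2 * s * (c * drv a b q + e * drv b a q) + s\<^sup>2 * (norm (c *\<^sub>R dir a - e *\<^sub>R dir b))\<^sup>2"
proof -
  have "(pt q a - pt q b) \<bullet> (c *\<^sub>R dir a - e *\<^sub>R dir b) = c * drv a b q + e * drv b a q"
    by (simp add: drv_def inner_diff_right inner_diff_left algebra_simps)
  moreover have "(norm (x + s *\<^sub>R y))\<^sup>2 = (norm x)\<^sup>2 + 2 * s * (x \<bullet> y) + s\<^sup>2 * (norm y)\<^sup>2" for x y :: "real ^ 'd"
    by (simp only: power2_norm_eq_inner)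
      (simp add: inner_add_left inner_add_right inner_commute power2_eq_square algebra_simps)
  ultimately show ?thesis by (simp add: len_def)
qed

lemma len_partial:
  "has_partial (len a b) v (\<lambda>q. (if v = a then 2 * drv a b q else 0) + (if v = b then 2 * drv b a q else 0))"
  unfolding has_partial_def
proof
  fix q
  let ?c = "if v = a then 1 else 0 :: real" and ?e = "if v = b then 1 else 0 :: real"
  have "len a b (q + s *\<^sub>R axis v 1) = len a b q + 2 * s * (?c * drv a b q + ?e * drv b a q)
      + s\<^sup>2 * (norm (?c *\<^sub>R dir a - ?e *\<^sub>R dir b))\<^sup>2" for s
  proof -
    have "pt (q + s *\<^sub>R axis v 1) a - pt (q + s *\<^sub>R axis v 1) b
        = pt q a - pt q b + s *\<^sub>R (?c *\<^sub>R dir a - ?e *\<^sub>R dir b)"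
      by (simp add: pt_def axis_def algebra_simps)
    then show ?thesis unfolding len_shift[symmetric] by (simp add: len_def)
  qed
  then show "((\<lambda>s. len a b (q + s *\<^sub>R axis v 1)) has_real_derivative
      (if v = a then 2 * drv a b q else 0) + (if v = b then 2 * drv b a q else 0)) (at 0)"
    by (auto intro!: derivative_eq_intros)
qed

lemma len_continuous: "continuous_on A (len a b)"
  unfolding len_def pt_def by (intro continuous_intros)

lemma drv_continuous: "continuous_on A (drv a b)"
  unfolding drv_def pt_def by (intro continuous_intros)

lemma generic_nonzero: "poly_fun K P \<Longrightarrow> P q \<noteq> 0 \<Longrightarrow> P p \<noteq> 0"
  using generic by blast

lemma linear_generic:
  assumes "c \<in> K" "d \<in> K" "a \<noteq> b" "c \<noteq> 0" shows "c * p $ a + d * p $ b \<noteq> 0"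
proof (rule generic_nonzero[of "\<lambda>q. c * q $ a + d * q $ b" "axis a 1"])
  show "poly_fun K (\<lambda>q. c * q $ a + d * q $ b)"
    using assms by (intro poly_fun.add poly_fun.mult poly_fun.const poly_fun.coord)
qed (use assms in \<open>simp add: axis_def\<close>)

lemma coord_nonzero: "p $ a \<noteq> 0"
  by (rule generic_nonzero[of "\<lambda>q. q $ a" "axis a 1"]) (auto intro: poly_fun.coord)

lemma coord_distinct: "a \<noteq> b \<Longrightarrow> p $ a \<noteq> p $ b"
  using linear_generic[of 1 "-1" a b] K by (auto simp: is_subfield_def)

text \<open>The affine function \<open>drv a b\<close> is not identically zero: it is nonzero at the
  origin or at the unit vector of \<open>a\<close>.\<close>

lemma drv_nonzero: "a \<noteq> b \<Longrightarrow> drv a b p \<noteq> 0"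
proof (cases "drv a b 0 = 0")
  case True
  assume "a \<noteq> b"
  then have "drv a b (axis a 1) \<noteq> 0" using True dir_nonzero[of a] by (simp add: drv_expand axis_def)
  then show ?thesis using generic_nonzero[OF poly_fun_drv] by blast
qed (use generic_nonzero[OF poly_fun_drv] in blast)

text \<open>For two vertices on the same line the signed difference of parameters replaces the squared distance:
  unlike the latter it changes sign under the reflection \<open>q \<mapsto> - q\<close>.\<close>

definition slen :: "'v \<Rightarrow> 'v \<Rightarrow> real ^ 'v \<Rightarrow> real" where
  "slen a b = (if lab a = lab b then (\<lambda>q. q $ a - q $ b) else len a b)"

definition slen' :: "'v \<Rightarrow> 'v \<Rightarrow> 'v \<Rightarrow> real ^ 'v \<Rightarrow> real" where
  "slen' a b v = (if lab a = lab b then (\<lambda>q. (if v = a then 1 else 0) - (if v = b then 1 else 0))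
     else (\<lambda>q. (if v = a then 2 * drv a b q else 0) + (if v = b then 2 * drv b a q else 0)))"

lemma slen_partial: "has_partial (slen a b) v (slen' a b v)"
proof -
  have "has_partial (\<lambda>q. q $ a + (-1) * q $ b) v
      (\<lambda>q. (if v = a then 1 else 0) + (0 * q $ b + (-1) * (if v = b then 1 else 0)))"
    by (intro has_partial_add has_partial_mult has_partial_const has_partial_coord)
  then have "has_partial (\<lambda>q. q $ a - q $ b) v (\<lambda>q. (if v = a then 1 else 0) - (if v = b then 1 else 0))"
    by (simp add: has_partial_def)
  then show ?thesis using len_partial by (auto simp: slen_def slen'_def)
qed

lemma slen_continuous: "continuous_on UNIV (slen a b)" "continuous_on UNIV (slen' a b v)"
  by (cases "v = a"; cases "v = b";
      auto simp: slen_def slen'_def intro!: continuous_intros len_continuous drv_continuous)+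

lemma len_same: "lab a = lab b \<Longrightarrow> len a b q = (slen a b q)\<^sup>2 * (dir a \<bullet> dir a)"
proof -
  assume l: "lab a = lab b"
  have "pt q a - pt q b = (q $ a - q $ b) *\<^sub>R dir a"
    using same_line[OF l] by (simp add: pt_def algebra_simps)
  then show ?thesis using l by (simp add: len_def slen_def power_mult_distrib power2_norm_eq_inner)
qed

lemma len_slen: "slen a b q = slen a b q' \<Longrightarrow> len a b q = len a b q'"
  using len_same[of a b] by (cases "lab a = lab b") (auto simp: slen_def)

lemma slen_commute: "slen a b q = slen a b q' \<Longrightarrow> slen b a q = slen b a q'"
  by (auto simp: slen_def len_commute[of b a] split: if_splits)

text \<open>The derivative of \<open>slen a b\<close> along \<open>X\<close>, for distinct
  \<open>a\<close> and \<open>b\<close>.\<close>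

definition rate :: "('v \<Rightarrow> real ^ 'v \<Rightarrow> real) \<Rightarrow> 'v \<Rightarrow> 'v \<Rightarrow> real ^ 'v \<Rightarrow> real" where
  "rate X a b q = (if lab a = lab b then X a q - X b q else 2 * (X a q * drv a b q + X b q * drv b a q))"

lemma rate_sum: "a \<noteq> b \<Longrightarrow> (\<Sum>v\<in>UNIV. X v q * slen' a b v q) = rate X a b q"
  by (simp add: slen'_def rate_def algebra_simps sum.distrib sum_subtractf if_distrib[of "(*) _"] cong: if_cong)

lemma rate_generic:
  assumes X: "\<And>v. poly_fun K (X v)" and z: "rate X a b p = 0" shows "rate X a b q = 0"
proof (cases "lab a = lab b")
  case True
  then show ?thesis
    using z generic[OF poly_fun_diff[OF K X X], of a b q] by (simp add: rate_def)
next
  case False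
  then show ?thesis
    using z generic[OF poly_fun.add[OF poly_fun.mult[OF X poly_fun_drv] poly_fun.mult[OF X poly_fun_drv]], of a a b b b a q]
    by (simp add: rate_def)
qed

text \<open>Along \<open>E'\<close> each vertex reaches a vertex on a non-parallel line, and bounded
  edges keep the difference of the two points bounded. Points of two non-parallel lines separate as
  a parameter grows, so this difference bounds the parameter.\<close>

lemma slen_bounded:
  assumes E': "\<And>a b. (a, b) \<in> E' \<Longrightarrow> (b, a) \<in> E'"
    and cr: "\<And>S i. S \<noteq> {} \<Longrightarrow> (\<forall>a\<in>S. \<forall>b. (a, b) \<in> E' \<longrightarrow> b \<in> S) \<Longrightarrow> \<exists>a\<in>S. lab a \<noteq> i"
  shows "bounded {q. \<forall>(a, b)\<in>E'. \<bar>slen a b q - slen a b p\<bar> \<le> 1}"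
proof -
  define Q where "Q = {q. \<forall>(a, b)\<in>E'. \<bar>slen a b q - slen a b p\<bar> \<le> 1}"
  define B where "B a b \<longleftrightarrow> (\<exists>R. \<forall>q\<in>Q. norm (pt q a - pt q b) \<le> R)" for a b
  have edge: "B a b" if "(a, b) \<in> E'" for a b
  proof (cases "lab a = lab b")
    case True
    have "norm (pt q a - pt q b) \<le> (\<bar>slen a b p\<bar> + 1) * norm (dir a)" if q: "q \<in> Q" for q
    proof -
      have "pt q a - pt q b = slen a b q *\<^sub>R dir a"
        using same_line[OF True] True by (simp add: pt_def slen_def algebra_simps)
      moreover have "\<bar>slen a b q - slen a b p\<bar> \<le> 1" using q \<open>(a, b) \<in> E'\<close> by (auto simp: Q_def)
      ultimately show ?thesis by (auto intro!: mult_right_mono)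
    qed
    then show ?thesis unfolding B_def by blast
  next
    case False
    have "norm (pt q a - pt q b) \<le> len a b p + 2" if q: "q \<in> Q" for q
    proof -
      have "\<bar>len a b q - len a b p\<bar> \<le> 1" using q \<open>(a, b) \<in> E'\<close> False by (auto simp: Q_def slen_def)
      moreover have "norm (pt q a - pt q b) \<le> len a b q + 1"
      proof -
        have "0 \<le> (norm (pt q a - pt q b) - 1)\<^sup>2 + norm (pt q a - pt q b)" by simp
        then show ?thesis by (simp add: len_def power2_eq_square algebra_simps)
      qed
      ultimately show ?thesis by linarith
    qed
    then show ?thesis unfolding B_def by blast
  qed
  have conn: "B a b" if "(a, b) \<in> E'\<^sup>*" for a b
    using that
  proof (induction rule: rtrancl_induct)
    case base
    then show ?case by (auto simp: B_def)
  next
    case (step b c)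
    obtain R where R: "\<And>q. q \<in> Q \<Longrightarrow> norm (pt q a - pt q b) \<le> R" using step.IH by (auto simp: B_def)
    obtain R' where R': "\<And>q. q \<in> Q \<Longrightarrow> norm (pt q b - pt q c) \<le> R'" using edge[OF step.hyps(2)] by (auto simp: B_def)
    have "norm (pt q a - pt q c) \<le> R + R'" if "q \<in> Q" for q
      using norm_triangle_ineq[of "pt q a - pt q b" "pt q b - pt q c"] R[OF that] R'[OF that] by simp
    then show ?case unfolding B_def by blast
  qed
  have "\<exists>R. \<forall>q\<in>Q. \<bar>q $ v\<bar> \<le> R" for v
  proof -
    have "\<exists>b\<in>E'\<^sup>* `` {v}. lab b \<noteq> lab v"
      by (rule cr) (auto intro: rtrancl_into_rtrancl)
    then obtain b where b: "(v, b) \<in> E'\<^sup>*" "lab v \<noteq> lab b" by auto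
    obtain R where R: "\<And>q. q \<in> Q \<Longrightarrow> norm (pt q v - pt q b) \<le> R" using conn[OF b(1)] by (auto simp: B_def)
    \<comment> \<open>\<open>r\<close> is orthogonal to \<open>dir b\<close>, so pairing with it
      removes the parameter of \<open>b\<close>; its pairing with \<open>dir v\<close> is the
      positive Gram determinant \<open>c\<close>.\<close>
    define r where "r = (dir b \<bullet> dir b) *\<^sub>R dir v - (dir v \<bullet> dir b) *\<^sub>R dir b"
    define c where "c = (dir v \<bullet> dir v) * (dir b \<bullet> dir b) - (dir v \<bullet> dir b)\<^sup>2"
    have c: "c > 0" using nonparallel[OF b(2)] by (simp add: c_def)
    have "\<bar>q $ v\<bar> \<le> (R * norm r + \<bar>(base v - base b) \<bullet> r\<bar>) / c" if q: "q \<in> Q" for q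
    proof -
      have "(pt q v - pt q b) \<bullet> r = (base v - base b) \<bullet> r + q $ v * c"
        by (simp add: pt_def r_def c_def inner_diff_left inner_diff_right inner_add_left inner_commute
            algebra_simps power2_eq_square)
      moreover have "\<bar>(pt q v - pt q b) \<bullet> r\<bar> \<le> R * norm r"
        using Cauchy_Schwarz_ineq2[of "pt q v - pt q b" r] mult_right_mono[OF R[OF q] norm_ge_zero[of r]] by linarith
      ultimately have "\<bar>q $ v * c\<bar> \<le> R * norm r + \<bar>(base v - base b) \<bullet> r\<bar>" by linarith
      then show ?thesis using c by (simp add: abs_mult pos_le_divide_eq)
    qed
    then show ?thesis by blast
  qed
  then obtain R where R: "\<And>v q. q \<in> Q \<Longrightarrow> \<bar>q $ v\<bar> \<le> R v" by metis
  have "norm q \<le> (\<Sum>v\<in>UNIV. R v)" if "q \<in> Q" for q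
    using norm_le_l1_cart[of q] sum_mono[of UNIV "\<lambda>v. \<bar>q $ v\<bar>" R] R[OF that] by fastforce
  then show ?thesis unfolding Q_def bounded_iff by blast
qed

end

context line_framework
begin

text \<open>The vector field moves the vertices of \<open>S\<close> along a tree \<open>T\<close> of edges, preserving their lengths;
  at \<open>p\<close> it is a multiple of the given flex \<open>y\<close>.\<close>

definition tree_field ::
    "('v \<times> 'v) set \<Rightarrow> ('v \<Rightarrow> real) \<Rightarrow> 'v set \<Rightarrow> ('v \<times> 'v) set \<Rightarrow> ('v \<Rightarrow> real ^ 'v \<Rightarrow> real) \<Rightarrow> bool" where
  "tree_field E' y S T X \<longleftrightarrow> T \<subseteq> E' \<inter> S \<times> S \<and> card T + 2 = 2 * card S \<and>
     (\<forall>v. poly_fun K (X v)) \<and> (\<forall>v q. v \<notin> S \<longrightarrow> X v q = 0) \<and>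
     (\<forall>v q q'. (\<forall>s\<in>S. q $ s = q' $ s) \<longrightarrow> X v q = X v q') \<and>
     (\<exists>X'. (\<forall>v. continuous_on UNIV (X' v) \<and> has_partial (X v) v (X' v)) \<and> (\<forall>q. (\<Sum>v\<in>UNIV. X' v q) = 0)) \<and>
     (\<forall>q. (\<forall>(a, b)\<in>T. drv a b q \<noteq> 0) \<longrightarrow> (\<forall>v\<in>S. X v q \<noteq> 0)) \<and>
     (\<exists>m. m \<noteq> 0 \<and> (\<forall>v\<in>S. X v p = m * y v)) \<and>
     (centred \<longrightarrow> (\<forall>v q. - X v (- q) = (-1) ^ card S * X v q))"

lemma tree_field_single:
  assumes "y v0 \<noteq> 0"
  shows "tree_field E' y {v0} {} (\<lambda>v q. if v = v0 then 1 else 0)"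
proof -
  have "poly_fun K (\<lambda>q :: real ^ 'v. 1)" "poly_fun K (\<lambda>q :: real ^ 'v. 0)"
    using K by (auto simp: is_subfield_def intro: poly_fun.const)
  moreover have "\<exists>X'. (\<forall>v. continuous_on UNIV (X' v) \<and> has_partial (\<lambda>q. if v = v0 then 1 else 0) v (X' v)) \<and>
    (\<forall>q :: real ^ 'v. (\<Sum>v\<in>UNIV. X' v q) = (0 :: real))"
    by (rule exI[of _ "\<lambda>_ _. 0"]) (simp add: has_partial_const)
  ultimately show ?thesis
    unfolding tree_field_def using assms by (auto intro!: exI[of _ "inverse (y v0)"])
qed

text \<open>The factors are chosen so that the new edge keeps its length:
  \<open>X a q * drv l a q * drv a l q\<close> occurs with both signs, while the common factor
  \<open>drv l a\<close> does no harm to the earlier edges. In the divergence the two new terms,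
  from \<open>l\<close> and from \<open>a\<close>, cancel by symmetry of the inner product. Each
  component gains one factor that is odd under the reflection.\<close>

lemma tree_field_grow:
  assumes tf: "tree_field E' y S T X" and e: "(a, l) \<in> E'" "(l, a) \<in> E'" "a \<in> S" "l \<notin> S"
    and flex: "y a * drv a l p + y l * drv l a p = 0"
  shows "tree_field E' y (insert l S) (insert (a, l) (insert (l, a) T))
    (\<lambda>v q. if v = l then - (X a q * drv a l q) else X v q * drv l a q)"
    (is "tree_field E' y ?S ?T ?Y")
proof -
  have al: "a \<noteq> l" using e by auto
  have T: "T \<subseteq> E' \<inter> S \<times> S" "card T + 2 = 2 * card S" and pX: "\<And>v. poly_fun K (X v)"
    and X0: "\<And>v q. v \<notin> S \<Longrightarrow> X v q = 0"
    and dep: "\<And>v q q'. (\<And>s. s \<in> S \<Longrightarrow> q $ s = q' $ s) \<Longrightarrow> X v q = X v q'"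
    and nz: "\<And>q v. \<lbrakk>\<And>a b. (a, b) \<in> T \<Longrightarrow> drv a b q \<noteq> 0; v \<in> S\<rbrakk> \<Longrightarrow> X v q \<noteq> 0"
    and par: "\<And>v q. centred \<Longrightarrow> - X v (- q) = (-1) ^ card S * X v q"
    using tf unfolding tree_field_def by blast+
  obtain m where m: "m \<noteq> 0" "\<And>v. v \<in> S \<Longrightarrow> X v p = m * y v"
    using tf unfolding tree_field_def by blast
  have "\<exists>X'. (\<forall>v. continuous_on UNIV (X' v) \<and> has_partial (X v) v (X' v)) \<and> (\<forall>q. (\<Sum>v\<in>UNIV. X' v q) = 0)"
    using tf unfolding tree_field_def by (elim conjE)
  then obtain X' where X'_ex: "\<forall>v. continuous_on UNIV (X' v) \<and> has_partial (X v) v (X' v)"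
    "\<forall>q. (\<Sum>v\<in>UNIV. X' v q) = 0"
    by (elim exE conjE) (rule that)
  note X' = X'_ex(1)[rule_format, THEN conjunct1] X'_ex(1)[rule_format, THEN conjunct2] X'_ex(2)[rule_format]
  have ST: "?T \<subseteq> E' \<inter> ?S \<times> ?S" "card ?T + 2 = 2 * card ?S"
  proof -
    show "?T \<subseteq> E' \<inter> ?S \<times> ?S" using T e by auto
    have "(a, l) \<notin> T" "(l, a) \<notin> T" using T e by auto
    then show "card ?T + 2 = 2 * card ?S" using T(2) e al by simp
  qed
  have pY: "poly_fun K (?Y v)" for v
  proof (cases "v = l")
    case True
    then show ?thesis using poly_fun_neg[OF K poly_fun.mult[OF pX[of a] poly_fun_drv[of a l]]] by simp
  next
    case False
    then show ?thesis using poly_fun.mult[OF pX poly_fun_drv] by simp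
  qed
  have Y0: "?Y v q = 0" if "v \<notin> ?S" for v q using that X0 by auto
  have depY: "?Y v q = ?Y v q'" if "\<forall>s\<in>?S. q $ s = q' $ s" for v q q'
  proof -
    have "X w q = X w q'" for w by (rule dep) (use that in auto)
    moreover have "drv a l q = drv a l q'" "drv l a q = drv l a q'"
      using that e(3) by (auto simp: drv_expand)
    ultimately show ?thesis by simp
  qed
  define Y' where "Y' v q = (if v = l then X a q * (dir a \<bullet> dir l)
    else X' v q * drv l a q - (if v = a then X a q * (dir l \<bullet> dir a) else 0))" for v q
  have Y': "continuous_on UNIV (Y' v)" "has_partial (?Y v) v (Y' v)" for v
  proof -
    show "continuous_on UNIV (Y' v)"
      unfolding Y'_def by (cases "v = l"; cases "v = a")
        (auto intro!: continuous_intros X' drv_continuous poly_fun_continuous[OF pX])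
    show "has_partial (?Y v) v (Y' v)"
    proof (cases "v = l")
      case True
      \<comment> \<open>The components of \<open>X\<close> do not depend on the parameter of the new
        vertex, which lies outside \<open>S\<close>.\<close>
      have "has_partial (X a) l (\<lambda>q. 0)"
        unfolding has_partial_def
      proof
        fix q
        have "X a (q + s *\<^sub>R axis l 1) = X a q" for s
          by (rule dep) (use e in \<open>auto simp: axis_def\<close>)
        then show "((\<lambda>s. X a (q + s *\<^sub>R axis l 1)) has_real_derivative 0) (at 0)" by simp
      qed
      then have "has_partial (\<lambda>q. (-1) * (X a q * drv a l q)) l
          (\<lambda>q. 0 * (X a q * drv a l q) + (-1) * (0 * drv a l q + X a q *
            ((if l = a then dir a \<bullet> dir a else 0) - (if l = l then dir a \<bullet> dir l else 0))))"
        by (intro has_partial_mult has_partial_const drv_partial)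
      then show ?thesis using True al by (simp add: Y'_def[abs_def])
    next
      case False
      have "has_partial (\<lambda>q. X v q * drv l a q) v
         (\<lambda>q. X' v q * drv l a q + X v q * ((if v = l then dir l \<bullet> dir l else 0) - (if v = a then dir l \<bullet> dir a else 0)))"
        by (intro has_partial_mult X' drv_partial)
      then have "has_partial (?Y v) v
         (\<lambda>q. X' v q * drv l a q + X v q * ((if v = l then dir l \<bullet> dir l else 0) - (if v = a then dir l \<bullet> dir a else 0)))"
        using False by simp
      then show ?thesis by (rule has_partial_eq) (use False in \<open>simp add: Y'_def\<close>)
    qed
  qed
  have divY: "(\<Sum>v\<in>UNIV. Y' v q) = 0" for q
  proof -
    \<comment> \<open>\<open>X l\<close> is identically zero, as \<open>l\<close> lies outside
      \<open>S\<close>, so its term may stay in the sum.\<close>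
    have "has_partial (X l) l (\<lambda>q. 0)" using X0[OF e(4)] by (simp add: has_partial_def)
    then have l0: "X' l q = 0" using has_partial_unique[OF X'(2)] by blast
    have "(\<Sum>v\<in>UNIV. Y' v q) = (\<Sum>v\<in>UNIV. X' v q * drv l a q + (if v = l then X a q * (dir a \<bullet> dir l) else 0)
        - (if v = a then X a q * (dir l \<bullet> dir a) else 0))"
      using l0 al by (intro sum.cong) (auto simp: Y'_def)
    also have "\<dots> = (\<Sum>v\<in>UNIV. X' v q) * drv l a q"
      by (simp add: sum.distrib sum_subtractf sum_distrib_right inner_commute)
    finally show ?thesis using X'(3) by simp
  qed
  have nzY: "?Y v q \<noteq> 0" if "\<forall>(b, c)\<in>?T. drv b c q \<noteq> 0" "v \<in> ?S" for v q
  proof -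
    have "X w q \<noteq> 0" if "w \<in> S" for w using nz[OF _ that] \<open>\<forall>(b, c)\<in>?T. drv b c q \<noteq> 0\<close> by blast
    then show ?thesis using that e(3) by auto
  qed
  \<comment> \<open>The flex equation of the new edge turns \<open>- y a * drv a l p\<close> into
    \<open>y l * drv l a p\<close>, so the factor \<open>m\<close> is multiplied by
    \<open>drv l a p\<close> at every vertex.\<close>
  have propY: "?Y v p = (m * drv l a p) * y v" if "v \<in> ?S" for v
    using that m(2) m(2)[OF e(3)] e flex by (auto simp: algebra_simps add_eq_0_iff)
  have parY: "- ?Y v (- q) = (-1) ^ card ?S * ?Y v q" if c: "centred" for v q
  proof -
    have "X w (- q) = - ((-1) ^ card S * X w q)" for w using par[OF c, of w q] by linarith
    then show ?thesis using e(4) by (simp add: drv_centred[OF c])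
  qed
  have "m * drv l a p \<noteq> 0" using m(1) drv_nonzero[of l a] al by simp
  then have "\<exists>m. m \<noteq> 0 \<and> (\<forall>v\<in>?S. ?Y v p = m * y v)" using propY by (intro exI conjI ballI)
  moreover have "\<exists>Y'. (\<forall>v. continuous_on UNIV (Y' v) \<and> has_partial (?Y v) v (Y' v)) \<and> (\<forall>q. (\<Sum>v\<in>UNIV. Y' v q) = 0)"
    by (intro exI[of _ Y'] conjI allI Y' divY)
  moreover have "\<forall>q. (\<forall>(a, b)\<in>?T. drv a b q \<noteq> 0) \<longrightarrow> (\<forall>v\<in>?S. ?Y v q \<noteq> 0)"
    by (intro allI impI, rule ballI, rule nzY)
  moreover have "\<forall>v q q'. (\<forall>s\<in>?S. q $ s = q' $ s) \<longrightarrow> ?Y v q = ?Y v q'"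
    by (intro allI impI depY)
  moreover have "\<forall>v q. v \<notin> ?S \<longrightarrow> ?Y v q = 0" by (intro allI impI Y0)
  moreover have "centred \<longrightarrow> (\<forall>v q. - ?Y v (- q) = (-1) ^ card ?S * ?Y v q)" by (intro allI impI parY)
  moreover have "\<forall>v. poly_fun K (?Y v)" by (intro allI pY)
  ultimately show ?thesis unfolding tree_field_def using ST by (intro conjI)
qed

text \<open>A largest set carrying a tree field is closed under \<open>E'\<close>, since an edge
  leaving it would let the field grow.\<close>

lemma tree_field_exists:
  assumes E': "E' \<subseteq> E" "\<And>a b. (a, b) \<in> E' \<Longrightarrow> (b, a) \<in> E'"
    and flex: "\<And>a b. (a, b) \<in> E' \<Longrightarrow> y a * drv a b p + y b * drv b a p = 0"
    and v0: "y v0 \<noteq> 0"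
  shows "\<exists>S T X. v0 \<in> S \<and> tree_field E' y S T X \<and> (\<forall>a\<in>S. \<forall>b. (a, b) \<in> E' \<longrightarrow> b \<in> S)"
proof -
  define P where "P S \<longleftrightarrow> v0 \<in> S \<and> (\<exists>T X. tree_field E' y S T X)" for S
  have "P {v0}" using tree_field_single[of y v0 E', OF v0] by (auto simp: P_def)
  then obtain S where S: "P S" "\<And>S'. P S' \<Longrightarrow> card S' \<le> card S"
    using ex_has_greatest_nat[of P "{v0}" card "CARD('v) + 1"] card_mono[of "UNIV :: 'v set"]
    by (metis finite less_Suc_eq_le subset_UNIV Suc_eq_plus1)
  have "b \<in> S" if "a \<in> S" "(a, b) \<in> E'" for a b
  proof (rule ccontr)
    assume "b \<notin> S"
    then have "P (insert b S)"
      using S(1) tree_field_grow[OF _ that(2) E'(2)[OF that(2)] that(1) _ flex[OF that(2)]] unfolding P_def by blast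
    then show False using S(2)[of "insert b S"] \<open>b \<notin> S\<close> by simp
  qed
  then show ?thesis using S(1) unfolding P_def by blast
qed

end

text \<open>Global rigidity in terms of parameters: isometries of the used lines act on them as the
  identity or, in the centred case, possibly as \<open>q \<mapsto> - q\<close>.\<close>

locale globally_rigid_line_framework = line_framework K base dir lab p E
  for K and base dir :: "'v::finite \<Rightarrow> real ^ 'd::finite" and lab p E +
  assumes crossing: "\<exists>a b. lab a \<noteq> lab b"
    and global: "(\<And>a b. (a, b) \<in> E \<Longrightarrow> len a b q = len a b p) \<Longrightarrow> q = p \<or> centred \<and> q = - p"
begin

text \<open>Otherwise translating \<open>S\<close> along its line to the second solution of a quadratic equation
  would contradict global rigidity.\<close>

lemma two_edges_leave:
  assumes S: "S \<noteq> {}" "\<forall>a\<in>S. lab a = i"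
  shows "\<exists>a\<in>S. \<exists>b. b \<notin> S \<and> (a, b) \<in> E \<and> (a, b) \<noteq> (c, d)"
proof (rule ccontr)
  assume "\<not> ?thesis"
  then have one: "a = c \<and> b = d" if "a \<in> S" "b \<notin> S" "(a, b) \<in> E" for a b using that by auto
  obtain s where s: "s \<in> S" using S(1) by auto
  \<comment> \<open>If \<open>c d\<close> leaves \<open>S\<close>, this is the nonzero root of
    \<open>\<tau> * (2 * drv c d p + \<tau> * (dir c \<bullet> dir c)) = 0\<close>, the condition
    that its length is kept; otherwise any nonzero translation works.\<close>
  define \<tau> where "\<tau> = (if c \<in> S \<and> d \<notin> S then - 2 * drv c d p / (dir c \<bullet> dir c) else 1)"
  have "\<tau> \<noteq> 0" using drv_nonzero[of c d] dir_nonzero[of c] by (auto simp: \<tau>_def)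
  define q where "q = (\<chi> v. if v \<in> S then p $ v + \<tau> else p $ v)"
  have pt: "pt q v = pt p v + (if v \<in> S then \<tau> *\<^sub>R dir v else 0)" for v
    by (simp add: pt_def q_def algebra_simps)
  have out: "len a b q = len a b p" if "a \<in> S" "b \<notin> S" "(a, b) \<in> E" for a b
  proof -
    have ab: "a = c" "b = d" using one that by auto
    have "pt q a - pt q b = pt p a - pt p b + \<tau> *\<^sub>R (1 *\<^sub>R dir a - 0 *\<^sub>R dir b)"
      using that by (simp add: pt)
    then have "len a b q = len a b p + 2 * \<tau> * (1 * drv a b p + 0 * drv b a p) + \<tau>\<^sup>2 * (norm (1 *\<^sub>R dir a - 0 *\<^sub>R dir b))\<^sup>2"
      unfolding len_shift[symmetric] by (simp add: len_def)
    also have "\<dots> = len a b p + \<tau> * (2 * drv a b p + \<tau> * (dir a \<bullet> dir a))"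
      by (simp add: power2_eq_square algebra_simps flip: power2_norm_eq_inner)
    also have "2 * drv a b p + \<tau> * (dir a \<bullet> dir a) = 0"
      using that ab dir_nonzero[of c] by (simp add: \<tau>_def)
    finally show ?thesis by simp
  qed
  have "len a b q = len a b p" if e: "(a, b) \<in> E" for a b
  proof -
    consider "a \<in> S" "b \<notin> S" | "a \<notin> S" "b \<in> S" | "a \<in> S" "b \<in> S" | "a \<notin> S" "b \<notin> S" by blast
    then show ?thesis
    proof cases
      case 2
      then show ?thesis using out[of b a] sym_E[OF e] by (simp add: len_commute)
    next
      case 3
      then have "dir a = dir b" using S(2) same_line by metis
      then show ?thesis using 3 by (simp add: len_def pt)
    qed (use out e in \<open>auto simp: len_def pt\<close>)
  qed
  then have "q = p \<or> q = - p" using global by blast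
  moreover have "q $ s \<noteq> p $ s" using s \<open>\<tau> \<noteq> 0\<close> by (simp add: q_def)
  \<comment> \<open>A vertex outside \<open>S\<close> is unmoved and has a nonzero parameter, which
    rules out \<open>- p\<close>.\<close>
  moreover obtain w where "w \<notin> S" using crossing S(2) by metis
  then have "q $ w \<noteq> (- p) $ w" using coord_nonzero[of w] by (simp add: q_def)
  ultimately show False by metis
qed

lemma degree_ge_2: "2 \<le> card {b. (a, b) \<in> E}"
proof -
  obtain b where b: "b \<noteq> a" "(a, b) \<in> E" using two_edges_leave[of "{a}" "lab a" a a] by auto
  obtain c where c: "(a, c) \<in> E" "c \<noteq> b" using two_edges_leave[of "{a}" "lab a" a b] by auto
  have "card {b, c} \<le> card {b. (a, b) \<in> E}" using b c by (intro card_mono) auto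
  then show ?thesis using c by simp
qed

text \<open>An edge \<open>ab\<close> outside the tree would have \<open>X b\<close> vanish on the hyperplane \<open>drv a b = 0\<close>.\<close>

lemma tree_field_all_edges:
  assumes tf: "tree_field E' y S T X" and E': "E' \<subseteq> E"
    and c: "centred" and across: "\<And>a b. (a, b) \<in> E \<Longrightarrow> lab a \<noteq> lab b"
    and rate: "\<And>a b q. (a, b) \<in> E' \<Longrightarrow> rate X a b q = 0"
    and ab: "(a, b) \<in> E'" "b \<in> S"
  shows "(a, b) \<in> T"
proof (rule ccontr)
  assume nT: "(a, b) \<notin> T"
  have T: "T \<subseteq> E" and nz: "\<And>q. (\<And>a b. (a, b) \<in> T \<Longrightarrow> drv a b q \<noteq> 0) \<Longrightarrow> X b q \<noteq> 0"
    using tf E' ab unfolding tree_field_def by blast+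
  have dr: "drv y z q = (dir y \<bullet> dir y) * q $ y - (dir y \<bullet> dir z) * q $ z" for y z q
    using c by (simp add: drv_expand centred_def)
  have lab: "lab a \<noteq> lab b" and "a \<noteq> b" using across E' ab irrefl_E by auto
  have A: "dir z \<bullet> dir z > 0" for z using dir_nonzero by simp
  have inK: "dir y \<bullet> dir z \<in> K" for y z by (rule is_subfield_inner[OF K dir_K dir_K])
  define t where "t = (dir a \<bullet> dir b) / (dir a \<bullet> dir a)"
  have tK: "t \<in> K" unfolding t_def by (rule is_subfield_divide[OF K inK inK])
  have t0: "t \<noteq> 0" using nonperpendicular[OF lab] A[of a] by (simp add: t_def)
  \<comment> \<open>Moving \<open>a\<close> alone makes \<open>drv a b\<close> vanish. On
    \<open>T\<close> the other values of \<open>drv\<close> become nontrivial linear forms over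
    \<open>K\<close> in the generic parameters; that of \<open>(b, a)\<close> is nonzero because the
    two lines are not parallel.\<close>
  define q where "q = (\<chi> w. if w = a then t * p $ b else p $ w)"
  have dab: "drv a b q = 0" using \<open>a \<noteq> b\<close> A[of a] by (simp add: dr q_def t_def)
  have dba: "drv b a q \<noteq> 0"
  proof
    assume "drv b a q = 0"
    then have "(dir b \<bullet> dir b) * p $ b = (dir b \<bullet> dir a) * (t * p $ b)"
      using \<open>a \<noteq> b\<close> by (simp add: dr q_def)
    then have "dir b \<bullet> dir b = (dir b \<bullet> dir a) * t" using coord_nonzero[of b] by simp
    then have "(dir a \<bullet> dir a) * (dir b \<bullet> dir b) = (dir a \<bullet> dir b)\<^sup>2"
      using A[of a] by (simp add: t_def inner_commute power2_eq_square field_simps)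
    then show False using nonparallel[OF lab] by simp
  qed
  have "drv y z q \<noteq> 0" if yz: "(y, z) \<in> T" for y z
  proof -
    have l: "lab y \<noteq> lab z" and ne: "y \<noteq> z" using across T yz irrefl_E by auto
    have neg: "- x \<in> K" if "x \<in> K" for x using that K by (simp add: is_subfield_def)
    have mul: "x * w \<in> K" if "x \<in> K" "w \<in> K" for x w using that K by (simp add: is_subfield_def)
    consider "y = a" "z \<noteq> b" | "z = a" "y = b" | "z = a" "y \<noteq> b" | "y \<noteq> a" "z \<noteq> a" using nT yz by blast
    then show ?thesis
    proof cases
      case 1
      have "(- (dir y \<bullet> dir z)) * p $ z + ((dir y \<bullet> dir y) * t) * p $ b \<noteq> 0"
        using 1 nonperpendicular[OF l] inK tK by (intro linear_generic neg mul) auto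
      then show ?thesis using 1 ne by (simp add: dr q_def)
    next
      case 2
      then show ?thesis using dba by simp
    next
      case 3
      have "(dir y \<bullet> dir y) * p $ y + (- ((dir y \<bullet> dir z) * t)) * p $ b \<noteq> 0"
        using 3 A[of y] inK tK by (intro linear_generic neg mul) auto
      then show ?thesis using 3 ne by (simp add: dr q_def)
    next
      case 4
      then show ?thesis using drv_nonzero[OF ne] by (simp add: dr q_def)
    qed
  qed
  then have "X b q \<noteq> 0" by (rule nz)
  then show False using rate[OF ab(1), of q] lab dab dba by (simp add: rate_def)
qed

text \<open>Every ordered edge starting in \<open>S\<close> is a tree edge or the deleted edge, so
  there are at most \<open>2 * card S\<close>, while minimum degree two gives every set of vertices
  at least twice its size. The edges join the two lines, so equally many start in \<open>S1\<close>
  and in \<open>S2\<close>; equality in the counts then forces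
  \<open>card S1 = card S2\<close>.\<close>

lemma tree_field_even:
  assumes tf: "tree_field E' y S T X" and E'_def: "E' = E - {(u, v), (v, u)}"
    and c: "centred" and across: "\<And>a b. (a, b) \<in> E \<Longrightarrow> lab a \<noteq> lab b"
    and closed: "\<And>a b. a \<in> S \<Longrightarrow> (a, b) \<in> E' \<Longrightarrow> b \<in> S"
    and rate: "\<And>a b q. (a, b) \<in> E' \<Longrightarrow> rate X a b q = 0"
  shows "even (card S)"
proof -
  have T: "T \<subseteq> E' \<inter> S \<times> S" "card T + 2 = 2 * card S" using tf by (auto simp: tree_field_def)
  define F where "F = {e \<in> E. fst e \<in> S}"
  have F: "F \<subseteq> T \<union> {(u, v), (v, u)}"
  proof
    fix e assume e: "e \<in> F"
    then obtain a b where ab: "e = (a, b)" "a \<in> S" "(a, b) \<in> E" by (cases e) (auto simp: F_def)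
    show "e \<in> T \<union> {(u, v), (v, u)}"
    proof (cases "(a, b) \<in> E'")
      case True
      then show ?thesis
        using tree_field_all_edges[OF tf _ c across rate True closed[OF ab(2) True]] ab by (auto simp: E'_def)
    qed (use ab in \<open>auto simp: E'_def\<close>)
  qed
  have deg: "card {e \<in> E. fst e = a} \<ge> 2" for a
  proof -
    have "{e \<in> E. fst e = a} = Pair a ` {b. (a, b) \<in> E}" by force
    then show ?thesis using degree_ge_2[of a] by (simp add: card_image inj_on_def)
  qed
  have cardF: "card {e \<in> E. fst e \<in> S'} = (\<Sum>a\<in>S'. card {e \<in> E. fst e = a})" for S'
  proof -
    have "{e \<in> E. fst e \<in> S'} = (\<Union>a\<in>S'. {e \<in> E. fst e = a})" by auto
    then show ?thesis using card_UN_disjoint[of S' "\<lambda>a. {e \<in> E. fst e = a}"] by auto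
  qed
  have ge: "2 * card S' \<le> card {e \<in> E. fst e \<in> S'}" for S'
    unfolding cardF using sum_mono[of S' "\<lambda>_. 2" "\<lambda>a. card {e \<in> E. fst e = a}"] deg by simp
  have le: "card F \<le> card T + card {(u, v), (v, u)}"
    using card_mono[OF _ F] card_Un_le[of T "{(u, v), (v, u)}"] by (meson finite order_trans)
  also have "\<dots> \<le> 2 * card S" using T(2) card_insert_le_m1[of 2 "{(v, u)}" "(u, v)"] by simp
  finally have "card F \<le> 2 * card S" .
  have "card (T \<union> {(u, v), (v, u)}) \<le> 2 * card S"
    using card_Un_le[of T "{(u, v), (v, u)}"] T(2) card_insert_le_m1[of 2 "{(v, u)}" "(u, v)"] by simp
  moreover have "card F \<ge> 2 * card S" using ge[of S] by (simp add: F_def)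
  \<comment> \<open>Equality places both ends of the deleted edge in \<open>S\<close>, so that no
    edge of \<open>E\<close> leaves \<open>S\<close>.\<close>
  ultimately have FT: "F = T \<union> {(u, v), (v, u)}"
    using F by (intro card_subset_eq) (auto intro: antisym[OF card_mono])
  obtain i j where ij: "\<And>w. lab w = i \<or> lab w = j" using c by (auto simp: centred_def)
  define S1 where "S1 = {a \<in> S. lab a = i}"
  define S2 where "S2 = {a \<in> S. lab a \<noteq> i}"
  have S12: "S = S1 \<union> S2" "S1 \<inter> S2 = {}" by (auto simp: S1_def S2_def)
  have "(u, v) \<in> F" "(v, u) \<in> F" unfolding FT by auto
  then have uv: "u \<in> S" "v \<in> S" by (simp_all add: F_def)
  have snd: "b \<in> S" if "(a, b) \<in> E" "a \<in> S" for a b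
  proof -
    have "(a, b) \<in> F" using that by (simp add: F_def)
    then show ?thesis unfolding FT using T(1) uv by blast
  qed
  have "bij_betw prod.swap {e \<in> E. fst e \<in> S1} {e \<in> E. fst e \<in> S2}"
  proof (rule bij_betw_byWitness[where f' = prod.swap])
    show "prod.swap ` {e \<in> E. fst e \<in> S1} \<subseteq> {e \<in> E. fst e \<in> S2}"
      using snd across sym_E by (auto simp: S1_def S2_def)
    show "prod.swap ` {e \<in> E. fst e \<in> S2} \<subseteq> {e \<in> E. fst e \<in> S1}"
    proof clarsimp
      fix a b assume ab: "(a, b) \<in> E" "a \<in> S2"
      then have "lab b = i" using across[of a b] ij[of a] ij[of b] by (auto simp: S2_def)
      then show "(b, a) \<in> E \<and> b \<in> S1" using ab snd sym_E by (auto simp: S1_def S2_def)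
    qed
  qed auto
  then have eq: "card {e \<in> E. fst e \<in> S1} = card {e \<in> E. fst e \<in> S2}" by (rule bij_betw_same_card)
  have "card {e \<in> E. fst e \<in> S1} + card {e \<in> E. fst e \<in> S2} = card F"
  proof -
    have "F = {e \<in> E. fst e \<in> S1} \<union> {e \<in> E. fst e \<in> S2}" using S12(1) by (auto simp: F_def)
    then show ?thesis using S12(2) by (subst card_Un_disjoint[symmetric]) auto
  qed
  moreover have "card S = card S1 + card S2" using S12 by (simp add: card_Un_disjoint)
  ultimately have "card S1 = card S2" using eq ge[of S1] ge[of S2] \<open>card F \<le> 2 * card S\<close> by linarith
  then show ?thesis using \<open>card S = card S1 + card S2\<close> by simp
qed

theorem flex_zero:
  assumes uv: "(u, v) \<in> E" and E'_def: "E' = E - {(u, v), (v, u)}"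
    and flex: "\<And>a b. (a, b) \<in> E' \<Longrightarrow> y a * drv a b p + y b * drv b a p = 0"
  shows "y w = 0"
proof (rule ccontr)
  assume w: "y w \<noteq> 0"
  have "u \<noteq> v" using uv irrefl_E by auto
  have E': "E' \<subseteq> E" "\<And>a b. (a, b) \<in> E' \<Longrightarrow> (b, a) \<in> E'" using sym_E by (auto simp: E'_def)
  obtain S T X where S: "w \<in> S" "tree_field E' y S T X" "\<And>a b. a \<in> S \<Longrightarrow> (a, b) \<in> E' \<Longrightarrow> b \<in> S"
    using tree_field_exists[of E' y w, OF E' flex w] by blast
  have pX: "\<And>v. poly_fun K (X v)" and X0: "\<And>v q. v \<notin> S \<Longrightarrow> X v q = 0"
    using S(2) unfolding tree_field_def by blast+
  obtain m where m: "m \<noteq> 0" "\<And>v. v \<in> S \<Longrightarrow> X v p = m * y v"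
    using S(2) unfolding tree_field_def by blast
  have "\<exists>X'. (\<forall>v. continuous_on UNIV (X' v) \<and> has_partial (X v) v (X' v)) \<and> (\<forall>q. (\<Sum>v\<in>UNIV. X' v q) = 0)"
    using S(2) unfolding tree_field_def by (elim conjE)
  then obtain X' where X'_ex: "\<forall>v. continuous_on UNIV (X' v) \<and> has_partial (X v) v (X' v)"
    "\<forall>q. (\<Sum>v\<in>UNIV. X' v q) = 0"
    by (elim exE conjE) (rule that)
  note X' = X'_ex(1)[rule_format, THEN conjunct1] X'_ex(1)[rule_format, THEN conjunct2] X'_ex(2)[rule_format]
  have rate': "rate X a b q = 0" if ab: "(a, b) \<in> E'" for a b q
  proof (rule rate_generic[OF pX])
    have "a \<noteq> b" using ab E' irrefl_E by auto
    show "rate X a b p = 0"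
    proof (cases "a \<in> S")
      case False
      then have "b \<notin> S" using S(3) E'(2)[OF ab] by blast
      then show ?thesis using False X0 by (simp add: rate_def)
    next
      case True
      then have b: "b \<in> S" using S(3) ab by blast
      show ?thesis
      proof (cases "lab a = lab b")
        case l: True
        \<comment> \<open>On a common line the flex equation factors, and the generic difference
          \<open>p $ a - p $ b\<close> can be cancelled.\<close>
        have "(dir a \<bullet> dir a) * (p $ a - p $ b) * (y a - y b) = y a * drv a b p + y b * drv b a p"
          using l same_line[OF l] by (simp add: drv_same algebra_simps)
        also have "\<dots> = 0" by (rule flex[OF ab])
        finally have "y a = y b" using coord_distinct[OF \<open>a \<noteq> b\<close>] dir_nonzero[of a] by simp
        then show ?thesis using l True b m(2) by (simp add: rate_def)
      next
        case l: False
        have "rate X a b p = 2 * m * (y a * drv a b p + y b * drv b a p)"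
          using l True b m(2) by (simp add: rate_def algebra_simps)
        then show ?thesis using flex[OF ab] by simp
      qed
    qed
  qed
  have bdd: "bounded {q. \<forall>(a, b)\<in>E'. \<bar>slen a b q - slen a b p\<bar> \<le> 1}"
  proof (rule slen_bounded[OF E'(2)])
    fix C :: "'v set" and i
    assume C: "C \<noteq> {}" "\<forall>a\<in>C. \<forall>b. (a, b) \<in> E' \<longrightarrow> b \<in> C"
    show "\<exists>a\<in>C. lab a \<noteq> i"
    proof (rule ccontr)
      assume "\<not> ?thesis"
      then have i: "\<forall>a\<in>C. lab a = i" by auto
      \<comment> \<open>Only the deleted edge can leave \<open>C\<close>, and in just one of its
        orientations; excluding each orientation in turn gives a contradiction.\<close>
      from two_edges_leave[OF C(1) i, of u v] two_edges_leave[OF C(1) i, of v u] C(2)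
      show False by (auto simp: E'_def)
    qed
  qed
  have slen_uv: "slen v u q = slen v u p" if "slen u v q = slen u v p" for q by (rule slen_commute[OF that])
  have alt: "q = p \<or> centred \<and> q = - p" if "\<And>a b. (a, b) \<in> E' \<Longrightarrow> slen a b q = slen a b p" "slen u v q = slen u v p" for q
  proof (rule global)
    fix a b assume "(a, b) \<in> E"
    then have "slen a b q = slen a b p" using that slen_uv by (auto simp: E'_def)
    then show "len a b q = len a b p" by (rule len_slen)
  qed
  \<comment> \<open>\<open>\<sigma>\<close> will be the derivative of \<open>g\<close> along
    \<open>X\<close> at \<open>p\<close>. If it is nonzero, the product at \<open>p\<close> is a
    positive square, so the point \<open>q\<close> found here differs from \<open>p\<close>.\<close>
  have turn: "\<exists>q. (\<forall>(a, b)\<in>I. slen a b q = slen a b p) \<and> g q = g p \<and> \<sigma> * (\<Sum>v\<in>UNIV. X v q * g' v q) \<le> 0"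
    if I: "E' \<subseteq> I" "\<And>a b q. (a, b) \<in> I \<Longrightarrow> a \<noteq> b \<and> rate X a b q = 0"
      and g: "continuous_on UNIV g" "\<And>v. continuous_on UNIV (g' v)" "\<And>v. has_partial g v (g' v)"
    for I g g' and \<sigma> :: real
  proof -
    have "\<exists>q. (\<forall>e\<in>I. slen (fst e) (snd e) q = slen (fst e) (snd e) p) \<and> g q = g p \<and>
       (\<Sum>v\<in>UNIV. (\<sigma> * X v q) * g' v q) \<le> 0"
    proof (rule divergence_free_level_set[where X' = "\<lambda>v q. \<sigma> * X' v q" and \<phi>' = "\<lambda>e. slen' (fst e) (snd e)"])
      show "has_partial (\<lambda>q. \<sigma> * X v q) v (\<lambda>q. \<sigma> * X' v q)" for v
        using has_partial_mult[OF has_partial_const X'(2), of \<sigma> v] by simp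
      show "(\<Sum>v\<in>UNIV. \<sigma> * X' v q) = 0" for q using X'(3) by (simp flip: sum_distrib_left)
      show "(\<Sum>v\<in>UNIV. \<sigma> * X v q * slen' (fst e) (snd e) v q) = 0" if "e \<in> I" for e q
        using rate_sum[of "fst e" "snd e" X q] I(2)[of "fst e" "snd e" q] that
        by (simp add: mult.assoc flip: sum_distrib_left)
      show "bounded {q. \<forall>e\<in>I. \<bar>slen (fst e) (snd e) q - slen (fst e) (snd e) p\<bar> \<le> 1}"
        by (rule bounded_subset[OF bdd]) (use I(1) in \<open>force dest!: subsetD\<close>)
    qed (use g X' in \<open>auto intro!: continuous_intros poly_fun_continuous[OF pX] slen_continuous slen_partial\<close>)
    then show ?thesis by (simp add: mult.assoc sum_distrib_left case_prod_beta)
  qed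
  show False
  proof (cases "rate X u v p = 0")
    case True
    have uv0: "rate X u v q = 0" "rate X v u q = 0" for q
      using rate_generic[OF pX True, of q] by (auto simp: rate_def algebra_simps split: if_splits)
    have r: "a \<noteq> b \<and> rate X a b q = 0" if "(a, b) \<in> E" for a b q
    proof (cases "(a, b) \<in> E'")
      case True
      then show ?thesis using rate' that irrefl_E by blast
    next
      case False
      then show ?thesis using uv0 that \<open>u \<noteq> v\<close> by (auto simp: E'_def)
    qed
    have c: "continuous_on UNIV (\<lambda>q :: real ^ 'v. q $ w)"
      "\<And>v. continuous_on UNIV (\<lambda>q :: real ^ 'v. if v = w then 1 else 0 :: real)"
      by (auto intro: continuous_intros)
    obtain q where q: "\<forall>(a, b)\<in>E. slen a b q = slen a b p" "q $ w = p $ w"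
      "X w p * (\<Sum>v\<in>UNIV. X v q * (if v = w then 1 else 0)) \<le> 0"
      using turn[OF E'(1) r c has_partial_coord] by blast
    have "q = p \<or> q = - p" using alt[of q] q(1) E'(1) uv by blast
    moreover have "q \<noteq> p"
    proof
      assume "q = p"
      then have "X w p * X w p \<le> 0" using q(3) by (simp add: if_distrib cong: if_cong)
      moreover have "X w p \<noteq> 0" using m S(1) w by simp
      ultimately show False by (auto simp: mult_le_0_iff)
    qed
    moreover have "q \<noteq> - p" using q(2) coord_nonzero[of w] by auto
    ultimately show False by blast
  next
    case False
    have r: "a \<noteq> b \<and> rate X a b q = 0" if "(a, b) \<in> E'" for a b q
      using that rate' irrefl_E E'(1) by blast
    obtain q where q: "\<forall>(a, b)\<in>E'. slen a b q = slen a b p" "slen u v q = slen u v p"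
      "rate X u v p * (\<Sum>z\<in>UNIV. X z q * slen' u v z q) \<le> 0"
      using turn[OF order_refl r slen_continuous slen_partial] by blast
    have le: "rate X u v p * rate X u v q \<le> 0" using q(3) rate_sum[OF \<open>u \<noteq> v\<close>] by simp
    have "q \<noteq> p" using le False by (auto simp: mult_le_0_iff)
    then have c: "centred" "q = - p" using alt[of q] q by auto
    have "lab a \<noteq> lab b" if "(a, b) \<in> E" for a b
    proof
      assume l: "lab a = lab b"
      have "slen a b q = slen a b p" using q that slen_uv by (auto simp: E'_def)
      then have "p $ a = p $ b" using l c(2) by (simp add: slen_def)
      then show False using coord_distinct[of a b] that irrefl_E by auto
    qed
    note across = this
    have "even (card S)"
      using tree_field_even[OF S(2) E'_def c(1) across S(3) rate'] .
    moreover have "- X z (- p) = (-1) ^ card S * X z p" for z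
      using S(2) c(1) unfolding tree_field_def by blast
    ultimately have "X z q = - X z p" for z using c(2) by (simp add: minus_equation_iff[of "X z p"]) (metis minus_minus)
    \<comment> \<open>Both the field and each \<open>drv\<close> change sign, so the rate at
      \<open>- p\<close> equals that at \<open>p\<close>, and its product with itself would be
      nonpositive.\<close>
    then have "rate X u v q = rate X u v p"
      using across[OF uv] c(2) drv_centred[OF c(1)] by (simp add: rate_def)
    then show False using le False by (auto simp: mult_le_0_iff)
  qed
qed

end

section \<open>Lines and their isometries\<close>

definition param_line :: "real ^ 'd \<Rightarrow> real ^ 'd \<Rightarrow> (real ^ 'd) set" where
  "param_line a b = range (\<lambda>t. a + t *\<^sub>R b)"

lemma range_reparametrise:
  assumes "\<And>t. f t = g (h t)" "\<And>t. g t = f (h' t)" shows "range f = range g"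
proof (intro equalityI image_subsetI)
  show "f t \<in> range g" for t by (subst assms(1)) (rule rangeI)
  show "g t \<in> range f" for t by (subst assms(2)) (rule rangeI)
qed

lemma param_line_shift: "param_line (a + s *\<^sub>R b) b = param_line a b"
  unfolding param_line_def
  by (rule range_reparametrise[where h = "\<lambda>t. s + t" and h' = "\<lambda>t. t - s"]) (simp_all add: algebra_simps)

lemma is_line_param:
  assumes "is_line L"
  obtains a b where "L = param_line a b" "b \<noteq> 0"
proof -
  obtain B where B: "affine hull B = L" "\<not> affine_dependent B" "int (card B) = 2"
    using aff_dim_basis_exists[of L] assms hull_same[of affine L] unfolding is_line_def by auto
  then have "card B = 2" by simp
  then obtain x y where xy: "B = {x, y}" "x \<noteq> y" by (auto simp: card_2_iff)
  have "L = param_line x (y - x)"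
    unfolding B(1)[symmetric] xy(1) affine_hull_2_alt param_line_def by auto
  then show ?thesis using that xy(2) by simp
qed

lemma coeff_rhs_solves_system:
  fixes x :: "real ^ 'd::{finite,linorder}"
  assumes C: "C \<in> carrier_mat (CARD('d) - 1) (CARD('d) + 1)"
  shows "coeff_part C *\<^sub>v coords x = rhs_part C \<longleftrightarrow>
    solves_system C CARD('d) (\<lambda>j. x $ (sorted_list_of_set (UNIV :: 'd set) ! j))"
proof -
  have "Matrix.vec_index (coeff_part C *\<^sub>v coords x) i
      = (\<Sum>j<CARD('d). C $$ (i,j) * x $ (sorted_list_of_set (UNIV :: 'd set) ! j))" if "i < CARD('d) - 1" for i
    using that C by (simp add: coeff_part_def coords_def scalar_prod_def lessThan_atLeast0)
  moreover have "Matrix.vec_index (rhs_part C) i = C $$ (i, CARD('d))" if "i < CARD('d) - 1" for i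
    using that C by (simp add: rhs_part_def)
  ultimately show ?thesis
    using C by (auto simp: Matrix.vec_eq_iff solves_system_def coeff_part_def rhs_part_def)
qed

text \<open>The free column of the reduced row echelon form is the last coordinate in which the
  direction is nonzero. With the direction scaled to 1 and the base point moved to 0 there, their
  remaining coordinates are, up to sign, entries of the matrix.\<close>

lemma line_param_in_field:
  fixes L :: "(real ^ 'd::{finite,linorder}) set"
  assumes "is_line L" and K: "is_subfield K" "elements_mat (standard_equation L) \<subseteq> K"
  obtains a b where "L = param_line a b" "b \<noteq> 0" "\<And>c. a $ c \<in> K" "\<And>c. b $ c \<in> K"
proof -
  obtain a w where L: "L = param_line a w" and w: "w \<noteq> 0" using is_line_param[OF assms(1)] .
  define n where "n = CARD('d)"
  define e where "e j = sorted_list_of_set (UNIV :: 'd set) ! j" for j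
  have be: "bij_betw e {..<n} UNIV"
    using bij_betw_nth[of "sorted_list_of_set (UNIV :: 'd set)" "{..<n}" UNIV]
    by (simp add: n_def e_def[abs_def])
  have char: "x = y \<longleftrightarrow> (\<forall>j<n. x $ e j = y $ e j)" for x y :: "real ^ 'd::{finite,linorder}"
    using be unfolding Finite_Cartesian_Product.vec_eq_iff bij_betw_def by (metis UNIV_I imageE lessThan_iff)
  define c where "c = Max {j. j < n \<and> w $ e j \<noteq> 0}"
  have "\<exists>j<n. w $ e j \<noteq> 0" using w unfolding char by auto
  then have "c \<in> {j. j < n \<and> w $ e j \<noteq> 0}" unfolding c_def by (intro Max_in) auto
  then have c: "c < n" "w $ e c \<noteq> 0" by auto
  have z: "w $ e j = 0" if "c < j" "j < n" for j
    using that Max_ge[of "{j. j < n \<and> w $ e j \<noteq> 0}" j] unfolding c_def by (auto simp: not_less[symmetric])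
  define M where "M = line_mat n c (\<lambda>j. a $ e j) (\<lambda>j. w $ e j)"
  have M: "M \<in> carrier_mat (n - 1) (n + 1)" by (simp add: M_def line_mat_def)
  have "is_standard_equation M L"
    unfolding is_standard_equation_def n_def[symmetric]
  proof (intro conjI M)
    show "row_echelon_form M"
      unfolding M_def by (rule line_mat_echelon[where u = "\<lambda>j. w $ e j", OF c(1) z])
    have "x \<in> L \<longleftrightarrow> coeff_part M *\<^sub>v coords x = rhs_part M" for x
    proof -
      have "x \<in> L \<longleftrightarrow> (\<exists>t. \<forall>j<n. x $ e j = a $ e j + t * w $ e j)"
        unfolding L param_line_def by (simp add: image_iff char)
      also have "\<dots> \<longleftrightarrow> solves_system M n (\<lambda>j. x $ e j)"
        unfolding M_def by (rule line_mat_solves[where u = "\<lambda>j. w $ e j", OF c, symmetric])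
      also have "\<dots> \<longleftrightarrow> coeff_part M *\<^sub>v coords x = rhs_part M"
        using coeff_rhs_solves_system[of M x] M by (simp add: n_def e_def)
      finally show ?thesis .
    qed
    then show "L = {x. coeff_part M *\<^sub>v coords x = rhs_part M}" by blast
  qed
  then have "standard_equation L = M"
    using standard_equation_ex1[OF assms(1)] is_standard_equation_standard_equation[OF assms(1)] by blast
  then have MK: "M $$ (i, j) \<in> K" if "i < n - 1" "j < n + 1" for i j
    using that M K(2) elements_matI[OF M that refl] by auto
  define b where "b = (1 / w $ e c) *\<^sub>R w"
  define a' where "a' = a + (- a $ e c) *\<^sub>R b"
  have "a' $ e j \<in> K \<and> b $ e j \<in> K" if j: "j < n" for j
  proof (cases "j = c")
    case True
    then show ?thesis using c(2) K(1) by (simp add: a'_def b_def is_subfield_def)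
  next
    case False
    then obtain i where i: "i < n - 1" "j = skip_index c i" using skip_cover[OF c(1) j] by blast
    have sk: "skip_index c i < n" "skip_index c i \<noteq> c" using skip_less[OF c(1) i(1)] by auto
    have "M $$ (i, n) = a' $ e j"
      using i(1) c(1) sk unfolding i(2) by (simp add: M_def line_mat_def a'_def b_def)
    moreover have "M $$ (i, c) = - b $ e j"
      using i(1) c(1) sk unfolding i(2) by (simp add: M_def line_mat_def b_def)
    ultimately show ?thesis using MK[of i n] MK[of i c] i c K(1)
      unfolding is_subfield_def by (metis add.inverse_inverse less_add_one trans_less_add1)
  qed
  moreover have "\<exists>j<n. i = e j" for i using be by (metis UNIV_I bij_betw_def imageE lessThan_iff)
  ultimately have inK: "a' $ i \<in> K" "b $ i \<in> K" for i by metis+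
  have "L = param_line a b"
    unfolding L param_line_def
    by (rule range_reparametrise[where h = "\<lambda>t. t * w $ e c" and h' = "\<lambda>t. t / w $ e c"])
      (use c(2) in \<open>simp_all add: b_def\<close>)
  then have "L = param_line a' b" unfolding a'_def param_line_shift .
  moreover have "b \<noteq> 0" using w c(2) by (simp add: b_def)
  ultimately show ?thesis using that inK by blast
qed

text \<open>Adding a kernel vector to a point of \<open>L\<close> gives another point of
  \<open>L\<close>.\<close>

lemma coeff_part_kernel:
  fixes L :: "(real ^ 'd::{finite,linorder}) set"
  assumes "is_line L" and L: "L = param_line a b"
    and f: "coeff_part (standard_equation L) *\<^sub>v coords f = 0\<^sub>v (CARD('d) - 1)"
  shows "\<exists>s. f = s *\<^sub>R b"
proof -
  define C where "C = coeff_part (standard_equation L)"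
  have se: "standard_equation L \<in> carrier_mat (CARD('d) - 1) (CARD('d) + 1)"
    "L = {x. C *\<^sub>v coords x = rhs_part (standard_equation L)}"
    using is_standard_equation_standard_equation[OF assms(1)] by (auto simp: is_standard_equation_def C_def)
  have mem: "x \<in> L \<longleftrightarrow> C *\<^sub>v coords x = rhs_part (standard_equation L)" for x
    using eqset_imp_iff[OF se(2), of x] by (simp only: mem_Collect_eq)
  have C: "C \<in> carrier_mat (CARD('d) - 1) CARD('d)" using se(1) by (auto simp: C_def coeff_part_def)
  have co: "coords x \<in> carrier_vec CARD('d)" for x :: "real ^ 'd::{finite,linorder}" by (simp add: coords_def)
  have "a \<in> L" unfolding L param_line_def by (rule range_eqI[of _ _ 0]) simp
  have "coords (a + f) = coords a + coords f" by (auto simp: coords_def)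
  then have "C *\<^sub>v coords (a + f) = C *\<^sub>v coords a + 0\<^sub>v (CARD('d) - 1)"
    using mult_add_distrib_mat_vec[OF C co co, of a f] f by (simp add: C_def)
  also have "\<dots> = C *\<^sub>v coords a" by (rule right_zero_vec[OF mult_mat_vec_carrier[OF C co]])
  finally have "a + f \<in> L" using \<open>a \<in> L\<close> by (simp only: mem)
  then show ?thesis unfolding L param_line_def by auto
qed

section \<open>Closest points and isometries of two lines\<close>

lemma cramer_two:
  fixes A B k X Y :: real
  assumes "A * B - k * k \<noteq> 0"
  defines "s \<equiv> (k * Y - B * X) / (A * B - k * k)" and "t \<equiv> (A * Y - k * X) / (A * B - k * k)"
  shows "X + s * A - t * k = 0" "Y + s * k - t * B = 0"
proof -
  define D where "D = A * B - k * k"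
  have D: "D \<noteq> 0" "s = (k * Y - B * X) / D" "t = (A * Y - k * X) / D" using assms by (simp_all add: D_def)
  have "X + s * A - t * k = (D * X + (k * Y - B * X) * A - (A * Y - k * X) * k) / D"
    "Y + s * k - t * B = (D * Y + (k * Y - B * X) * k - (A * Y - k * X) * B) / D"
    unfolding D(2,3) using D(1) by (simp_all add: add_divide_distrib diff_divide_distrib left_diff_distrib)
  then show "X + s * A - t * k = 0" "Y + s * k - t * B = 0"
    by (simp_all add: D_def algebra_simps)
qed

text \<open>The feet of the common perpendicular solve a linear system over \<open>K\<close> whose
  determinant is the Gram determinant. Recentring the lines there therefore keeps the coordinates in
  \<open>K\<close>.\<close>

lemma closest_points_in_field:
  fixes a b c d :: "real ^ 'd::finite"
  assumes K: "is_subfield K" and inK: "\<And>i. a $ i \<in> K" "\<And>i. b $ i \<in> K" "\<And>i. c $ i \<in> K" "\<And>i. d $ i \<in> K"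
    and np: "(b \<bullet> d)\<^sup>2 < (b \<bullet> b) * (d \<bullet> d)"
  shows "\<exists>s\<in>K. \<exists>t\<in>K. ((a + s *\<^sub>R b) - (c + t *\<^sub>R d)) \<bullet> b = 0 \<and> ((a + s *\<^sub>R b) - (c + t *\<^sub>R d)) \<bullet> d = 0"
proof -
  define D where "D = (b \<bullet> b) * (d \<bullet> d) - (b \<bullet> d) * (b \<bullet> d)"
  define s where "s = ((b \<bullet> d) * ((a - c) \<bullet> d) - (d \<bullet> d) * ((a - c) \<bullet> b)) / D"
  define t where "t = ((b \<bullet> b) * ((a - c) \<bullet> d) - (b \<bullet> d) * ((a - c) \<bullet> b)) / D"
  have D: "D \<noteq> 0" using np by (simp add: D_def power2_eq_square)
  have mul: "x * y \<in> K" if "x \<in> K" "y \<in> K" for x y using that K by (simp add: is_subfield_def)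
  have ac: "(a - c) $ i \<in> K" for i using inK K by (simp add: is_subfield_diff)
  note inner = is_subfield_inner[OF K]
  have "s \<in> K" "t \<in> K"
    unfolding s_def t_def D_def
    by (intro is_subfield_divide[OF K] is_subfield_diff[OF K] mul inner inK ac)+
  note st = this
  have e: "((a + s *\<^sub>R b) - (c + t *\<^sub>R d)) \<bullet> x = (a - c) \<bullet> x + s * (b \<bullet> x) - t * (d \<bullet> x)" for x
    by (simp add: inner_diff_left inner_add_left)
  have "(a - c) \<bullet> b + s * (b \<bullet> b) - t * (b \<bullet> d) = 0" "(a - c) \<bullet> d + s * (b \<bullet> d) - t * (d \<bullet> d) = 0"
    unfolding s_def t_def D_def using D by (intro cramer_two; simp add: D_def)+
  then have "((a + s *\<^sub>R b) - (c + t *\<^sub>R d)) \<bullet> b = 0" "((a + s *\<^sub>R b) - (c + t *\<^sub>R d)) \<bullet> d = 0"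
    unfolding e by (simp_all add: inner_commute)
  then show ?thesis using st by blast
qed

text \<open>The two orthogonality hypotheses say that \<open>a\<close> and \<open>c\<close> are the mutually closest points of the lines.\<close>

lemma centred_dist:
  fixes a b c d :: "real ^ 'd::finite"
  assumes "(a - c) \<bullet> b = 0" "(a - c) \<bullet> d = 0"
  shows "(dist (a + s *\<^sub>R b) (c + t *\<^sub>R d))\<^sup>2
    = (norm (a - c))\<^sup>2 + (s\<^sup>2 * (b \<bullet> b) + t\<^sup>2 * (d \<bullet> d) - 2 * (b \<bullet> d) * (s * t))"
proof -
  have eq: "a + s *\<^sub>R b - (c + t *\<^sub>R d) = (a - c) + (s *\<^sub>R b - t *\<^sub>R d)" by simp
  have "(norm (x + y))\<^sup>2 = (norm x)\<^sup>2 + 2 * (x \<bullet> y) + (norm y)\<^sup>2" for x y :: "real ^ 'd"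
    unfolding power2_norm_eq_inner by (simp add: inner_add_left inner_add_right inner_commute)
  moreover have "(a - c) \<bullet> (s *\<^sub>R b - t *\<^sub>R d) = 0" using assms by (simp add: inner_diff_right)
  moreover have "(norm (s *\<^sub>R b - t *\<^sub>R d))\<^sup>2 = s\<^sup>2 * (b \<bullet> b) + t\<^sup>2 * (d \<bullet> d) - 2 * (b \<bullet> d) * (s * t)"
    unfolding power2_norm_eq_inner
    by (simp add: inner_diff_left inner_diff_right inner_commute power2_eq_square algebra_simps)
  ultimately show ?thesis unfolding dist_norm eq by simp
qed

lemma quadratic_form_pos:
  fixes A B k s t :: real
  assumes "k\<^sup>2 < A * B" "A > 0"
  shows "s\<^sup>2 * A + t\<^sup>2 * B - 2 * k * (s * t) \<ge> 0"
    and "s\<^sup>2 * A + t\<^sup>2 * B - 2 * k * (s * t) = 0 \<Longrightarrow> s = 0 \<and> t = 0"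
proof -
  have eq: "A * (s\<^sup>2 * A + t\<^sup>2 * B - 2 * k * (s * t)) = (A * s - k * t)\<^sup>2 + (A * B - k\<^sup>2) * t\<^sup>2"
    by (simp add: power2_eq_square algebra_simps)
  have nn: "(A * B - k\<^sup>2) * t\<^sup>2 \<ge> 0" using assms by simp
  then have "A * (s\<^sup>2 * A + t\<^sup>2 * B - 2 * k * (s * t)) \<ge> 0" unfolding eq by simp
  then show "s\<^sup>2 * A + t\<^sup>2 * B - 2 * k * (s * t) \<ge> 0" using assms(2) by (simp add: zero_le_mult_iff)
  assume "s\<^sup>2 * A + t\<^sup>2 * B - 2 * k * (s * t) = 0"
  then have 0: "(A * s - k * t)\<^sup>2 + (A * B - k\<^sup>2) * t\<^sup>2 = 0" unfolding eq[symmetric] by simp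
  then have "(A * B - k\<^sup>2) * t\<^sup>2 = 0" "(A * s - k * t)\<^sup>2 = 0"
    using nn zero_le_power2[of "A * s - k * t"] by linarith+
  then show "s = 0 \<and> t = 0" using assms by auto
qed

lemma centred_is_closest_point:
  fixes a b c d :: "real ^ 'd::finite"
  assumes o: "(a - c) \<bullet> b = 0" "(a - c) \<bullet> d = 0" and np: "(b \<bullet> d)\<^sup>2 < (b \<bullet> b) * (d \<bullet> d)" "b \<noteq> 0"
  shows "is_closest_point a (param_line a b) (param_line c d)"
proof -
  have A: "b \<bullet> b > 0" using np(2) by simp
  have ge: "dist a c \<le> infdist (a + s *\<^sub>R b) (param_line c d)" for s
  proof -
    have "dist a c \<le> dist (a + s *\<^sub>R b) (c + t *\<^sub>R d)" for t
    proof (rule power2_le_imp_le)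
      show "(dist a c)\<^sup>2 \<le> (dist (a + s *\<^sub>R b) (c + t *\<^sub>R d))\<^sup>2"
        unfolding centred_dist[OF o] using quadratic_form_pos(1)[OF np(1) A, of s t] by (simp add: dist_norm)
    qed simp
    then show ?thesis
      unfolding infdist_def by (auto simp: param_line_def intro!: cINF_greatest)
  qed
  have "c \<in> param_line c d" unfolding param_line_def by (rule range_eqI[of _ _ 0]) simp
  then have "infdist a (param_line c d) \<le> dist a c" by (rule infdist_le)
  moreover have "a \<in> param_line a b" unfolding param_line_def by (rule range_eqI[of _ _ 0]) simp
  ultimately show ?thesis
    unfolding is_closest_point_def is_arg_min_def using ge
    by (auto simp: param_line_def) (meson not_less order_trans)
qed

text \<open>Distances across the two lines suffice. Positive definiteness forces both base points to
  be fixed, and then each parameter is kept up to sign. As the lines are not perpendicular, the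
  mixed term links the signs to one \<open>\<epsilon>\<close> for both lines.\<close>

lemma isometry_two_lines:
  fixes a b c d :: "real ^ 'd::finite"
  assumes o: "(a - c) \<bullet> b = 0" "(a - c) \<bullet> d = 0"
    and np: "(b \<bullet> d)\<^sup>2 < (b \<bullet> b) * (d \<bullet> d)" "b \<bullet> d \<noteq> 0" "b \<noteq> 0" "d \<noteq> 0"
    and th: "\<theta> ` param_line a b \<subseteq> param_line a b" "\<theta> ` param_line c d \<subseteq> param_line c d"
    and iso: "\<And>x y. x \<in> param_line a b \<Longrightarrow> y \<in> param_line c d \<Longrightarrow> dist (\<theta> x) (\<theta> y) = dist x y"
  shows "\<exists>\<epsilon>. (\<epsilon> = 1 \<or> \<epsilon> = -1) \<and> (\<forall>t. \<theta> (a + t *\<^sub>R b) = a + (\<epsilon> * t) *\<^sub>R b) \<and> (\<forall>t. \<theta> (c + t *\<^sub>R d) = c + (\<epsilon> * t) *\<^sub>R d)"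
proof -
  have "\<forall>s. \<exists>s'. \<theta> (a + s *\<^sub>R b) = a + s' *\<^sub>R b" "\<forall>t. \<exists>t'. \<theta> (c + t *\<^sub>R d) = c + t' *\<^sub>R d"
    using th unfolding param_line_def by blast+
  then obtain f g where f: "\<And>s. \<theta> (a + s *\<^sub>R b) = a + f s *\<^sub>R b" and g: "\<And>t. \<theta> (c + t *\<^sub>R d) = c + g t *\<^sub>R d"
    by metis
  define A B k where "A = b \<bullet> b" "B = d \<bullet> d" "k = b \<bullet> d"
  have AB: "k\<^sup>2 < A * B" "A > 0" "B > 0" "k \<noteq> 0" using np by (auto simp: A_B_k_def)
  have F: "(f s)\<^sup>2 * A + (g t)\<^sup>2 * B - 2 * k * (f s * g t) = s\<^sup>2 * A + t\<^sup>2 * B - 2 * k * (s * t)" for s t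
  proof -
    have "dist (\<theta> (a + s *\<^sub>R b)) (\<theta> (c + t *\<^sub>R d)) = dist (a + s *\<^sub>R b) (c + t *\<^sub>R d)"
      by (rule iso) (auto simp: param_line_def)
    then have "(dist (a + f s *\<^sub>R b) (c + g t *\<^sub>R d))\<^sup>2 = (dist (a + s *\<^sub>R b) (c + t *\<^sub>R d))\<^sup>2"
      by (simp add: f g)
    then show ?thesis unfolding centred_dist[OF o] A_B_k_def by simp
  qed
  have 0: "f 0 = 0 \<and> g 0 = 0" using F[of 0 0] by (intro quadratic_form_pos(2)[OF AB(1,2)]) simp
  have "(f s)\<^sup>2 = s\<^sup>2" "(g t)\<^sup>2 = t\<^sup>2" for s t using F[of s 0] F[of 0 t] 0 AB by simp_all
  then have fg: "f s * g t = s * t" for s t using F[of s t] AB by simp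
  have e: "f 1 = 1 \<or> f 1 = -1" using \<open>\<And>s. (f s)\<^sup>2 = s\<^sup>2\<close>[of 1] by (simp add: power2_eq_1_iff)
  have gt: "g t = f 1 * t" for t using fg[of 1 t] e by auto
  have ft: "f s = f 1 * s" for s using fg[of s 1] gt[of 1] e by auto
  show ?thesis using e f g ft gt by (intro exI[of _ "f 1"]) metis
qed

lemma param_line_directions:
  fixes a b c d :: "real ^ 'd::finite"
  assumes "b \<noteq> 0" "d \<noteq> 0"
    and np: "\<not> affine_parallel (param_line a b) (param_line c d)"
    and npp: "\<not> perpendicular (param_line a b) (param_line c d)"
  shows "b \<bullet> d \<noteq> 0" "(b \<bullet> d)\<^sup>2 < (b \<bullet> b) * (d \<bullet> d)"
proof -
  show k: "b \<bullet> d \<noteq> 0"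
  proof
    assume "b \<bullet> d = 0"
    moreover have "(a + x *\<^sub>R b) - (a + y *\<^sub>R b) = (x - y) *\<^sub>R b" for x y and a b :: "real ^ 'd"
      by (simp add: algebra_simps)
    ultimately have "perpendicular (param_line a b) (param_line c d)"
      by (auto simp: perpendicular_def param_line_def)
    then show False using npp by blast
  qed
  show "(b \<bullet> d)\<^sup>2 < (b \<bullet> b) * (d \<bullet> d)"
  proof (rule ccontr)
    assume n: "\<not> ?thesis"
    \<comment> \<open>\<open>r\<close> is \<open>d \<bullet> d\<close> times the part of
      \<open>b\<close> orthogonal to \<open>d\<close>; failure of the strict inequality makes it
      zero.\<close>
    define r where "r = (d \<bullet> d) *\<^sub>R b - (b \<bullet> d) *\<^sub>R d"
    have d: "d \<bullet> d > 0" using assms(2) by simp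
    have "r \<bullet> r = (d \<bullet> d) * ((b \<bullet> b) * (d \<bullet> d) - (b \<bullet> d)\<^sup>2)"
      by (simp add: r_def inner_diff_left inner_diff_right inner_commute power2_eq_square algebra_simps)
    also have "\<dots> \<le> 0" using n d by (simp add: mult_le_0_iff)
    finally have "r = 0" by (metis inner_ge_zero inner_eq_zero_iff order_antisym)
    define m where "m = (b \<bullet> d) / (d \<bullet> d)"
    have "(d \<bullet> d) *\<^sub>R b = (d \<bullet> d) *\<^sub>R (m *\<^sub>R d)" using \<open>r = 0\<close> d by (simp add: r_def m_def)
    then have b: "b = m *\<^sub>R d" using d by (metis scaleR_cancel_left less_irrefl)
    have m: "m \<noteq> 0" using d k by (simp add: m_def)
    have "param_line c d = (+) (c - a) ` param_line a b"
      unfolding param_line_def image_image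
      by (rule range_reparametrise[where h = "\<lambda>t. t / m" and h' = "\<lambda>t. t * m"]) (use m in \<open>simp_all add: b\<close>)
    then show False using np by (auto simp: affine_parallel_def)
  qed
qed

text \<open>A supremum of cardinalities equal to a positive \<open>n\<close> is reached, since
  otherwise \<open>n - 1\<close> would be an upper bound.\<close>

lemma transcendence_degree_witness:
  assumes "transcendence_degree K F = enat n" "0 < n"
  obtains B where "finite B" "B \<subseteq> F" "algebraically_independent K B" "n \<le> card B"
proof -
  define \<B> where "\<B> = {B. B \<subseteq> F \<and> finite B \<and> algebraically_independent K B}"
  have "\<exists>B\<in>\<B>. n \<le> card B"
  proof (rule ccontr)
    assume "\<not> ?thesis"
    then have lt: "card B < n" if "B \<in> \<B>" for B using that by force
    have "transcendence_degree K F \<le> enat (n - 1)"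
      unfolding transcendence_degree_def \<B>_def[symmetric] using lt assms(2)
      by (intro SUP_least) (fastforce simp: less_eq_Suc_le)
    then show False using assms by simp
  qed
  then show ?thesis using that by (auto simp: \<B>_def)
qed

section \<open>Coordinates and isometries for lines in general position\<close>

lemma field_of_lines_coordinates:
  fixes L :: "nat \<Rightarrow> (real ^ 'd::{finite,linorder}) set"
  assumes "i \<in> {1..k}" "is_line (L i)"
  obtains a b where "L i = param_line a b" "b \<noteq> 0" "\<And>c. a $ c \<in> field_of_lines k L" "\<And>c. b $ c \<in> field_of_lines k L"
proof (rule line_param_in_field[OF assms(2)])
  show "is_subfield (field_of_lines k L)" unfolding field_of_lines_def by (rule is_subfield_hull)
  show "elements_mat (standard_equation (L i)) \<subseteq> field_of_lines k L"
    unfolding field_of_lines_def using assms(1) by (intro order_trans[OF _ hull_subset]) auto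
qed (rule that)

lemma general_position_directions:
  fixes L :: "nat \<Rightarrow> (real ^ 'd::finite) set"
  assumes "inj_on L {1..k}" "general_position (L ` {1..k})" "i \<in> {1..k}" "j \<in> {1..k}" "i \<noteq> j"
    and "L i = param_line a b" "L j = param_line c d" "b \<noteq> 0" "d \<noteq> 0"
  shows "b \<bullet> d \<noteq> 0" "(b \<bullet> d)\<^sup>2 < (b \<bullet> b) * (d \<bullet> d)"
proof -
  have "L i \<noteq> L j" using inj_onD[OF assms(1) _ assms(3,4)] assms(5) by blast
  then have np: "\<not> affine_parallel (L i) (L j)" "\<not> perpendicular (L i) (L j)"
    using assms unfolding general_position_def by blast+
  show "b \<bullet> d \<noteq> 0" "(b \<bullet> d)\<^sup>2 < (b \<bullet> b) * (d \<bullet> d)"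
    by (rule param_line_directions[OF assms(8,9) np[unfolded assms(6,7)]])+
qed

text \<open>Recentring the two distinguished lines at their mutually closest points makes their
  joint reflection the map \<open>q \<mapsto> - q\<close> on parameters, without leaving
  \<open>K\<close>.\<close>

lemma coordinates_centred:
  fixes L :: "nat \<Rightarrow> (real ^ 'd::{finite,linorder}) set"
  assumes lines: "\<forall>i\<in>{1..k}. is_line (L i)" and inj: "inj_on L {1..k}" and gp: "general_position (L ` {1..k})"
  defines "K \<equiv> field_of_lines k L"
  obtains a b where "\<And>l. l \<in> {1..k} \<Longrightarrow> L l = param_line (a l) (b l)" "\<And>l. l \<in> {1..k} \<Longrightarrow> b l \<noteq> 0"
    "\<And>l c. l \<in> {1..k} \<Longrightarrow> a l $ c \<in> K \<and> b l $ c \<in> K"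
    "i \<in> {1..k} \<Longrightarrow> j \<in> {1..k} \<Longrightarrow> i \<noteq> j \<Longrightarrow> (a i - a j) \<bullet> b i = 0 \<and> (a i - a j) \<bullet> b j = 0"
proof -
  have K: "is_subfield K" unfolding K_def field_of_lines_def by (rule is_subfield_hull)
  have "\<forall>l\<in>{1..k}. \<exists>a b. L l = param_line a b \<and> b \<noteq> 0 \<and> (\<forall>c. a $ c \<in> K \<and> b $ c \<in> K)"
  proof
    fix l assume l: "l \<in> {1..k}"
    obtain a b where "L l = param_line a b" "b \<noteq> 0" "\<And>c. a $ c \<in> K" "\<And>c. b $ c \<in> K"
      unfolding K_def using field_of_lines_coordinates[OF l] lines l by blast
    then show "\<exists>a b. L l = param_line a b \<and> b \<noteq> 0 \<and> (\<forall>c. a $ c \<in> K \<and> b $ c \<in> K)" by blast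
  qed
  then obtain a b where ab: "\<And>l. l \<in> {1..k} \<Longrightarrow> L l = param_line (a l) (b l)" "\<And>l. l \<in> {1..k} \<Longrightarrow> b l \<noteq> 0"
    "\<And>l c. l \<in> {1..k} \<Longrightarrow> a l $ c \<in> K \<and> b l $ c \<in> K"
    by metis
  show ?thesis
  proof (cases "i \<in> {1..k} \<and> j \<in> {1..k} \<and> i \<noteq> j")
    case False
    then show ?thesis using that[of a b] ab by blast
  next
    case True
    then have ij: "i \<in> {1..k}" "j \<in> {1..k}" "i \<noteq> j" by auto
    have np: "(b i \<bullet> b j)\<^sup>2 < (b i \<bullet> b i) * (b j \<bullet> b j)"
      using general_position_directions(2)[OF inj gp ij] ab ij by blast
    obtain s t where st: "s \<in> K" "t \<in> K" "((a i + s *\<^sub>R b i) - (a j + t *\<^sub>R b j)) \<bullet> b i = 0"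
      "((a i + s *\<^sub>R b i) - (a j + t *\<^sub>R b j)) \<bullet> b j = 0"
      using closest_points_in_field[OF K _ _ _ _ np, of "a i" "a j"] ab(3) ij by blast
    define a' where "a' = a(i := a i + s *\<^sub>R b i, j := a j + t *\<^sub>R b j)"
    show ?thesis
    proof (rule that[of a' b])
      show "L l = param_line (a' l) (b l)" if "l \<in> {1..k}" for l
        using ab(1)[OF that] by (simp add: a'_def param_line_shift)
      show "a' l $ c \<in> K \<and> b l $ c \<in> K" if "l \<in> {1..k}" for l c
        using ab(3)[OF that] st(1,2) K by (auto simp: a'_def is_subfield_def)
      show "(a' i - a' j) \<bullet> b i = 0 \<and> (a' i - a' j) \<bullet> b j = 0"
        using st(3,4) ij by (simp add: a'_def)
    qed (use ab in auto)
  qed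
qed

text \<open>On \<open>L i\<close> the map is the identity or the reflection in the closest point to
  \<open>L j\<close>, and it also fixes the closest point to \<open>L l\<close>. These points differ
  because the lines are not weakly concurrent, so the reflection is excluded.\<close>

lemma Isom_fixes_third_line:
  fixes L :: "nat \<Rightarrow> (real ^ 'd::finite) set"
  assumes inj: "inj_on L {1..k}" and gp: "general_position (L ` {1..k})"
    and l: "i \<in> {1..k}" "j \<in> {1..k}" "l \<in> {1..k}" "distinct [i, j, l]"
    and ab: "\<And>i. i \<in> {1..k} \<Longrightarrow> L i = param_line (a i) (b i)" "\<And>i. i \<in> {1..k} \<Longrightarrow> b i \<noteq> 0"
    and \<theta>: "\<And>i'. i' \<in> {i, j, l} \<Longrightarrow> \<theta> ` L i' \<subseteq> L i'"
    and iso: "\<And>x y. x \<in> L i \<union> L j \<union> L l \<Longrightarrow> y \<in> L i \<union> L j \<union> L l \<Longrightarrow> dist (\<theta> x) (\<theta> y) = dist x y"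
    and x: "x \<in> L i"
  shows "\<theta> x = x"
proof -
  have closest: "\<exists>c. is_closest_point c (L i) (L m) \<and> c \<in> L i \<and>
      (\<exists>\<epsilon>. (\<epsilon> = 1 \<or> \<epsilon> = -1) \<and> (\<forall>t. \<theta> (c + t *\<^sub>R b i) = c + (\<epsilon> * t) *\<^sub>R b i))" if m: "m \<in> {j, l}" for m
  proof -
    have im: "m \<in> {1..k}" "i \<noteq> m" using l m by auto
    note d = general_position_directions[OF inj gp l(1) im ab(1)[OF l(1)] ab(1)[OF im(1)] ab(2)[OF l(1)] ab(2)[OF im(1)]]
    have "is_subfield UNIV" by (simp add: is_subfield_def)
    then obtain s t where st: "((a i + s *\<^sub>R b i) - (a m + t *\<^sub>R b m)) \<bullet> b i = 0"
      "((a i + s *\<^sub>R b i) - (a m + t *\<^sub>R b m)) \<bullet> b m = 0"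
      using closest_points_in_field[of UNIV "a i" "b i" "a m" "b m"] d(2) by blast
    define c e where "c = a i + s *\<^sub>R b i" "e = a m + t *\<^sub>R b m"
    have Lc: "L i = param_line c (b i)" "L m = param_line e (b m)"
      using ab(1) l(1) im by (simp_all add: c_e_def param_line_shift)
    note st = st[folded c_e_def]
    have "\<exists>\<epsilon>. (\<epsilon> = 1 \<or> \<epsilon> = -1) \<and> (\<forall>t. \<theta> (c + t *\<^sub>R b i) = c + (\<epsilon> * t) *\<^sub>R b i) \<and>
        (\<forall>t. \<theta> (e + t *\<^sub>R b m) = e + (\<epsilon> * t) *\<^sub>R b m)"
      by (rule isometry_two_lines[OF st d(2,1) ab(2)[OF l(1)] ab(2)[OF im(1)]])
        (use \<theta> iso m in \<open>auto simp flip: Lc\<close>)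
    moreover have "is_closest_point c (L i) (L m)"
      unfolding Lc by (rule centred_is_closest_point[OF st d(2) ab(2)[OF l(1)]])
    moreover have "c \<in> L i" unfolding Lc param_line_def by (rule range_eqI[of _ _ 0]) simp
    ultimately show ?thesis by blast
  qed
  obtain c \<epsilon> where c: "is_closest_point c (L i) (L j)" "c \<in> L i" "\<epsilon> = 1 \<or> \<epsilon> = -1"
    "\<And>t. \<theta> (c + t *\<^sub>R b i) = c + (\<epsilon> * t) *\<^sub>R b i" using closest[of j] by auto
  obtain e \<delta> where e: "is_closest_point e (L i) (L l)" "e \<in> L i"
    "\<And>t. \<theta> (e + t *\<^sub>R b i) = e + (\<delta> * t) *\<^sub>R b i" using closest[of l] by auto
  have dist: "L i \<noteq> L j" "L i \<noteq> L l" "L j \<noteq> L l"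
    using inj_onD[OF inj _ l(1,2)] inj_onD[OF inj _ l(1,3)] inj_onD[OF inj _ l(2,3)] l(4) by auto
  have "\<not> weakly_concurrent (L i) (L j) (L l)"
    using gp l dist unfolding general_position_def by simp
  moreover have "\<not> affine_parallel (L i) (L j)" "\<not> affine_parallel (L i) (L l)" "\<not> affine_parallel (L j) (L l)"
    using gp l dist unfolding general_position_def by blast+
  ultimately have "c \<noteq> e" using c(1) e(1) unfolding weakly_concurrent_def by blast
  have par: "\<exists>t. y = c + t *\<^sub>R b i" if y: "y \<in> L i" for y
  proof -
    obtain s r where "c = a i + s *\<^sub>R b i" "y = a i + r *\<^sub>R b i"
      using c(2) y ab(1)[OF l(1)] unfolding param_line_def by auto
    then have "y = c + (r - s) *\<^sub>R b i" by (simp add: algebra_simps)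
    then show ?thesis by blast
  qed
  obtain \<tau> where \<tau>: "e = c + \<tau> *\<^sub>R b i" using par[OF e(2)] by blast
  have "\<theta> e = e" using e(3)[of 0] by simp
  then have "(\<epsilon> * \<tau>) *\<^sub>R b i = \<tau> *\<^sub>R b i" using c(4)[of \<tau>] \<tau> by simp
  then have "\<epsilon> * \<tau> = \<tau>" using ab(2)[OF l(1)] by simp
  then have "\<epsilon> = 1" using \<open>c \<noteq> e\<close> \<tau> by auto
  then show ?thesis using c(4) par[OF x] by auto
qed

theorem theorem4p4:
  fixes k :: nat
    and L :: "nat \<Rightarrow> (real ^ 'd::{finite,linorder}) set"
    and V :: "nat \<Rightarrow> 'v::finite set"
    and E :: "('v \<times> 'v) set"
    and p :: "'v \<Rightarrow> real ^ 'd::{finite,linorder}"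
    and u v :: 'v
  assumes "\<forall>i\<in>{1..k}. is_line (L i)"
    and "inj_on L {1..k}"
    and "general_position (L ` {1..k})"
    and "partitioned_graph k E V"
    and "crossing k V"
    and "p \<in> realisations k L V"
    and "generic_realisation k L p"
    and "globally_rigid k L V E p"
    and "(u, v) \<in> E"
  shows "infinitesimally_rigid k L V (delete_edge E u v) p"
proof -
  define K where "K = field_of_lines k L"
  have K: "is_subfield K" unfolding K_def field_of_lines_def by (rule is_subfield_hull)
  have pg: "sym E" "irrefl E" "disjoint_family_on V {1..k}" "(\<Union>i\<in>{1..k}. V i) = UNIV"
    using assms(4) by (auto simp: partitioned_graph_def)
  define U where "U = {i \<in> {1..k}. V i \<noteq> {}}"
  obtain i j where ij: "i \<in> U" "j \<in> U" "i \<noteq> j" using assms(5) unfolding crossing_def U_def by blast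
  then have ijk: "i \<in> {1..k}" "j \<in> {1..k}" by (auto simp: U_def)
  define lab where "lab w = (SOME l. l \<in> {1..k} \<and> w \<in> V l)" for w
  have lab: "lab w \<in> {1..k}" "w \<in> V (lab w)" for w
  proof -
    have "\<exists>l. l \<in> {1..k} \<and> w \<in> V l" using pg(4) by blast
    from someI_ex[OF this] show "lab w \<in> {1..k}" "w \<in> V (lab w)" unfolding lab_def by auto
  qed
  have labU: "lab w \<in> U" for w using lab[of w] by (auto simp: U_def)
  have lab_eq: "lab w = l" if "l \<in> {1..k}" "w \<in> V l" for w l
    using pg(3) lab[of w] that unfolding disjoint_family_on_def by blast
  \<comment> \<open>The base points are centred on two used lines \<open>i\<close> and
    \<open>j\<close>; if no other line is used, \<open>F.centred\<close> holds.\<close>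
  obtain a b where ab: "\<And>l. l \<in> {1..k} \<Longrightarrow> L l = param_line (a l) (b l)" "\<And>l. l \<in> {1..k} \<Longrightarrow> b l \<noteq> 0"
    "\<And>l c. l \<in> {1..k} \<Longrightarrow> a l $ c \<in> K \<and> b l $ c \<in> K"
    "(a i - a j) \<bullet> b i = 0" "(a i - a j) \<bullet> b j = 0"
    using coordinates_centred[OF assms(1-3), where i = i and j = j] ijk ij(3) unfolding K_def by metis
  have dirs: "b l \<bullet> b m \<noteq> 0" "(b l \<bullet> b m)\<^sup>2 < (b l \<bullet> b l) * (b m \<bullet> b m)"
    if "l \<in> {1..k}" "m \<in> {1..k}" "l \<noteq> m" for l m
    using general_position_directions[OF assms(2,3) that ab(1)[OF that(1)] ab(1)[OF that(2)] ab(2)[OF that(1)] ab(2)[OF that(2)]] .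
  have "\<forall>w. \<exists>t. p w = a (lab w) + t *\<^sub>R b (lab w)"
  proof
    fix w
    have "p w \<in> L (lab w)" using assms(6) lab[of w] unfolding realisations_def by blast
    then show "\<exists>t. p w = a (lab w) + t *\<^sub>R b (lab w)" using ab(1)[OF lab(1)] by (auto simp: param_line_def)
  qed
  then obtain x0 where x0: "\<And>w. p w = a (lab w) + x0 w *\<^sub>R b (lab w)" by metis
  define x where "x = (\<chi> w. x0 w)"
  have px: "p w = a (lab w) + x $ w *\<^sub>R b (lab w)" for w using x0 by (simp add: x_def)
  obtain B where B: "finite B" "B \<subseteq> field_of_realisation k L p" "algebraically_independent K B" "CARD('v) \<le> card B"
    using transcendence_degree_witness[OF assms(7)[unfolded generic_realisation_def]] unfolding K_def by auto
  \<comment> \<open>The coordinates of \<open>p\<close> are affine in the parameters with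
    coefficients in \<open>K\<close>, so the independent set \<open>B\<close> lies in the field
    generated by \<open>K\<close> and \<open>x\<close>.\<close>
  have fr: "field_of_realisation k L p \<subseteq> is_subfield hull (K \<union> range (($) x))"
    unfolding field_of_realisation_def K_def[symmetric]
  proof (rule hull_minimal)
    let ?H = "is_subfield hull (K \<union> range (($) x))"
    have H: "is_subfield ?H" by (rule is_subfield_hull)
    have sub: "K \<subseteq> ?H" "x $ w \<in> ?H" for w using hull_subset[of "K \<union> range (($) x)" is_subfield] by auto
    have "p w $ c \<in> ?H" for w c
    proof -
      have "a (lab w) $ c \<in> ?H" "b (lab w) $ c \<in> ?H" using ab(3)[OF lab(1)] sub(1) by auto
      then show ?thesis using H sub(2)[of w] by (simp add: px is_subfield_def)
    qed
    then show "K \<union> {p w $ c |w c. True} \<subseteq> ?H" using sub(1) by blast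
    show "is_subfield ?H" by (rule H)
  qed
  interpret F: line_framework K "\<lambda>w. a (lab w)" "\<lambda>w. b (lab w)" lab x E
  proof
    show "P q = 0" if "poly_fun K P" "P x = 0" for P q
      using poly_fun_vanish_generic[OF K B(1) order_trans[OF B(2) fr] B(4,3) that] .
    show "(w', w) \<in> E" if "(w, w') \<in> E" for w w' using pg(1) that by (auto dest: symD)
    show "(w, w) \<notin> E" for w using pg(2) by (auto simp: irrefl_def)
  qed (use K ab lab dirs in auto)
  have pt: "F.pt x w = p w" for w by (simp add: F.pt_def px)
  interpret F: globally_rigid_line_framework K "\<lambda>w. a (lab w)" "\<lambda>w. b (lab w)" lab x E
  proof
    obtain w w' where "w \<in> V i" "w' \<in> V j" using ij by (auto simp: U_def)
    then have "lab w = i" "lab w' = j" using lab_eq ijk by auto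
    then show "\<exists>w w'. lab w \<noteq> lab w'" using ij(3) by blast
    fix q assume q: "\<And>w w'. (w, w') \<in> E \<Longrightarrow> F.len w w' q = F.len w w' x"
    have "F.pt q \<in> realisations k L V"
      unfolding realisations_def using ab(1) lab_eq by (auto simp: F.pt_def param_line_def)
    moreover have "measurement E (F.pt q) = measurement E p"
      using q by (auto simp: measurement_def restrict_def F.len_def pt fun_eq_iff)
    ultimately obtain \<theta> where \<theta>: "\<theta> \<in> Isom (used_lines k L V)" "F.pt q = \<theta> \<circ> p"
      using assms(8) by (auto simp: globally_rigid_def)
    have th: "F.pt q w = \<theta> (p w)" for w using \<theta>(2) by (metis comp_apply)
    have Uk: "U \<subseteq> {1..k}" by (auto simp: U_def)
    have used: "L l \<in> used_lines k L V" if "l \<in> U" for l using that by (auto simp: used_lines_def U_def)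
    have im: "\<theta> ` L l \<subseteq> L l" if "l \<in> U" for l using \<theta>(1) used[OF that] by (auto simp: Isom_def)
    have iso: "dist (\<theta> y) (\<theta> z) = dist y z" if "y \<in> L l" "z \<in> L m" "l \<in> U" "m \<in> U" for y z l m
    proof -
      have "\<forall>y\<in>\<Union>(used_lines k L V). \<forall>z\<in>\<Union>(used_lines k L V). dist (\<theta> y) (\<theta> z) = dist y z"
        using \<theta>(1) unfolding Isom_def by simp
      then show ?thesis using UnionI[OF used[OF that(3)] that(1)] UnionI[OF used[OF that(4)] that(2)] by blast
    qed
    show "q = x \<or> F.centred \<and> q = - x"
    proof (cases "U = {i, j}")
      case True
      obtain \<epsilon> where \<epsilon>: "\<epsilon> = 1 \<or> \<epsilon> = -1" "\<And>t. \<theta> (a i + t *\<^sub>R b i) = a i + (\<epsilon> * t) *\<^sub>R b i"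
        "\<And>t. \<theta> (a j + t *\<^sub>R b j) = a j + (\<epsilon> * t) *\<^sub>R b j"
        using isometry_two_lines[OF ab(4,5) dirs(2,1)[OF ijk ij(3)] ab(2)[OF ijk(1)] ab(2)[OF ijk(2)], of \<theta>]
          im[OF ij(1)] im[OF ij(2)] iso[OF _ _ ij(1,2)] ab(1)[OF ijk(1)] ab(1)[OF ijk(2)] by metis
      have "q $ w = \<epsilon> * x $ w" for w
      proof -
        have "lab w = i \<or> lab w = j" using labU[of w] True by auto
        then have "F.pt q w = a (lab w) + (\<epsilon> * x $ w) *\<^sub>R b (lab w)" unfolding th px using \<epsilon> by auto
        then show ?thesis using ab(2)[OF lab(1)[of w]] by (simp add: F.pt_def)
      qed
      then have "q = \<epsilon> *\<^sub>R x" by (simp add: Finite_Cartesian_Product.vec_eq_iff)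
      moreover have "F.centred"
        unfolding F.centred_def
      proof (intro conjI allI exI)
        show l: "lab w = i \<or> lab w = j" for w using labU[of w] True by auto
        have "(a j - a i) \<bullet> b j = 0" using ab(5) by (simp add: inner_diff_left)
        then show "(a (lab w) - a (lab w')) \<bullet> b (lab w) = 0" for w w'
          using l[of w] l[of w'] ab(4) by auto
      qed
      ultimately show ?thesis using \<epsilon>(1) by auto
    next
      case False
      then obtain l where l: "l \<in> U" "l \<noteq> i" "l \<noteq> j" using ij by auto
      have "q $ w = x $ w" for w
      proof -
        \<comment> \<open>With at least three used lines, each vertex has two used lines besides its
          own, and these fix its line pointwise.\<close>
        obtain m m' where m: "m \<in> U" "m' \<in> U" "distinct [lab w, m, m']"
        proof -
          consider "lab w = i" | "lab w = j" | "lab w \<noteq> i" "lab w \<noteq> j" by blast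
          then show ?thesis
          proof cases
            case 1 then show ?thesis using that[of j l] ij l by auto
          next
            case 2 then show ?thesis using that[of i l] ij l by auto
          next
            case 3 then show ?thesis using that[of i j] ij by auto
          qed
        qed
        have mk: "m \<in> {1..k}" "m' \<in> {1..k}" using m Uk by auto
        have "\<theta> (p w) = p w"
        proof (rule Isom_fixes_third_line[OF assms(2,3) lab(1)[of w] mk m(3) ab(1,2)])
          show "\<theta> ` L i' \<subseteq> L i'" if "i' \<in> {lab w, m, m'}" for i'
            using im labU[of w] m that by blast
          show "dist (\<theta> y) (\<theta> z) = dist y z" if "y \<in> L (lab w) \<union> L m \<union> L m'" "z \<in> L (lab w) \<union> L m \<union> L m'" for y z
            using iso labU[of w] m that by blast
          show "p w \<in> L (lab w)" using assms(6) lab[of w] unfolding realisations_def by blast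
        qed
        then have "F.pt q w = F.pt x w" using th pt by simp
        then show ?thesis using ab(2)[OF lab(1)[of w]] by (simp add: F.pt_def)
      qed
      then show ?thesis by (simp add: Finite_Cartesian_Product.vec_eq_iff)
    qed
  qed
  have "f = 0" if f: "f \<in> infinitesimal_flexes k L V (delete_edge E u v) p" for f
  proof -
    have "\<forall>w. \<exists>s. f $ w = s *\<^sub>R b (lab w)"
    proof
      fix w
      have "coeff_part (standard_equation (L (lab w))) *\<^sub>v coords (f $ w) = 0\<^sub>v (CARD('d) - 1)"
        using f lab[of w] by (auto simp: infinitesimal_flexes_def)
      then show "\<exists>s. f $ w = s *\<^sub>R b (lab w)"
        using coeff_part_kernel[OF _ ab(1)[OF lab(1)]] assms(1) lab(1) by blast
    qed
    then obtain y where y: "\<And>w. f $ w = y w *\<^sub>R b (lab w)" by metis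
    have "y w = 0" for w
    proof (rule F.flex_zero[OF assms(9) refl])
      fix c d assume "(c, d) \<in> E - {(u, v), (v, u)}"
      then have "(p c - p d) \<bullet> (f $ c - f $ d) = 0"
        using f by (auto simp: infinitesimal_flexes_def delete_edge_def)
      then show "y c * F.drv c d x + y d * F.drv d c x = 0"
        by (simp add: F.drv_def pt y inner_diff_left inner_diff_right algebra_simps)
    qed
    then show ?thesis using y by (simp add: Finite_Cartesian_Product.vec_eq_iff)
  qed
  then have "infinitesimal_flexes k L V (delete_edge E u v) p \<subseteq> {0}" by blast
  then have "dim (infinitesimal_flexes k L V (delete_edge E u v) p) = 0" by (simp add: dim_eq_0)
  \<comment> \<open>Two distinct lines are used and they are not parallel, so the dimension demanded
    by the definition is 0.\<close>
  moreover have "\<not> (\<forall>M\<in>used_lines k L V. \<forall>N\<in>used_lines k L V. affine_parallel M N)"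
  proof -
    have "L i \<in> used_lines k L V" "L j \<in> used_lines k L V" using ij by (auto simp: used_lines_def U_def)
    moreover have "L i \<noteq> L j" using inj_onD[OF assms(2) _ ijk] ij(3) by blast
    then have "\<not> affine_parallel (L i) (L j)" using assms(3) ijk unfolding general_position_def by blast
    ultimately show ?thesis by blast
  qed
  ultimately show ?thesis unfolding infinitesimally_rigid_def by auto
qed

end
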